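(* (Well-bracketed setting.) Let $\Delta$ be a visibility function, $\sigma$ a stack and $P$ a closed process with $\langle\Delta\mid\sigma\rangle\vdash P$, and suppose $P\xrightarrow{\mu}P'$. Then: (1) if $\mu=\tau$, then either $\sigma=p^{O},p^{I},\sigma''$ for some continuation name $p$ not free in $P'$ and $\langle\Delta\setminus p\mid\sigma''\rangle\vdash P'$, or $\langle\Delta\mid\sigma\rangle\vdash P'$; (2) if $\mu=\overline a\langle v\rangle(b,p)$ then $a\in\Delta(\mathsf{cur})$ and $\langle(\Delta\setminus\mathsf{cur}),b\mapsto\Delta(\mathsf{cur})\cup\{b\},p\mapsto\Delta(\mathsf{cur})\cup\{b\}\mid p^{I},\sigma\rangle\vdash P'$; (3) if $\mu=\overline p\langle v\rangle(b)$ then $\sigma=p^{O},\sigma''$, $p\in\Delta(\mathsf{cur})$ and $\langle(\Delta\setminus\mathsf{cur}),b\mapsto\Delta(\mathsf{cur})\cup\{b\}\mid\sigma''\rangle\vdash P'$; (4) if $\mu=a\langle v\rangle(b,p)$ and $\mathsf{cur}\notin\mathrm{dom}\Delta$, then $\langle\Delta,\mathsf{cur}\mapsto\Delta(a)\cup\{b,p\}\mid p^{O},\sigma\rangle\vdash P'$; (5) if $\mu=p\langle v\rangle(b)$ and $\mathsf{cur}\notin\mathrm{dom}\Delta$, then $\sigma=p^{I},q^{O},\sigma''$ for some $q$ and $\langle(\Delta\setminus p),\mathsf{cur}\mapsto\Delta(p)\cup\{b\}\mid q^{O},\sigma''\rangle\vdash P'$; (6) if $\mu=h\langle v\rangle$,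 or $\mu=\overline h\langle v\rangle$ and $\mathsf{cur}\notin\mathrm{dom}\Delta$, then $\langle\Delta\mid\sigma\rangle\vdash P'$.
   Context: Names are partitioned into server names $a,b,c,d$ (set $N_{ser}$), continuation names $p,q,r$ (set $N_{con}$), first-order names $h,k$, and success names $\omega$; first-order values $v$, variables $x$, expressions $e,f$ (closed ones evaluate, $e\Downarrow v$). Server names carry (first-order value, server name, continuation name); continuation names carry (first-order value, server name); first-order names carry a value. Processes: $P::= a(x,b,p).P\mid p(x,b).P\mid h(x).P\mid \overline a\langle e\rangle(b,p).P\mid\overline p\langle e\rangle(b).P\mid\overline h\langle e\rangle.P\mid\omega.P\mid !\alpha.P\mid P|Q\mid\nu n\,P\mid 0\mid P+Q\mid\mathtt{if}\ e=f\ \mathtt{then}\ P\ \mathtt{else}\ Q$ ($\alpha$ an input prefix, $n$ any non-success name); names in output parentheses are fresh and bound; input parameters are bound. Actions: $\tau$, $a\langle v\rangle(b,p)$, $\overline a\langle v\rangle(b,p)$, $p\langle v\rangle(b)$, $\overline p\langle v\rangle(b)$, $h\langle v\rangle$, $\overline h\langle v\rangle$, $\omega$. Transitions are standard: input prefixes receive values (substituting $v$ for $x$), outputs emit the evaluated value with their fresh names; $\omega.P\xrightarrow{\omega}0$; $!\alpha.P$ behaves as $\alpha.P|!\alpha.P$; restriction passes actions not mentioning the restricted name; sum chooses; matching higher-order input/output in parallel yields $\tau$ with the transmitted bound names restricted ($\nu b\nu p(P'|Q')$ resp. $\nu b(P'|Q')$), first-order communication yields $P'|Q'$; parallel interleaving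 when bound names are not free in the other component; conditional follows the selected branch. A visibility function is a finite partial function $\Delta:N_{ser}\cup N_{con}\cup\{\mathsf{cur}\}\to\mathcal P_{fin}(N_{ser}\cup N_{con})$ that is transitive ($o,n\in\mathrm{dom}\Delta$, $n\in\Delta(o)$ imply $\Delta(n)\subseteq\Delta(o)$). $\Delta,n\mapsto V$ extends ($n\notin\mathrm{dom}\Delta$); $\Delta\setminus n$ erases $n$ from domain and values; $\Delta_1\cup\Delta_2$, $\Delta_1\cap\Delta_2$: union/intersection of domains with pointwise union/intersection of values. $\Delta$ is duplicable if $\mathrm{dom}\Delta\subseteq N_{ser}$. $(\Delta_1,\Delta_2)\in\mathrm{split}(\Delta)$ iff $\Delta_1\cup\Delta_2=\Delta$ and $\Delta_1\cap\Delta_2$ is duplicable. A stack is a sequence of tagged continuation names $p^{O}$ (output) and $p^{I}$ (input) in which tags alternate, each name occurs at most once with a given tag, and if a name occurs with both tags then $p^{I}$ immediately follows $p^{O}$. $\sigma\in\mathrm{inter}(\sigma_1,\sigma_2)$ iff $\sigma$ is a stack obtained by an order-preserving interleaving (merge) of $\sigma_1$ and $\sigma_2$. Typing $\langle\Delta\mid\sigma\rangle\vdash P$ is the least relation with: $\langle\Delta,\mathsf{cur}\mapsto V\mid\sigma\rangle\vdash\overline a\langle e\rangle(b,p).P$ if $a\in V$ and $\langle\Delta,b\mapsto V\cup\{b\},p\mapsto V\cup\{b\}\mid p^{I},\sigma\rangle\vdash P$; $\langle\Delta,\mathsf{cur}\mapsto V\mid p^{O},\sigma\rangle\vdash\overline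 p\langle e\rangle(b).P$ if $p\in V$ and $\langle\Delta,b\mapsto V\cup\{b\}\mid\sigma\rangle\vdash P$; $\langle\Delta,a\mapsto V\mid\sigma\rangle\vdash a(x,b,p).P$ if $\langle\Delta,a\mapsto V,\mathsf{cur}\mapsto V\cup\{b,p\}\mid p^{O},\sigma\rangle\vdash P$; $\langle\Delta,a\mapsto V\mid\emptyset\rangle\vdash!a(x,b,p).P$ if $\Delta$ is duplicable and $\langle\Delta,a\mapsto V,\mathsf{cur}\mapsto V\cup\{b,p\}\mid p^{O}\rangle\vdash P$; $\langle\Delta,p\mapsto V\mid p^{I},q^{O}\rangle\vdash p(x,b).P$ if $\langle\Delta,\mathsf{cur}\mapsto V\cup\{b\}\mid q^{O}\rangle\vdash P$; $\langle\Delta\setminus a\mid\sigma\rangle\vdash\nu aP$ if $\langle\Delta\mid\sigma\rangle\vdash P$; $\langle\Delta\setminus p\mid\sigma_1,\sigma_2\rangle\vdash\nu pP$ if $\langle\Delta\mid\sigma_1,p^{O},p^{I},\sigma_2\rangle\vdash P$; $\langle\Delta\setminus p\mid\sigma\rangle\vdash\nu pP$ if $\langle\Delta\mid\sigma\rangle\vdash P$ and $p$ does not occur in $\sigma$; $\langle\Delta\mid\sigma\rangle\vdash P_1|P_2$ if $\langle\Delta_i\mid\sigma_i\rangle\vdash P_i$, $(\Delta_1,\Delta_2)\in\mathrm{split}(\Delta)$, $\sigma\in\mathrm{inter}(\sigma_1,\sigma_2)$; $\langle\Delta\mid\emptyset\rangle\vdash0$ if $\Delta$ duplicable; $\langle\Delta\mid\emptyset\rangle\vdash\omega.P$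 always; $\langle\Delta\mid\emptyset\rangle\vdash\overline h\langle e\rangle.P$ if $\langle\Delta\mid\emptyset\rangle\vdash P$ and $\mathsf{cur}\notin\mathrm{dom}\Delta$; $\langle\Delta\mid\emptyset\rangle\vdash h(x).P$ if $\langle\Delta\mid\emptyset\rangle\vdash P$ and $\mathsf{cur}\in\mathrm{dom}\Delta$; $\langle\Delta\mid\sigma\rangle\vdash\nu hP$ if $\langle\Delta\mid\sigma\rangle\vdash P$; $\langle\Delta\mid\emptyset\rangle\vdash P_1+P_2$ and $\langle\Delta\mid\emptyset\rangle\vdash\mathtt{if}\ e=f\ \mathtt{then}\ P_1\ \mathtt{else}\ P_2$ if both $\langle\Delta\mid\emptyset\rangle\vdash P_i$.
   Formalization: Clause (5) additionally assumes that p^I is on top of σ (false otherwise: p^I may be buried by interleaving); in clause (1) "p not free in P'" ignores occurrences under success prefixes ω.Q, which are typed for any Q; bound names of μ are taken fresh for Δ and σ. *)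

theory Defs
  imports Main "HOL-Combinatorics.Transposition"
begin

section \<open>Syntax\<close>

datatype sname = SName nat    \<comment> \<open>server names\<close>
datatype cname = CName nat    \<comment> \<open>continuation names\<close>
datatype fname = FName nat    \<comment> \<open>first-order names\<close>
datatype wname = WName nat    \<comment> \<open>success names\<close>
datatype var = Var nat

datatype hname = Srv sname | Con cname

text \<open>
  The language of first-order expressions is a parameter: \<open>'e\<close> is the type of expressions,
  \<open>'v\<close> the type of values, and \<open>ev e v\<close> is the evaluation judgement of \<open>e\<close> to \<open>v\<close>.
\<close>

locale expr_lang =
  fixes efv :: "'e \<Rightarrow> var set"
    and esub :: "var \<Rightarrow> 'v \<Rightarrow> 'e \<Rightarrow> 'e"
    and ev :: "'e \<Rightarrow> 'v \<Rightarrow> bool"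
  assumes efv_esub: "efv (esub x v e) = efv e - {x}"
    and closed_evaluates: "efv e = {} \<Longrightarrow> \<exists>v. ev e v"

datatype inp =
    InS sname var sname cname
  | InC cname var sname
  | InF fname var

datatype 'e proc =
    In inp "'e proc"
  | OutS sname 'e sname cname "'e proc"
  | OutC cname 'e sname "'e proc"
  | OutF fname 'e "'e proc"
  | Succ wname "'e proc"
  | Rep inp "'e proc"
  | Par "'e proc" "'e proc"
  | NuS sname "'e proc"
  | NuC cname "'e proc"
  | NuF fname "'e proc"
  | Stop
  | Sum "'e proc" "'e proc"
  | Cond 'e 'e "'e proc" "'e proc"

primrec in_var :: "inp \<Rightarrow> var" where
  "in_var (InS a x b p) = x"
| "in_var (InC p x b) = x"
| "in_var (InF h x) = x"

primrec in_subj :: "inp \<Rightarrow> hname set" where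
  "in_subj (InS a x b p) = {Srv a}"
| "in_subj (InC p x b) = {Con p}"
| "in_subj (InF h x) = {}"

primrec in_bnd :: "inp \<Rightarrow> hname set" where
  "in_bnd (InS a x b p) = {Srv b, Con p}"
| "in_bnd (InC p x b) = {Srv b}"
| "in_bnd (InF h x) = {}"

primrec in_subj_f :: "inp \<Rightarrow> fname set" where
  "in_subj_f (InS a x b p) = {}"
| "in_subj_f (InC p x b) = {}"
| "in_subj_f (InF h x) = {h}"

text \<open>Free variables, free server and continuation names, free first-order names.\<close>

primrec fv :: "('e \<Rightarrow> var set) \<Rightarrow> 'e proc \<Rightarrow> var set" where
  "fv efv (In \<alpha> P) = fv efv P - {in_var \<alpha>}"
| "fv efv (OutS a e b p P) = efv e \<union> fv efv P"
| "fv efv (OutC p e b P) = efv e \<union> fv efv P"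
| "fv efv (OutF h e P) = efv e \<union> fv efv P"
| "fv efv (Succ w P) = fv efv P"
| "fv efv (Rep \<alpha> P) = fv efv P - {in_var \<alpha>}"
| "fv efv (Par P Q) = fv efv P \<union> fv efv Q"
| "fv efv (NuS a P) = fv efv P"
| "fv efv (NuC p P) = fv efv P"
| "fv efv (NuF h P) = fv efv P"
| "fv efv Stop = {}"
| "fv efv (Sum P Q) = fv efv P \<union> fv efv Q"
| "fv efv (Cond e f P Q) = efv e \<union> efv f \<union> fv efv P \<union> fv efv Q"

primrec fn :: "'e proc \<Rightarrow> hname set" where
  "fn (In \<alpha> P) = in_subj \<alpha> \<union> (fn P - in_bnd \<alpha>)"
| "fn (OutS a e b p P) = {Srv a} \<union> (fn P - {Srv b, Con p})"
| "fn (OutC p e b P) = {Con p} \<union> (fn P - {Srv b})"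
| "fn (OutF h e P) = fn P"
| "fn (Succ w P) = fn P"
| "fn (Rep \<alpha> P) = in_subj \<alpha> \<union> (fn P - in_bnd \<alpha>)"
| "fn (Par P Q) = fn P \<union> fn Q"
| "fn (NuS a P) = fn P - {Srv a}"
| "fn (NuC p P) = fn P - {Con p}"
| "fn (NuF h P) = fn P"
| "fn Stop = {}"
| "fn (Sum P Q) = fn P \<union> fn Q"
| "fn (Cond e f P Q) = fn P \<union> fn Q"

primrec ffn :: "'e proc \<Rightarrow> fname set" where
  "ffn (In \<alpha> P) = in_subj_f \<alpha> \<union> ffn P"
| "ffn (OutS a e b p P) = ffn P"
| "ffn (OutC p e b P) = ffn P"
| "ffn (OutF h e P) = {h} \<union> ffn P"
| "ffn (Succ w P) = ffn P"
| "ffn (Rep \<alpha> P) = in_subj_f \<alpha> \<union> ffn P"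
| "ffn (Par P Q) = ffn P \<union> ffn Q"
| "ffn (NuS a P) = ffn P"
| "ffn (NuC p P) = ffn P"
| "ffn (NuF h P) = ffn P - {h}"
| "ffn Stop = {}"
| "ffn (Sum P Q) = ffn P \<union> ffn Q"
| "ffn (Cond e f P Q) = ffn P \<union> ffn Q"

text \<open>
  As \<open>fn\<close>, but ignoring the continuations of success prefixes. These are never executed (the
  derivative of \<open>Succ w P\<close> is \<open>Stop\<close>), and the typing rule for \<open>Succ w P\<close> puts no constraint on
  \<open>P\<close>.
\<close>

primrec live_fn :: "'e proc \<Rightarrow> hname set" where
  "live_fn (In \<alpha> P) = in_subj \<alpha> \<union> (live_fn P - in_bnd \<alpha>)"
| "live_fn (OutS a e b p P) = {Srv a} \<union> (live_fn P - {Srv b, Con p})"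
| "live_fn (OutC p e b P) = {Con p} \<union> (live_fn P - {Srv b})"
| "live_fn (OutF h e P) = live_fn P"
| "live_fn (Succ w P) = {}"
| "live_fn (Rep \<alpha> P) = in_subj \<alpha> \<union> (live_fn P - in_bnd \<alpha>)"
| "live_fn (Par P Q) = live_fn P \<union> live_fn Q"
| "live_fn (NuS a P) = live_fn P - {Srv a}"
| "live_fn (NuC p P) = live_fn P - {Con p}"
| "live_fn (NuF h P) = live_fn P"
| "live_fn Stop = {}"
| "live_fn (Sum P Q) = live_fn P \<union> live_fn Q"
| "live_fn (Cond e f P Q) = live_fn P \<union> live_fn Q"

text \<open>
  \<open>ren\<close> applies its arguments to all names, free and bound. It is only used with transpositions:
  if \<open>c\<close> is not free in \<open>NuS a P\<close>, then \<open>NuS c (swapS a c P)\<close> is an alpha-variant of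
  \<open>NuS a P\<close>, and every alpha-variant arises by iterating this. Processes are raw terms;
  alpha-conversion is built into the rules for the binders below, which rename the bound names to
  arbitrary fresh ones.
\<close>

primrec ren_in :: "(sname \<Rightarrow> sname) \<Rightarrow> (cname \<Rightarrow> cname) \<Rightarrow> (fname \<Rightarrow> fname) \<Rightarrow> inp \<Rightarrow> inp" where
  "ren_in s c f (InS a x b p) = InS (s a) x (s b) (c p)"
| "ren_in s c f (InC p x b) = InC (c p) x (s b)"
| "ren_in s c f (InF h x) = InF (f h) x"

primrec ren :: "(sname \<Rightarrow> sname) \<Rightarrow> (cname \<Rightarrow> cname) \<Rightarrow> (fname \<Rightarrow> fname) \<Rightarrow> 'e proc \<Rightarrow> 'e proc" where
  "ren s c f (In \<alpha> P) = In (ren_in s c f \<alpha>) (ren s c f P)"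
| "ren s c f (OutS a e b p P) = OutS (s a) e (s b) (c p) (ren s c f P)"
| "ren s c f (OutC p e b P) = OutC (c p) e (s b) (ren s c f P)"
| "ren s c f (OutF h e P) = OutF (f h) e (ren s c f P)"
| "ren s c f (Succ w P) = Succ w (ren s c f P)"
| "ren s c f (Rep \<alpha> P) = Rep (ren_in s c f \<alpha>) (ren s c f P)"
| "ren s c f (Par P Q) = Par (ren s c f P) (ren s c f Q)"
| "ren s c f (NuS a P) = NuS (s a) (ren s c f P)"
| "ren s c f (NuC p P) = NuC (c p) (ren s c f P)"
| "ren s c f (NuF h P) = NuF (f h) (ren s c f P)"
| "ren s c f Stop = Stop"
| "ren s c f (Sum P Q) = Sum (ren s c f P) (ren s c f Q)"
| "ren s c f (Cond e g P Q) = Cond e g (ren s c f P) (ren s c f Q)"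

abbreviation swapS :: "sname \<Rightarrow> sname \<Rightarrow> 'e proc \<Rightarrow> 'e proc" where
  "swapS a b \<equiv> ren (transpose a b) id id"

abbreviation swapC :: "cname \<Rightarrow> cname \<Rightarrow> 'e proc \<Rightarrow> 'e proc" where
  "swapC p q \<equiv> ren id (transpose p q) id"

abbreviation swapF :: "fname \<Rightarrow> fname \<Rightarrow> 'e proc \<Rightarrow> 'e proc" where
  "swapF h k \<equiv> ren id id (transpose h k)"

abbreviation swapSC :: "sname \<Rightarrow> sname \<Rightarrow> cname \<Rightarrow> cname \<Rightarrow> 'e proc \<Rightarrow> 'e proc" where
  "swapSC a b p q \<equiv> ren (transpose a b) (transpose p q) id"

primrec psub :: "(var \<Rightarrow> 'v \<Rightarrow> 'e \<Rightarrow> 'e) \<Rightarrow> var \<Rightarrow> 'v \<Rightarrow> 'e proc \<Rightarrow> 'e proc" where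
  "psub esub x v (In \<alpha> P) = In \<alpha> (if x = in_var \<alpha> then P else psub esub x v P)"
| "psub esub x v (OutS a e b p P) = OutS a (esub x v e) b p (psub esub x v P)"
| "psub esub x v (OutC p e b P) = OutC p (esub x v e) b (psub esub x v P)"
| "psub esub x v (OutF h e P) = OutF h (esub x v e) (psub esub x v P)"
| "psub esub x v (Succ w P) = Succ w (psub esub x v P)"
| "psub esub x v (Rep \<alpha> P) = Rep \<alpha> (if x = in_var \<alpha> then P else psub esub x v P)"
| "psub esub x v (Par P Q) = Par (psub esub x v P) (psub esub x v Q)"
| "psub esub x v (NuS a P) = NuS a (psub esub x v P)"
| "psub esub x v (NuC p P) = NuC p (psub esub x v P)"
| "psub esub x v (NuF h P) = NuF h (psub esub x v P)"
| "psub esub x v Stop = Stop"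
| "psub esub x v (Sum P Q) = Sum (psub esub x v P) (psub esub x v Q)"
| "psub esub x v (Cond e f P Q) =
     Cond (esub x v e) (esub x v f) (psub esub x v P) (psub esub x v Q)"


section \<open>Transitions\<close>

text \<open>
  \<open>ASIn a v b p\<close>, \<open>ASOut a v b p\<close>, \<open>ACIn p v b\<close> and \<open>ACOut p v b\<close> have subject \<open>a\<close> resp. \<open>p\<close>,
  value \<open>v\<close>, and the remaining names are bound.
\<close>

datatype 'v act =
    Tau
  | ASIn sname 'v sname cname
  | ASOut sname 'v sname cname
  | ACIn cname 'v sname
  | ACOut cname 'v sname
  | AFIn fname 'v
  | AFOut fname 'v
  | ASucc wname

primrec bn :: "'v act \<Rightarrow> hname set" where
  "bn Tau = {}"
| "bn (ASIn a v b p) = {Srv b, Con p}"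
| "bn (ASOut a v b p) = {Srv b, Con p}"
| "bn (ACIn p v b) = {Srv b}"
| "bn (ACOut p v b) = {Srv b}"
| "bn (AFIn h v) = {}"
| "bn (AFOut h v) = {}"
| "bn (ASucc w) = {}"

primrec act_names :: "'v act \<Rightarrow> hname set" where
  "act_names Tau = {}"
| "act_names (ASIn a v b p) = {Srv a, Srv b, Con p}"
| "act_names (ASOut a v b p) = {Srv a, Srv b, Con p}"
| "act_names (ACIn p v b) = {Con p, Srv b}"
| "act_names (ACOut p v b) = {Con p, Srv b}"
| "act_names (AFIn h v) = {}"
| "act_names (AFOut h v) = {}"
| "act_names (ASucc w) = {}"

primrec act_fnames :: "'v act \<Rightarrow> fname set" where
  "act_fnames Tau = {}"
| "act_fnames (ASIn a v b p) = {}"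
| "act_fnames (ASOut a v b p) = {}"
| "act_fnames (ACIn p v b) = {}"
| "act_fnames (ACOut p v b) = {}"
| "act_fnames (AFIn h v) = {h}"
| "act_fnames (AFOut h v) = {h}"
| "act_fnames (ASucc w) = {}"

inductive step :: "(var \<Rightarrow> 'v \<Rightarrow> 'e \<Rightarrow> 'e) \<Rightarrow> ('e \<Rightarrow> 'v \<Rightarrow> bool) \<Rightarrow>
    'e proc \<Rightarrow> 'v act \<Rightarrow> 'e proc \<Rightarrow> bool"
  for esub :: "var \<Rightarrow> 'v \<Rightarrow> 'e \<Rightarrow> 'e" and ev :: "'e \<Rightarrow> 'v \<Rightarrow> bool" where
  step_InS: "{Srv b', Con p'} \<inter> fn (In (InS a x b p) P) = {} \<Longrightarrow>
    step esub ev (In (InS a x b p) P) (ASIn a v b' p') (psub esub x v (swapSC b b' p p' P))"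
| step_InC: "Srv b' \<notin> fn (In (InC p x b) P) \<Longrightarrow>
    step esub ev (In (InC p x b) P) (ACIn p v b') (psub esub x v (swapS b b' P))"
| step_InF: "step esub ev (In (InF h x) P) (AFIn h v) (psub esub x v P)"
| step_OutS: "ev e v \<Longrightarrow> {Srv b', Con p'} \<inter> fn (OutS a e b p P) = {} \<Longrightarrow>
    step esub ev (OutS a e b p P) (ASOut a v b' p') (swapSC b b' p p' P)"
| step_OutC: "ev e v \<Longrightarrow> Srv b' \<notin> fn (OutC p e b P) \<Longrightarrow>
    step esub ev (OutC p e b P) (ACOut p v b') (swapS b b' P)"
| step_OutF: "ev e v \<Longrightarrow> step esub ev (OutF h e P) (AFOut h v) P"
| step_Succ: "step esub ev (Succ w P) (ASucc w) Stop"
| step_Rep: "step esub ev (Par (In \<alpha> P) (Rep \<alpha> P)) \<mu> P' \<Longrightarrow> step esub ev (Rep \<alpha> P) \<mu> P'"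
| step_ParL: "step esub ev P \<mu> P' \<Longrightarrow> bn \<mu> \<inter> fn Q = {} \<Longrightarrow>
    step esub ev (Par P Q) \<mu> (Par P' Q)"
| step_ParR: "step esub ev Q \<mu> Q' \<Longrightarrow> bn \<mu> \<inter> fn P = {} \<Longrightarrow>
    step esub ev (Par P Q) \<mu> (Par P Q')"
| step_ComSL: "step esub ev P (ASOut a v b p) P' \<Longrightarrow> step esub ev Q (ASIn a v b p) Q' \<Longrightarrow>
    step esub ev (Par P Q) Tau (NuS b (NuC p (Par P' Q')))"
| step_ComSR: "step esub ev P (ASIn a v b p) P' \<Longrightarrow> step esub ev Q (ASOut a v b p) Q' \<Longrightarrow>
    step esub ev (Par P Q) Tau (NuS b (NuC p (Par P' Q')))"
| step_ComCL: "step esub ev P (ACOut p v b) P' \<Longrightarrow> step esub ev Q (ACIn p v b) Q' \<Longrightarrow>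
    step esub ev (Par P Q) Tau (NuS b (Par P' Q'))"
| step_ComCR: "step esub ev P (ACIn p v b) P' \<Longrightarrow> step esub ev Q (ACOut p v b) Q' \<Longrightarrow>
    step esub ev (Par P Q) Tau (NuS b (Par P' Q'))"
| step_ComFL: "step esub ev P (AFOut h v) P' \<Longrightarrow> step esub ev Q (AFIn h v) Q' \<Longrightarrow>
    step esub ev (Par P Q) Tau (Par P' Q')"
| step_ComFR: "step esub ev P (AFIn h v) P' \<Longrightarrow> step esub ev Q (AFOut h v) Q' \<Longrightarrow>
    step esub ev (Par P Q) Tau (Par P' Q')"
| step_NuS: "step esub ev (swapS a a' P) \<mu> P' \<Longrightarrow> Srv a' \<notin> fn (NuS a P) \<Longrightarrow>
    Srv a' \<notin> act_names \<mu> \<Longrightarrow> step esub ev (NuS a P) \<mu> (NuS a' P')"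
| step_NuC: "step esub ev (swapC p p' P) \<mu> P' \<Longrightarrow> Con p' \<notin> fn (NuC p P) \<Longrightarrow>
    Con p' \<notin> act_names \<mu> \<Longrightarrow> step esub ev (NuC p P) \<mu> (NuC p' P')"
| step_NuF: "step esub ev (swapF h h' P) \<mu> P' \<Longrightarrow> h' \<notin> ffn (NuF h P) \<Longrightarrow>
    h' \<notin> act_fnames \<mu> \<Longrightarrow> step esub ev (NuF h P) \<mu> (NuF h' P')"
| step_SumL: "step esub ev P \<mu> P' \<Longrightarrow> step esub ev (Sum P Q) \<mu> P'"
| step_SumR: "step esub ev Q \<mu> Q' \<Longrightarrow> step esub ev (Sum P Q) \<mu> Q'"
| step_Then: "ev e v \<Longrightarrow> ev f v \<Longrightarrow> step esub ev P \<mu> P' \<Longrightarrow> step esub ev (Cond e f P Q) \<mu> P'"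
| step_Else: "ev e v \<Longrightarrow> ev f w \<Longrightarrow> v \<noteq> w \<Longrightarrow> step esub ev Q \<mu> Q' \<Longrightarrow>
    step esub ev (Cond e f P Q) \<mu> Q'"


section \<open>Visibility functions and stacks\<close>

datatype vkey = Cur | Nm hname

type_synonym vis = "vkey \<rightharpoonup> hname set"

definition visfun :: "vis \<Rightarrow> bool" where
  "visfun \<Delta> \<longleftrightarrow> finite (dom \<Delta>) \<and> (\<forall>V \<in> ran \<Delta>. finite V) \<and>
     (\<forall>k n V W. \<Delta> k = Some V \<longrightarrow> n \<in> V \<longrightarrow> \<Delta> (Nm n) = Some W \<longrightarrow> W \<subseteq> V)"

definition erase :: "vis \<Rightarrow> vkey \<Rightarrow> vis" where
  "erase \<Delta> k = (\<lambda>l. if l = k then None else map_option (\<lambda>V. {n \<in> V. Nm n \<noteq> k}) (\<Delta> l))"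

definition vunion :: "vis \<Rightarrow> vis \<Rightarrow> vis" where
  "vunion \<Delta>\<^sub>1 \<Delta>\<^sub>2 = (\<lambda>k. case \<Delta>\<^sub>1 k of None \<Rightarrow> \<Delta>\<^sub>2 k
     | Some V \<Rightarrow> (case \<Delta>\<^sub>2 k of None \<Rightarrow> Some V | Some W \<Rightarrow> Some (V \<union> W)))"

definition vinter :: "vis \<Rightarrow> vis \<Rightarrow> vis" where
  "vinter \<Delta>\<^sub>1 \<Delta>\<^sub>2 = (\<lambda>k. case \<Delta>\<^sub>1 k of None \<Rightarrow> None
     | Some V \<Rightarrow> (case \<Delta>\<^sub>2 k of None \<Rightarrow> None | Some W \<Rightarrow> Some (V \<inter> W)))"

definition duplicable :: "vis \<Rightarrow> bool" where
  "duplicable \<Delta> \<longleftrightarrow> dom \<Delta> \<subseteq> range (\<lambda>a. Nm (Srv a))"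

definition vsplit :: "vis \<Rightarrow> (vis \<times> vis) set" where
  "vsplit \<Delta> = {(\<Delta>\<^sub>1, \<Delta>\<^sub>2). visfun \<Delta>\<^sub>1 \<and> visfun \<Delta>\<^sub>2 \<and> vunion \<Delta>\<^sub>1 \<Delta>\<^sub>2 = \<Delta> \<and> duplicable (vinter \<Delta>\<^sub>1 \<Delta>\<^sub>2)}"

datatype tag = TO | TI

type_synonym stack = "(cname \<times> tag) list"

definition is_stack :: "stack \<Rightarrow> bool" where
  "is_stack \<sigma> \<longleftrightarrow>
     (\<forall>i. Suc i < length \<sigma> \<longrightarrow> snd (\<sigma> ! i) \<noteq> snd (\<sigma> ! Suc i)) \<and>
     distinct \<sigma> \<and>
     (\<forall>i j p. i < length \<sigma> \<longrightarrow> j < length \<sigma> \<longrightarrow> \<sigma> ! i = (p, TO) \<longrightarrow> \<sigma> ! j = (p, TI) \<longrightarrow> j = Suc i)"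

definition inter :: "stack \<Rightarrow> stack \<Rightarrow> stack set" where
  "inter \<sigma>\<^sub>1 \<sigma>\<^sub>2 = {\<sigma> \<in> shuffles \<sigma>\<^sub>1 \<sigma>\<^sub>2. is_stack \<sigma>}"

definition supp :: "vis \<Rightarrow> stack \<Rightarrow> hname set" where
  "supp \<Delta> \<sigma> = {n. Nm n \<in> dom \<Delta>} \<union> \<Union> (ran \<Delta>) \<union> Con ` fst ` set \<sigma>"


section \<open>Typing\<close>

text \<open>
  Every rule requires its conclusion to be formed from a visibility function and a stack. An
  extension of \<open>\<Delta>\<close> by \<open>k \<mapsto> V\<close> is an update \<open>\<Delta>(k \<mapsto> V)\<close> with \<open>\<Delta> k = None\<close>. Names bound by
  prefixes are renamed to names that are fresh for the conclusion; for the restrictions the name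
  cannot occur in the conclusion, since it is erased resp. absent there.
\<close>

definition wf_env :: "vis \<Rightarrow> stack \<Rightarrow> bool" where
  "wf_env \<Delta> \<sigma> \<longleftrightarrow> visfun \<Delta> \<and> is_stack \<sigma>"

inductive typed :: "vis \<Rightarrow> stack \<Rightarrow> 'e proc \<Rightarrow> bool" where
  typed_OutS: "wf_env (\<Delta>(Cur \<mapsto> V)) \<sigma> \<Longrightarrow> \<Delta> Cur = None \<Longrightarrow> Srv a \<in> V \<Longrightarrow>
    {Srv b', Con p'} \<inter> (supp (\<Delta>(Cur \<mapsto> V)) \<sigma> \<union> fn (OutS a e b p P)) = {} \<Longrightarrow>
    typed (\<Delta>(Nm (Srv b') \<mapsto> V \<union> {Srv b'}, Nm (Con p') \<mapsto> V \<union> {Srv b'})) ((p', TI) # \<sigma>)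
      (swapSC b b' p p' P) \<Longrightarrow>
    typed (\<Delta>(Cur \<mapsto> V)) \<sigma> (OutS a e b p P)"
| typed_OutC: "wf_env (\<Delta>(Cur \<mapsto> V)) ((p, TO) # \<sigma>) \<Longrightarrow> \<Delta> Cur = None \<Longrightarrow> Con p \<in> V \<Longrightarrow>
    Srv b' \<notin> supp (\<Delta>(Cur \<mapsto> V)) ((p, TO) # \<sigma>) \<union> fn (OutC p e b P) \<Longrightarrow>
    typed (\<Delta>(Nm (Srv b') \<mapsto> V \<union> {Srv b'})) \<sigma> (swapS b b' P) \<Longrightarrow>
    typed (\<Delta>(Cur \<mapsto> V)) ((p, TO) # \<sigma>) (OutC p e b P)"
| typed_InS: "wf_env (\<Delta>(Nm (Srv a) \<mapsto> V)) \<sigma> \<Longrightarrow> \<Delta> (Nm (Srv a)) = None \<Longrightarrow> \<Delta> Cur = None \<Longrightarrow>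
    {Srv b', Con p'} \<inter> (supp (\<Delta>(Nm (Srv a) \<mapsto> V)) \<sigma> \<union> fn (In (InS a x b p) P)) = {} \<Longrightarrow>
    typed (\<Delta>(Nm (Srv a) \<mapsto> V, Cur \<mapsto> V \<union> {Srv b', Con p'})) ((p', TO) # \<sigma>)
      (swapSC b b' p p' P) \<Longrightarrow>
    typed (\<Delta>(Nm (Srv a) \<mapsto> V)) \<sigma> (In (InS a x b p) P)"
| typed_RepS: "wf_env (\<Delta>(Nm (Srv a) \<mapsto> V)) [] \<Longrightarrow> \<Delta> (Nm (Srv a)) = None \<Longrightarrow> duplicable \<Delta> \<Longrightarrow>
    {Srv b', Con p'} \<inter> (supp (\<Delta>(Nm (Srv a) \<mapsto> V)) [] \<union> fn (Rep (InS a x b p) P)) = {} \<Longrightarrow>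
    typed (\<Delta>(Nm (Srv a) \<mapsto> V, Cur \<mapsto> V \<union> {Srv b', Con p'})) [(p', TO)]
      (swapSC b b' p p' P) \<Longrightarrow>
    typed (\<Delta>(Nm (Srv a) \<mapsto> V)) [] (Rep (InS a x b p) P)"
| typed_InC: "wf_env (\<Delta>(Nm (Con p) \<mapsto> V)) [(p, TI), (q, TO)] \<Longrightarrow>
    \<Delta> (Nm (Con p)) = None \<Longrightarrow> \<Delta> Cur = None \<Longrightarrow>
    Srv b' \<notin> supp (\<Delta>(Nm (Con p) \<mapsto> V)) [(p, TI), (q, TO)] \<union> fn (In (InC p x b) P) \<Longrightarrow>
    typed (\<Delta>(Cur \<mapsto> V \<union> {Srv b'})) [(q, TO)] (swapS b b' P) \<Longrightarrow>
    typed (\<Delta>(Nm (Con p) \<mapsto> V)) [(p, TI), (q, TO)] (In (InC p x b) P)"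
| typed_NuS: "wf_env (erase \<Delta> (Nm (Srv a'))) \<sigma> \<Longrightarrow> Srv a' \<notin> fn (NuS a P) \<Longrightarrow>
    typed \<Delta> \<sigma> (swapS a a' P) \<Longrightarrow>
    typed (erase \<Delta> (Nm (Srv a'))) \<sigma> (NuS a P)"
| typed_NuC_pair: "wf_env (erase \<Delta> (Nm (Con p'))) (\<sigma>\<^sub>1 @ \<sigma>\<^sub>2) \<Longrightarrow> Con p' \<notin> fn (NuC p P) \<Longrightarrow>
    typed \<Delta> (\<sigma>\<^sub>1 @ (p', TO) # (p', TI) # \<sigma>\<^sub>2) (swapC p p' P) \<Longrightarrow>
    typed (erase \<Delta> (Nm (Con p'))) (\<sigma>\<^sub>1 @ \<sigma>\<^sub>2) (NuC p P)"
| typed_NuC_absent: "wf_env (erase \<Delta> (Nm (Con p'))) \<sigma> \<Longrightarrow> Con p' \<notin> fn (NuC p P) \<Longrightarrow>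
    p' \<notin> fst ` set \<sigma> \<Longrightarrow> typed \<Delta> \<sigma> (swapC p p' P) \<Longrightarrow>
    typed (erase \<Delta> (Nm (Con p'))) \<sigma> (NuC p P)"
| typed_Par: "wf_env \<Delta> \<sigma> \<Longrightarrow> typed \<Delta>\<^sub>1 \<sigma>\<^sub>1 P\<^sub>1 \<Longrightarrow> typed \<Delta>\<^sub>2 \<sigma>\<^sub>2 P\<^sub>2 \<Longrightarrow>
    (\<Delta>\<^sub>1, \<Delta>\<^sub>2) \<in> vsplit \<Delta> \<Longrightarrow> \<sigma> \<in> inter \<sigma>\<^sub>1 \<sigma>\<^sub>2 \<Longrightarrow>
    typed \<Delta> \<sigma> (Par P\<^sub>1 P\<^sub>2)"
| typed_Stop: "wf_env \<Delta> [] \<Longrightarrow> duplicable \<Delta> \<Longrightarrow> typed \<Delta> [] Stop"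
| typed_Succ: "wf_env \<Delta> [] \<Longrightarrow> typed \<Delta> [] (Succ w P)"
| typed_OutF: "wf_env \<Delta> [] \<Longrightarrow> typed \<Delta> [] P \<Longrightarrow> Cur \<notin> dom \<Delta> \<Longrightarrow> typed \<Delta> [] (OutF h e P)"
| typed_InF: "wf_env \<Delta> [] \<Longrightarrow> typed \<Delta> [] P \<Longrightarrow> Cur \<in> dom \<Delta> \<Longrightarrow> typed \<Delta> [] (In (InF h x) P)"
| typed_NuF: "wf_env \<Delta> \<sigma> \<Longrightarrow> typed \<Delta> \<sigma> P \<Longrightarrow> typed \<Delta> \<sigma> (NuF h P)"
| typed_Sum: "wf_env \<Delta> [] \<Longrightarrow> typed \<Delta> [] P\<^sub>1 \<Longrightarrow> typed \<Delta> [] P\<^sub>2 \<Longrightarrow> typed \<Delta> [] (Sum P\<^sub>1 P\<^sub>2)"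
| typed_Cond: "wf_env \<Delta> [] \<Longrightarrow> typed \<Delta> [] P\<^sub>1 \<Longrightarrow> typed \<Delta> [] P\<^sub>2 \<Longrightarrow>
    typed \<Delta> [] (Cond e f P\<^sub>1 P\<^sub>2)"


section \<open>Two boundary cases\<close>

text \<open>
  Parallel composition may bury an input tag \<open>p\<^sup>I\<close> below the top of the stack, while the plain
  transition system still offers the input at \<open>p\<close>. Preservation of types under inputs at
  continuation names therefore concerns those names whose input tag is on top.
\<close>

lemma typed_caller:
  assumes "p \<noteq> q" "b \<noteq> c"
  shows "typed [Nm (Con p) \<mapsto> {Con q}] [(p, TI), (q, TO)] (In (InC p x b) (OutC q e c Stop))"
proof -
  have s: "is_stack []" "is_stack [(q, TO)]" "is_stack [(p, TI), (q, TO)]"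
    using assms by (auto simp: is_stack_def less_Suc_eq nth_Cons')
  have "typed (Map.empty(Nm (Srv c) \<mapsto> {Con q, Srv b} \<union> {Srv c})) [] (swapS c c Stop)"
    by (auto intro!: typed_Stop simp: wf_env_def visfun_def s duplicable_def)
  then have "typed (Map.empty(Cur \<mapsto> {Con q, Srv b})) [(q, TO)] (OutC q e c Stop)"
    using assms by (intro typed_OutC) (auto simp: wf_env_def visfun_def s supp_def)
  then have "typed (Map.empty(Cur \<mapsto> {Con q} \<union> {Srv b})) [(q, TO)] (swapS b b (OutC q e c Stop))"
    by (simp add: insert_commute)
  from typed_InC[OF _ _ _ _ this] show ?thesis
    using assms by (auto simp: wf_env_def visfun_def s supp_def)
qed

lemma buried_input:
  assumes "expr_lang efv esub ev" and "efv e = {}"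
  shows "\<exists>\<Delta> \<sigma> P P' p v b. visfun \<Delta> \<and> is_stack \<sigma> \<and> fv efv P = {} \<and> typed \<Delta> \<sigma> P \<and>
    Cur \<notin> dom \<Delta> \<and> step esub ev P (ACIn p v b) P' \<and> bn (ACIn p v b) \<inter> supp \<Delta> \<sigma> = {} \<and>
    \<not> (\<exists>q \<sigma>''. \<sigma> = (p, TI) # (q, TO) # \<sigma>'')"
proof -
  obtain v where "ev e v"
    using assms by (meson expr_lang.closed_evaluates)
  define p q r s where "p = CName 0" and "q = CName 1" and "r = CName 2" and "s = CName 3"
  note n = p_def q_def r_def s_def
  define b c where "b = SName 0" and "c = SName 1"
  define A where "A p q = In (InC p (Var 0) b) (OutC q e c Stop)" for p q
  define \<sigma> where "\<sigma> = [(r, TI), (s, TO), (p, TI), (q, TO)]"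
  define \<Delta> :: vis where "\<Delta> = [Nm (Con p) \<mapsto> {Con q}, Nm (Con r) \<mapsto> {Con s}]"
  have st: "is_stack \<sigma>"
    by (auto simp: \<sigma>_def is_stack_def less_Suc_eq nth_Cons' n)
  have vis: "visfun \<Delta>" by (auto simp: \<Delta>_def visfun_def n)
  have t: "typed [Nm (Con p) \<mapsto> {Con q}] [(p, TI), (q, TO)] (A p q)"
    "typed [Nm (Con r) \<mapsto> {Con s}] [(r, TI), (s, TO)] (A r s)"
    unfolding A_def by (rule typed_caller; simp add: n b_def c_def)+
  have "typed \<Delta> \<sigma> (Par (A p q) (A r s))"
    using vis st
    by (intro typed_Par[OF _ t])
      (auto simp: wf_env_def vsplit_def vunion_def vinter_def duplicable_def visfun_def inter_def
        \<Delta>_def \<sigma>_def n fun_eq_iff split: option.splits if_splits)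
  moreover have "step esub ev (Par (A p q) (A r s)) (ACIn p v b)
      (Par (psub esub (Var 0) v (swapS b b (OutC q e c Stop))) (A r s))"
    unfolding A_def by (intro step_ParL step_InC) (auto simp: b_def)
  moreover have "fv efv (Par (A p q) (A r s)) = {}"
    using assms by (simp add: A_def)
  moreover have "Cur \<notin> dom \<Delta>" "bn (ACIn p v b) \<inter> supp \<Delta> \<sigma> = {}"
    by (auto simp: \<Delta>_def supp_def \<sigma>_def ran_def split: if_splits)
  moreover have "\<not> (\<exists>q \<sigma>''. \<sigma> = (p, TI) # (q, TO) # \<sigma>'')"
    by (simp add: \<sigma>_def n)
  ultimately show ?thesis using st vis by blast
qed

text \<open>
  A continuation name consumed by a communication may still occur in the continuation of a
  success prefix; hence \<open>live_fn\<close>.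
\<close>

lemma dead_occurrence:
  assumes "expr_lang efv esub ev" and "efv e = {}" and esub: "\<And>x v. esub x v e = e"
  shows "\<exists>\<Delta> \<sigma> P P'. visfun \<Delta> \<and> is_stack \<sigma> \<and> fv efv P = {} \<and> typed \<Delta> \<sigma> P \<and>
    step esub ev P Tau P' \<and>
    \<not> ((\<exists>p \<sigma>''. \<sigma> = (p, TO) # (p, TI) # \<sigma>'' \<and> Con p \<notin> fn P' \<and>
          typed (erase \<Delta> (Nm (Con p))) \<sigma>'' P') \<or>
       typed \<Delta> \<sigma> P')"
proof -
  obtain v where ev: "ev e v"
    using assms by (meson expr_lang.closed_evaluates)
  define p q where "p = CName 0" and "q = CName 1"
  note n = p_def q_def
  define b c where "b = SName 0" and "c = SName 1"
  note m = b_def c_def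
  define D where "D = Succ (WName 0) (OutC p e b Stop)"
  define A where "A = OutC p e b Stop"
  define B where "B = In (InC p (Var 0) b) (OutC q e c D)"
  define P' where "P' = NuS b (Par Stop (OutC q e c D))"
  define \<sigma> where "\<sigma> = [(p, TO), (p, TI), (q, TO)]"
  define \<Delta> :: vis where "\<Delta> = [Cur \<mapsto> {Con p, Con q}, Nm (Con p) \<mapsto> {Con q}]"
  have s: "is_stack []" "is_stack [(p, TO)]" "is_stack [(q, TO)]" "is_stack [(p, TI), (q, TO)]"
      "is_stack \<sigma>"
    by (auto simp: is_stack_def \<sigma>_def less_Suc_eq nth_Cons' n)
  have vis: "visfun \<Delta>" by (auto simp: \<Delta>_def visfun_def n)
  have "typed (Map.empty(Nm (Srv b) \<mapsto> {Con p, Con q} \<union> {Srv b})) [] (swapS b b Stop)"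
    by (auto intro!: typed_Stop simp: wf_env_def visfun_def s duplicable_def)
  then have tA: "typed [Cur \<mapsto> {Con p, Con q}] [(p, TO)] A"
    unfolding A_def by (intro typed_OutC) (auto simp: wf_env_def visfun_def s supp_def)
  have "typed (Map.empty(Nm (Srv c) \<mapsto> {Con q, Srv b} \<union> {Srv c})) [] (swapS c c D)"
    unfolding D_def by (auto intro!: typed_Succ simp: wf_env_def visfun_def s)
  then have "typed (Map.empty(Cur \<mapsto> {Con q, Srv b})) [(q, TO)] (OutC q e c D)"
    by (intro typed_OutC) (auto simp: wf_env_def visfun_def s supp_def D_def m)
  then have "typed (Map.empty(Cur \<mapsto> {Con q} \<union> {Srv b})) [(q, TO)] (swapS b b (OutC q e c D))"
    by (simp add: D_def insert_commute)
  from typed_InC[OF _ _ _ _ this]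
  have tB: "typed (Map.empty(Nm (Con p) \<mapsto> {Con q})) [(p, TI), (q, TO)] B"
    unfolding B_def by (auto simp: wf_env_def visfun_def s supp_def D_def)
  have "typed \<Delta> \<sigma> (Par A B)"
    using vis s
    by (intro typed_Par[OF _ tA tB])
      (auto simp: wf_env_def vsplit_def vunion_def vinter_def duplicable_def visfun_def inter_def
        \<Delta>_def \<sigma>_def n fun_eq_iff split: option.splits if_splits)
  moreover have "step esub ev (Par A B) Tau P'"
  proof -
    have "step esub ev A (ACOut p v b) (swapS b b Stop)"
      unfolding A_def using ev by (intro step_OutC) auto
    moreover have "step esub ev B (ACIn p v b) (psub esub (Var 0) v (swapS b b (OutC q e c D)))"
      unfolding B_def by (intro step_InC) (auto simp: D_def)
    ultimately show ?thesis
      using step_ComCL[of esub ev A p v b] by (simp add: P'_def D_def esub)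
  qed
  moreover have "fv efv (Par A B) = {}"
    using assms by (simp add: A_def B_def D_def)
  moreover have "Con p \<in> fn P'"
    by (simp add: P'_def D_def n)
  moreover have "\<not> typed \<Delta>' \<sigma> P'" for \<Delta>'
  proof
    assume "typed \<Delta>' \<sigma> P'"
    then obtain \<Delta>'' a' where "typed \<Delta>'' \<sigma> (swapS b a' (Par Stop (OutC q e c D)))"
      unfolding P'_def by cases
    then have "typed \<Delta>'' \<sigma> (Par Stop (OutC q e (transpose b a' c) (swapS b a' D)))"
      by simp
    then obtain \<Delta>\<^sub>1 \<sigma>\<^sub>1 \<Delta>\<^sub>2 \<sigma>\<^sub>2 where 1: "typed \<Delta>\<^sub>1 \<sigma>\<^sub>1 (Stop :: 'a proc)"
      "typed \<Delta>\<^sub>2 \<sigma>\<^sub>2 (OutC q e (transpose b a' c) (swapS b a' D))" "\<sigma> \<in> inter \<sigma>\<^sub>1 \<sigma>\<^sub>2"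
      by cases
    from 1(1) have "\<sigma>\<^sub>1 = []" by cases
    with 1(3) have "\<sigma>\<^sub>2 = \<sigma>" by (simp add: inter_def)
    with 1(2) have "typed \<Delta>\<^sub>2 \<sigma> (OutC q e (transpose b a' c) (swapS b a' D))" by simp
    then show False by cases (simp add: \<sigma>_def n)
  qed
  ultimately show ?thesis using s vis unfolding \<sigma>_def by (intro exI conjI) auto
qed

end

theory Submission
  imports Defs
begin

text \<open>
  Typings are compared with a transition relation on environments \<open>\<langle>\<Delta> | \<sigma>\<rangle>\<close>, and preservation is
  proved by induction on the transition of the process. Three facts carry the argument.
  (i) Typing is stable under enlarging visibilities and under erasing names that are not live.
  Hence, when a call at \<open>a\<close> is received, the server, which sees only \<open>\<Delta>(a)\<close>, can be given the
  visibility \<open>\<Delta>(cur) \<supseteq> \<Delta>(a)\<close> of the caller. (ii) The stack of a typed process ends with an output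
  tag. Counting tags then shows that at most one of two interleaved stacks has an output tag on top,
  and that this tag is on top of the interleaving. Consequently a reply at \<open>p\<close> is only consumed when
  the stack starts with \<open>p\<^sup>O, p\<^sup>I\<close>. (iii) A live continuation name occurs in the stack, so it is gone
  after its communication. Processes are raw terms, so a permutation of names that are not free in a
  process fixes it only up to alpha-conversion; to make bound names fresh, the environment is
  permuted instead.
\<close>

subsection \<open>Renaming\<close>

text \<open>The six claims are not inductive as they stand. In a reply at \<open>p\<close> the
  receiver is one component of a parallel composition, and nothing says in advance that p^I is on
  top of its stack, so the claim about inputs cannot be invoked for it. The induction therefore also
  records that every input at \<open>p\<close> has p^I somewhere in the stack, even where the
  theorem promises no typing. Once the sender has shown p^O on top of the whole stack, the stack
  condition puts p^I directly below it, and only then does the receiver's move become available.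
  Collecting the claims in one relation lets each closure property (parallel contexts, erasure,
  removal of a hidden pair, renaming) be proved once for all actions. Freshness is the other
  obstacle: the names bound by a transition avoid processes only, while \<Delta> may mention names
  that no process contains. In a communication these names end up restricted, so a clash with
  \<Delta> is harmless; the argument runs in an environment without the clash, and its conclusion is
  carried back.\<close>

primrec hren :: "(sname \<Rightarrow> sname) \<Rightarrow> (cname \<Rightarrow> cname) \<Rightarrow> hname \<Rightarrow> hname" where
  "hren s c (Srv a) = Srv (s a)"
| "hren s c (Con p) = Con (c p)"

lemma hren_id [simp]: "hren id id n = n"
  by (cases n) auto

lemma hren_comp: "hren s c (hren s' c' n) = hren (s \<circ> s') (c \<circ> c') n"
  by (cases n) auto

lemma inj_hren: "inj s \<Longrightarrow> inj c \<Longrightarrow> inj (hren s c)"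
  by (rule injI, case_tac x; case_tac y) (auto dest: injD)

lemma ren_in_comp: "ren_in s c f (ren_in s' c' f' \<alpha>) = ren_in (s \<circ> s') (c \<circ> c') (f \<circ> f') \<alpha>"
  by (cases \<alpha>) auto

lemma ren_comp: "ren s c f (ren s' c' f' P) = ren (s \<circ> s') (c \<circ> c') (f \<circ> f') P"
  by (induction P) (simp_all add: ren_in_comp comp_def)

lemma ren_in_id [simp]: "ren_in id id id \<alpha> = \<alpha>"
  by (cases \<alpha>) auto

lemma ren_id [simp]: "ren id id id P = P"
  by (induction P) (simp_all add: ren_in_id[unfolded id_def] id_def)

lemma size_ren [simp]: "size (ren s c f P) = size P"
  by (induction P) auto

lemma in_subj_ren [simp]: "in_subj (ren_in s c f \<alpha>) = hren s c ` in_subj \<alpha>"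
  by (cases \<alpha>) auto

lemma in_bnd_ren [simp]: "in_bnd (ren_in s c f \<alpha>) = hren s c ` in_bnd \<alpha>"
  by (cases \<alpha>) auto

lemma in_var_ren [simp]: "in_var (ren_in s c f \<alpha>) = in_var \<alpha>"
  by (cases \<alpha>) auto

lemma fn_ren:
  assumes "inj s" "inj c"
  shows "fn (ren s c f P) = hren s c ` fn P"
  using inj_hren[OF assms]
  by (induction P) (auto simp: image_Un image_set_diff)

lemma live_fn_ren:
  assumes "inj s" "inj c"
  shows "live_fn (ren s c f P) = hren s c ` live_fn P"
  using inj_hren[OF assms]
  by (induction P) (auto simp: image_Un image_set_diff)

lemma live_fn_subset: "live_fn P \<subseteq> fn P"
  by (induction P) auto

lemma finite_in_subj [simp]: "finite (in_subj \<alpha>)"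
  by (cases \<alpha>) auto

lemma finite_fn [simp]: "finite (fn P)"
  by (induction P) auto

lemma psub_ren: "psub esub x v (ren s c f P) = ren s c f (psub esub x v P)"
  by (induction P) auto

lemma fn_psub [simp]: "fn (psub esub x v P) = fn P"
  by (induction P) auto

lemma ex_fresh_srv: "finite X \<Longrightarrow> \<exists>b. Srv b \<notin> X"
proof -
  assume "finite X"
  moreover have "inj (\<lambda>n. Srv (SName n))" by (auto intro: injI)
  ultimately have "finite ((\<lambda>n. Srv (SName n)) -` X)" by (simp add: finite_vimageI)
  then show ?thesis by (metis ex_new_if_finite infinite_UNIV_nat vimageI2)
qed

lemma ex_fresh_con: "finite X \<Longrightarrow> \<exists>p. Con p \<notin> X"
proof -
  assume "finite X"
  moreover have "inj (\<lambda>n. Con (CName n))" by (auto intro: injI)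
  ultimately have "finite ((\<lambda>n. Con (CName n)) -` X)" by (simp add: finite_vimageI)
  then show ?thesis by (metis ex_new_if_finite infinite_UNIV_nat vimageI2)
qed

lemma inj_transpose [simp]: "inj (transpose a b)"
  by (metis injI transpose_involutory)

text \<open>Here \<open>s'\<close> renames the raw term and \<open>s\<close> the environment; on the
  relevant names they may differ only at the bound name \<open>b\<close>. The transposition of
  \<open>s' b\<close> and \<open>s b'\<close> corrects exactly this point, and injectivity keeps all
  other points away from it.\<close>

lemma transpose_conj:
  assumes "inj s" "inj s'" "x \<noteq> b \<Longrightarrow> s' x = s x \<and> x \<noteq> b'"
  shows "transpose (s' b) (s b') (s' x) = s (transpose b b' x)"
  using assms by (cases "x = b") (auto simp: transpose_def inj_eq dest: injD)

lemma bn_subset_act_names: "bn \<mu> \<subseteq> act_names \<mu>"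
  by (cases \<mu>) auto

lemma finite_act_names [simp]: "finite (act_names \<mu>)"
  by (cases \<mu>) auto

lemma live_fn_swapSC_subset:
  assumes "{Srv b', Con p'} \<inter> (fn P - {Srv b, Con p}) = {}"
  shows "live_fn (swapSC b b' p p' P) \<subseteq> (live_fn P - {Srv b, Con p}) \<union> {Srv b', Con p'}"
proof -
  have "hren (transpose b b') (transpose p p') n \<in> (live_fn P - {Srv b, Con p}) \<union> {Srv b', Con p'}"
    if "n \<in> live_fn P" for n
    using that assms live_fn_subset[of P] by (cases n) (auto simp: transpose_def)
  then show ?thesis by (auto simp: live_fn_ren)
qed

text \<open>Name permutations act on environments; involutions suffice and need no inverse.\<close>

definition kren :: "(sname \<Rightarrow> sname) \<Rightarrow> (cname \<Rightarrow> cname) \<Rightarrow> vkey \<Rightarrow> vkey" where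
  "kren s c k = (case k of Cur \<Rightarrow> Cur | Nm n \<Rightarrow> Nm (hren s c n))"

lemma kren_simps [simp]: "kren s c Cur = Cur" "kren s c (Nm n) = Nm (hren s c n)"
  by (simp_all add: kren_def)

definition vren :: "(sname \<Rightarrow> sname) \<Rightarrow> (cname \<Rightarrow> cname) \<Rightarrow> vis \<Rightarrow> vis" where
  "vren s c \<Delta> = (\<lambda>k. map_option ((`) (hren s c)) (\<Delta> (kren s c k)))"

definition sren :: "(cname \<Rightarrow> cname) \<Rightarrow> stack \<Rightarrow> stack" where
  "sren c \<sigma> = map (map_prod c id) \<sigma>"

lemma sren_simps [simp]: "sren c [] = []" "sren c ((p, t) # \<sigma>) = (c p, t) # sren c \<sigma>"
  "sren c (\<sigma>1 @ \<sigma>2) = sren c \<sigma>1 @ sren c \<sigma>2" "sren id \<sigma> = \<sigma>"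
  "fst ` set (sren c \<sigma>) = c ` fst ` set \<sigma>"
  by (auto simp: sren_def image_image prod.map_id0)

lemma shuffles_map: "zs \<in> shuffles xs ys \<Longrightarrow> map g zs \<in> shuffles (map g xs) (map g ys)"
  by (induction xs ys arbitrary: zs rule: shuffles.induct) auto

section \<open>Involutive renamings acting on environments\<close>

locale involutions =
  fixes s :: "sname \<Rightarrow> sname" and c :: "cname \<Rightarrow> cname"
  assumes s_s [simp]: "s (s a) = a" and c_c [simp]: "c (c p) = p"
begin

lemma inj_s: "inj s" by (metis injI s_s)
lemma inj_c: "inj c" by (metis injI c_c)

lemma hren_hren [simp]: "hren s c (hren s c n) = n"
  by (cases n) auto

lemma kren_kren [simp]: "kren s c (kren s c k) = k"
  by (cases k) auto

lemma hren_eq_iff [simp]: "hren s c n = hren s c m \<longleftrightarrow> n = m"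
  by (metis hren_hren)

lemma kren_eq_iff: "kren s c k = l \<longleftrightarrow> k = kren s c l"
  by (metis kren_kren)

lemma image_hren_hren [simp]: "hren s c ` hren s c ` V = V"
  by (simp add: image_image)

lemma vren_vren [simp]: "vren s c (vren s c \<Delta>) = \<Delta>"
  by (auto simp: vren_def fun_eq_iff option.map_comp comp_def intro!: option.map_ident_strong)

lemma sren_sren [simp]: "sren c (sren c \<sigma>) = \<sigma>"
  by (auto simp: sren_def intro!: map_idI)

lemma vren_upd [simp]: "vren s c (\<Delta>(k \<mapsto> V)) = (vren s c \<Delta>)(kren s c k \<mapsto> hren s c ` V)"
  by (auto simp: vren_def fun_eq_iff)

lemma vren_Cur [simp]: "vren s c \<Delta> Cur = map_option ((`) (hren s c)) (\<Delta> Cur)"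
  by (simp add: vren_def)

lemma vren_Nm [simp]: "vren s c \<Delta> (Nm (Srv (s a))) = map_option ((`) (hren s c)) (\<Delta> (Nm (Srv a)))"
  "vren s c \<Delta> (Nm (Con (c p))) = map_option ((`) (hren s c)) (\<Delta> (Nm (Con p)))"
  by (simp_all add: vren_def)

lemma vren_erase: "vren s c (erase \<Delta> k) = erase (vren s c \<Delta>) (kren s c k)"
proof
  fix l
  have "hren s c ` {n \<in> V. Nm n \<noteq> k} = {n \<in> hren s c ` V. Nm n \<noteq> kren s c k}" for V
    by (cases k) auto
  then show "vren s c (erase \<Delta> k) l = erase (vren s c \<Delta>) (kren s c k) l"
    by (auto simp: vren_def erase_def option.map_comp comp_def kren_eq_iff)
qed

lemma dom_vren: "dom (vren s c \<Delta>) = kren s c ` dom \<Delta>"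
  by (auto simp: vren_def dom_def image_iff) (metis kren_kren)

lemma ran_vren: "ran (vren s c \<Delta>) = (`) (hren s c) ` ran \<Delta>"
  by (auto simp: vren_def ran_def image_iff) (metis kren_kren)

lemma visfun_vren:
  assumes "visfun \<Delta>"
  shows "visfun (vren s c \<Delta>)"
proof -
  have "W \<subseteq> V" if "vren s c \<Delta> k = Some V" "n \<in> V" "vren s c \<Delta> (Nm n) = Some W" for k n V W
  proof -
    obtain V' W' where *: "\<Delta> (kren s c k) = Some V'" "V = hren s c ` V'"
      "\<Delta> (Nm (hren s c n)) = Some W'" "W = hren s c ` W'"
      using \<open>vren s c \<Delta> k = Some V\<close> \<open>vren s c \<Delta> (Nm n) = Some W\<close> by (auto simp: vren_def)
    with \<open>n \<in> V\<close> have "hren s c n \<in> V'" by auto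
    with * assms have "W' \<subseteq> V'" unfolding visfun_def by blast
    with * show ?thesis by auto
  qed
  moreover have "finite (dom (vren s c \<Delta>))" "\<forall>V \<in> ran (vren s c \<Delta>). finite V"
    using assms unfolding visfun_def dom_vren ran_vren by blast+
  ultimately show ?thesis unfolding visfun_def by blast
qed

lemma is_stack_sren: "is_stack \<sigma> \<Longrightarrow> is_stack (sren c \<sigma>)"
proof -
  assume \<sigma>: "is_stack \<sigma>"
  have eq: "map_prod c id x = (p, t :: tag) \<longleftrightarrow> x = (c p, t)" for x p t
    by (cases x) auto
  have "inj (map_prod c (id :: tag \<Rightarrow> tag))"
    by (intro prod.inj_map inj_c) auto
  then show ?thesis
    using \<sigma> unfolding is_stack_def sren_def
    by (auto simp: eq distinct_map intro: inj_on_subset)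
qed

lemma wf_env_vren: "wf_env \<Delta> \<sigma> \<Longrightarrow> wf_env (vren s c \<Delta>) (sren c \<sigma>)"
  by (simp add: wf_env_def visfun_vren is_stack_sren)

lemma supp_vren: "supp (vren s c \<Delta>) (sren c \<sigma>) = hren s c ` supp \<Delta> \<sigma>"
proof -
  have "{n. Nm n \<in> kren s c ` dom \<Delta>} = hren s c ` {n. Nm n \<in> dom \<Delta>}"
  proof (intro set_eqI iffI)
    fix n
    assume "n \<in> {n. Nm n \<in> kren s c ` dom \<Delta>}"
    then obtain k where k: "k \<in> dom \<Delta>" "Nm n = kren s c k" by blast
    then have "k = Nm (hren s c n)" by (metis kren_kren kren_simps(2))
    with k show "n \<in> hren s c ` {n. Nm n \<in> dom \<Delta>}"
      by (intro image_eqI[of _ _ "hren s c n"]) auto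
  next
    fix n
    assume "n \<in> hren s c ` {n. Nm n \<in> dom \<Delta>}"
    then obtain m where "n = hren s c m" "Nm m \<in> dom \<Delta>" by blast
    then show "n \<in> {n. Nm n \<in> kren s c ` dom \<Delta>}"
      using image_eqI[of "Nm n" "kren s c" "Nm m"] by simp
  qed
  then show ?thesis
    by (auto simp: supp_def dom_vren ran_vren image_Un image_Union image_image)
qed

lemma vunion_vren: "vunion (vren s c \<Delta>1) (vren s c \<Delta>2) = vren s c (vunion \<Delta>1 \<Delta>2)"
  by (auto simp: vunion_def vren_def fun_eq_iff split: option.splits)

lemma vinter_vren: "vinter (vren s c \<Delta>1) (vren s c \<Delta>2) = vren s c (vinter \<Delta>1 \<Delta>2)"
  by (auto simp: vinter_def vren_def fun_eq_iff split: option.splits)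

lemma duplicable_vren: "duplicable \<Delta> \<Longrightarrow> duplicable (vren s c \<Delta>)"
  by (auto simp: duplicable_def dom_vren)

lemma vsplit_vren: "(\<Delta>1, \<Delta>2) \<in> vsplit \<Delta> \<Longrightarrow> (vren s c \<Delta>1, vren s c \<Delta>2) \<in> vsplit (vren s c \<Delta>)"
  by (auto simp: vsplit_def vunion_vren vinter_vren visfun_vren duplicable_vren)

lemma inter_sren: "\<sigma> \<in> inter \<sigma>1 \<sigma>2 \<Longrightarrow> sren c \<sigma> \<in> inter (sren c \<sigma>1) (sren c \<sigma>2)"
  unfolding inter_def using is_stack_sren by (auto simp: shuffles_map sren_def)

lemma vren_fresh:
  assumes "\<forall>n \<in> supp \<Delta> \<sigma>. hren s c n = n"
  shows "vren s c \<Delta> = \<Delta>" "sren c \<sigma> = \<sigma>"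
proof -
  show "vren s c \<Delta> = \<Delta>"
  proof
    fix k
    have fix_k: "kren s c k = k" if "k \<in> dom \<Delta>" for k
      using assms that by (cases k) (auto simp: supp_def)
    have img: "hren s c ` V = V" if "\<Delta> k = Some V" for V
      using assms that by (force simp: supp_def ran_def image_iff)
    show "vren s c \<Delta> k = \<Delta> k"
    proof (cases "\<Delta> k")
      case None
      \<comment> \<open>If the image of \<open>k\<close> were in the domain, it would be fixed, and
        applying the involution again would put \<open>k\<close> itself into the domain.\<close>
      then have "\<Delta> (kren s c k) = None"
        using fix_k by (metis domIff kren_kren)
      then show ?thesis by (simp add: vren_def None)
    next
      case (Some V)
      then show ?thesis using fix_k[of k] img by (simp add: vren_def domI)
    qed
  qed
  show "sren c \<sigma> = \<sigma>"
    unfolding sren_def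
  proof (rule map_idI)
    fix x assume "x \<in> set \<sigma>"
    then have "Con (fst x) \<in> supp \<Delta> \<sigma>" by (auto simp: supp_def)
    with assms have "c (fst x) = fst x" by fastforce
    then show "map_prod c id x = x" by (cases x) auto
  qed
qed

text \<open>Transports the freshness side conditions of the binder rules. Environment and process
  are renamed by different maps, but these agree on the free names, so one image of \<open>X\<close>
  is fresh for both.\<close>

lemma fresh_ren:
  assumes "X \<inter> (supp \<Delta> \<sigma> \<union> fn Q) = {}" "inj s'" "inj c'" "\<forall>n \<in> fn Q. hren s' c' n = hren s c n"
  shows "hren s c ` X \<inter> (supp (vren s c \<Delta>) (sren c \<sigma>) \<union> fn (ren s' c' f' Q)) = {}"
proof -
  have "fn (ren s' c' f' Q) = hren s c ` fn Q"
    using assms by (auto simp: fn_ren)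
  with assms(1) show ?thesis by (auto simp: supp_vren)
qed

text \<open>Lets \<open>typed_ren\<close> pass under a binder. \<open>s'\<close> need not agree with
  \<open>s\<close> on the bound names, so the induction hypothesis is applied to a corrected map:
  undo the opening at \<open>b'\<close>, rename by \<open>s'\<close>, open again at
  \<open>s b'\<close>. It agrees with \<open>s\<close> on all free names of the opened body, and
  what it produces is syntactically the renamed body opened at the renamed fresh names.\<close>

lemma binder_agree_SC:
  assumes "inj s'" "inj c'" "{Srv b', Con p'} \<inter> (fn P - {Srv b, Con p}) = {}"
    and "\<forall>n \<in> fn P - {Srv b, Con p}. hren s' c' n = hren s c n"
  obtains s'' c'' where "inj s''" "inj c''"
    "\<forall>n \<in> fn (swapSC b b' p p' P). hren s'' c'' n = hren s c n"
    "\<And>f. ren s'' c'' f (swapSC b b' p p' P) = swapSC (s' b) (s b') (c' p) (c p') (ren s' c' f P)"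
proof
  let ?s = "transpose (s' b) (s b') \<circ> s' \<circ> transpose b b'"
  let ?c = "transpose (c' p) (c p') \<circ> c' \<circ> transpose p p'"
  show "inj ?s" "inj ?c" using assms by (auto intro!: inj_compose)
  have "hren (transpose (s' b) (s b') \<circ> s') (transpose (c' p) (c p') \<circ> c') m
      = hren s c (hren (transpose b b') (transpose p p') m)" if "m \<in> fn P" for m
    using that assms inj_s inj_c by (cases m) (force intro!: transpose_conj)+
  then show "\<forall>n \<in> fn (swapSC b b' p p' P). hren ?s ?c n = hren s c n"
    by (auto simp: fn_ren hren_comp comp_assoc)
  show "\<And>f. ren ?s ?c f (swapSC b b' p p' P) = swapSC (s' b) (s b') (c' p) (c p') (ren s' c' f P)"
    by (simp add: ren_comp comp_assoc)
qed

lemma binder_agree_S: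
  assumes "inj s'" "inj c'" "Srv b' \<notin> fn P - {Srv b}"
    and "\<forall>n \<in> fn P - {Srv b}. hren s' c' n = hren s c n"
  obtains s'' where "inj s''"
    "\<forall>n \<in> fn (swapS b b' P). hren s'' c' n = hren s c n"
    "\<And>f. ren s'' c' f (swapS b b' P) = swapS (s' b) (s b') (ren s' c' f P)"
proof
  let ?s = "transpose (s' b) (s b') \<circ> s' \<circ> transpose b b'"
  show "inj ?s" using assms by (auto intro!: inj_compose)
  have "hren (transpose (s' b) (s b') \<circ> s') c' m = hren s c (hren (transpose b b') id m)"
    if "m \<in> fn P" for m
    using that assms inj_s by (cases m) (force intro!: transpose_conj)+
  then show "\<forall>n \<in> fn (swapS b b' P). hren ?s c' n = hren s c n"
    by (auto simp: fn_ren hren_comp comp_assoc)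
  show "\<And>f. ren ?s c' f (swapS b b' P) = swapS (s' b) (s b') (ren s' c' f P)"
    by (simp add: ren_comp comp_assoc)
qed

lemma binder_agree_C:
  assumes "inj s'" "inj c'" "Con p' \<notin> fn P - {Con p}"
    and "\<forall>n \<in> fn P - {Con p}. hren s' c' n = hren s c n"
  obtains c'' where "inj c''"
    "\<forall>n \<in> fn (swapC p p' P). hren s' c'' n = hren s c n"
    "\<And>f. ren s' c'' f (swapC p p' P) = swapC (c' p) (c p') (ren s' c' f P)"
proof
  let ?c = "transpose (c' p) (c p') \<circ> c' \<circ> transpose p p'"
  show "inj ?c" using assms by (auto intro!: inj_compose)
  have "hren s' (transpose (c' p) (c p') \<circ> c') m = hren s c (hren id (transpose p p') m)"
    if "m \<in> fn P" for m
    using that assms inj_c by (cases m) (force intro!: transpose_conj)+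
  then show "\<forall>n \<in> fn (swapC p p' P). hren s' ?c n = hren s c n"
    by (auto simp: fn_ren hren_comp comp_assoc)
  show "\<And>f. ren s' ?c f (swapC p p' P) = swapC (c' p) (c p') (ren s' c' f P)"
    by (simp add: ren_comp comp_assoc)
qed

lemmas ren_unfolds = vren_upd kren_simps hren.simps image_Un image_insert image_empty ren.simps
  ren_in.simps sren_simps vren_erase

text \<open>Equivariance and invariance under alpha-conversion in one: the process may be renamed by any
  injections that agree with the involutions on its free names.\<close>

lemma typed_ren:
  assumes "typed \<Delta> \<sigma> P" "inj s'" "inj c'" "\<forall>n \<in> fn P. hren s' c' n = hren s c n"
  shows "typed (vren s c \<Delta>) (sren c \<sigma>) (ren s' c' f' P)"
  using assms
proof (induction arbitrary: s' c' f' rule: typed.induct)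
  case (typed_OutS \<Delta> V \<sigma> a b' p' e b p P)
  from binder_agree_SC[of s' c' b' p' P b p] typed_OutS.prems typed_OutS.hyps(4)
  obtain s'' c'' where "inj s''" "inj c''" "\<forall>n \<in> fn (swapSC b b' p p' P). hren s'' c'' n = hren s c n"
    and eq: "\<And>f. ren s'' c'' f (swapSC b b' p p' P) =
      swapSC (s' b) (s b') (c' p) (c p') (ren s' c' f P)"
    by auto
  note IH = typed_OutS.IH[OF this(1-3), of f', unfolded eq]
  have "s' a = s a" using typed_OutS.prems by simp
  then have "typed ((vren s c \<Delta>)(Cur \<mapsto> hren s c ` V)) (sren c \<sigma>)
    (OutS (s' a) e (s' b) (c' p) (ren s' c' f' P))"
    using typed_OutS.hyps(2,3)
    by (intro typed.typed_OutS[OF wf_env_vren[OF typed_OutS.hyps(1), unfolded ren_unfolds] _ _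
          fresh_ren[OF typed_OutS.hyps(4) typed_OutS.prems, of f', unfolded ren_unfolds]
          IH[unfolded ren_unfolds]]) (auto intro: image_eqI[of _ _ "Srv a"])
  then show ?case unfolding ren_unfolds .
next
  case (typed_OutC \<Delta> V p \<sigma> b' e b P)
  from binder_agree_S[of s' c' b' P b] typed_OutC.prems typed_OutC.hyps(4)
  obtain s'' where "inj s''" "\<forall>n \<in> fn (swapS b b' P). hren s'' c' n = hren s c n"
    and eq: "\<And>f. ren s'' c' f (swapS b b' P) = swapS (s' b) (s b') (ren s' c' f P)"
    by auto
  note IH = typed_OutC.IH[OF this(1) typed_OutC.prems(2) this(2), of f', unfolded eq]
  have "c' p = c p" using typed_OutC.prems by simp
  moreover have "hren s c ` {Srv b'} \<inter> (supp (vren s c (\<Delta>(Cur \<mapsto> V))) (sren c ((p, TO) # \<sigma>))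
      \<union> fn (ren s' c' f' (OutC p e b P))) = {}"
    using typed_OutC.hyps(4) typed_OutC.prems by (intro fresh_ren) auto
  ultimately have "typed ((vren s c \<Delta>)(Cur \<mapsto> hren s c ` V)) ((c p, TO) # sren c \<sigma>)
      (OutC (c p) e (s' b) (ren s' c' f' P))"
    using typed_OutC.hyps(2,3)
    by (intro typed.typed_OutC[OF wf_env_vren[OF typed_OutC.hyps(1), unfolded ren_unfolds] _ _ _
          IH[unfolded ren_unfolds]]) (auto intro: image_eqI[of _ _ "Con p"])
  then show ?case unfolding ren_unfolds \<open>c' p = c p\<close> .
next
  case (typed_InS \<Delta> a V \<sigma> b' p' x b p P)
  from binder_agree_SC[of s' c' b' p' P b p] typed_InS.prems typed_InS.hyps(4)
  obtain s'' c'' where "inj s''" "inj c''" "\<forall>n \<in> fn (swapSC b b' p p' P). hren s'' c'' n = hren s c n"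
    and eq: "\<And>f. ren s'' c'' f (swapSC b b' p p' P) =
      swapSC (s' b) (s b') (c' p) (c p') (ren s' c' f P)"
    by auto
  note IH = typed_InS.IH[OF this(1-3), of f', unfolded eq]
  have "s' a = s a" using typed_InS.prems by simp
  then have "typed ((vren s c \<Delta>)(Nm (Srv (s a)) \<mapsto> hren s c ` V)) (sren c \<sigma>)
      (In (InS (s a) x (s' b) (c' p)) (ren s' c' f' P))"
    using typed_InS.hyps(2,3) fresh_ren[OF typed_InS.hyps(4) typed_InS.prems, of f', unfolded
      ren_unfolds]
    by (intro typed.typed_InS[OF wf_env_vren[OF typed_InS.hyps(1), unfolded ren_unfolds] _ _ _
          IH[unfolded ren_unfolds]]) (simp_all add: duplicable_vren)
  then show ?case unfolding ren_unfolds \<open>s' a = s a\<close> .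
next
  case (typed_RepS \<Delta> a V b' p' x b p P)
  from binder_agree_SC[of s' c' b' p' P b p] typed_RepS.prems typed_RepS.hyps(4)
  obtain s'' c'' where "inj s''" "inj c''" "\<forall>n \<in> fn (swapSC b b' p p' P). hren s'' c'' n = hren s c n"
    and eq: "\<And>f. ren s'' c'' f (swapSC b b' p p' P) =
      swapSC (s' b) (s b') (c' p) (c p') (ren s' c' f P)"
    by auto
  note IH = typed_RepS.IH[OF this(1-3), of f', unfolded eq]
  have "s' a = s a" using typed_RepS.prems by simp
  then have "typed ((vren s c \<Delta>)(Nm (Srv (s a)) \<mapsto> hren s c ` V)) []
      (Rep (InS (s a) x (s' b) (c' p)) (ren s' c' f' P))"
    using typed_RepS.hyps(2,3) fresh_ren[OF typed_RepS.hyps(4) typed_RepS.prems, of f', unfolded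
      ren_unfolds]
    by (intro typed.typed_RepS[OF wf_env_vren[OF typed_RepS.hyps(1), unfolded ren_unfolds] _ _ _
          IH[unfolded ren_unfolds]]) (simp_all add: duplicable_vren)
  then show ?case unfolding ren_unfolds \<open>s' a = s a\<close> .
next
  case (typed_InC \<Delta> p V q b' x b P)
  from binder_agree_S[of s' c' b' P b] typed_InC.prems typed_InC.hyps(4)
  obtain s'' where "inj s''" "\<forall>n \<in> fn (swapS b b' P). hren s'' c' n = hren s c n"
    and eq: "\<And>f. ren s'' c' f (swapS b b' P) = swapS (s' b) (s b') (ren s' c' f P)"
    by auto
  note IH = typed_InC.IH[OF this(1) typed_InC.prems(2) this(2), of f', unfolded eq]
  have "c' p = c p" using typed_InC.prems by simp
  moreover have "hren s c ` {Srv b'} \<inter> (supp (vren s c (\<Delta>(Nm (Con p) \<mapsto> V))) (sren c [(p, TI), (q, TO)])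
      \<union> fn (ren s' c' f' (In (InC p x b) P))) = {}"
    using typed_InC.hyps(4) typed_InC.prems by (intro fresh_ren) auto
  ultimately have "typed ((vren s c \<Delta>)(Nm (Con (c p)) \<mapsto> hren s c ` V)) [(c p, TI), (c q, TO)]
      (In (InC (c p) x (s' b)) (ren s' c' f' P))"
    using typed_InC.hyps(2,3)
    by (intro typed.typed_InC[OF wf_env_vren[OF typed_InC.hyps(1), unfolded ren_unfolds] _ _ _
          IH[unfolded ren_unfolds]]) auto
  then show ?case unfolding ren_unfolds \<open>c' p = c p\<close> .
next
  case (typed_NuS \<Delta> a' \<sigma> a P)
  from binder_agree_S[of s' c' a' P a] typed_NuS.prems typed_NuS.hyps(2)
  obtain s'' where "inj s''" "\<forall>n \<in> fn (swapS a a' P). hren s'' c' n = hren s c n"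
    and eq: "\<And>f. ren s'' c' f (swapS a a' P) = swapS (s' a) (s a') (ren s' c' f P)"
    by auto
  note IH = typed_NuS.IH[OF this(1) typed_NuS.prems(2) this(2), of f', unfolded eq]
  \<comment> \<open>The restriction rule asks \<open>a'\<close> to be fresh for the process alone,
    so \<open>fresh_ren\<close> is used with the empty environment.\<close>
  have "hren s c ` {Srv a'} \<inter> (supp (vren s c Map.empty) (sren c []) \<union> fn
    (ren s' c' f' (NuS a P))) = {}"
    using typed_NuS.hyps(2) typed_NuS.prems by (intro fresh_ren) (auto simp: supp_def)
  then have "typed (erase (vren s c \<Delta>) (Nm (Srv (s a')))) (sren c \<sigma>) (NuS (s' a) (ren s' c' f' P))"
    by (intro typed.typed_NuS[OF wf_env_vren[OF typed_NuS.hyps(1), unfolded ren_unfolds] _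
          IH[unfolded ren_unfolds]]) auto
  then show ?case unfolding ren_unfolds .
next
  case (typed_NuC_pair \<Delta> p' \<sigma>1 \<sigma>2 p P)
  from binder_agree_C[of s' c' p' P p] typed_NuC_pair.prems typed_NuC_pair.hyps(2)
  obtain c'' where "inj c''" "\<forall>n \<in> fn (swapC p p' P). hren s' c'' n = hren s c n"
    and eq: "\<And>f. ren s' c'' f (swapC p p' P) = swapC (c' p) (c p') (ren s' c' f P)"
    by auto
  note IH = typed_NuC_pair.IH[OF typed_NuC_pair.prems(1) this(1,2), of f', unfolded eq]
  have "hren s c ` {Con p'} \<inter> (supp (vren s c Map.empty) (sren c []) \<union> fn
    (ren s' c' f' (NuC p P))) = {}"
    using typed_NuC_pair.hyps(2) typed_NuC_pair.prems by (intro fresh_ren) (auto simp: supp_def)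
  then have "typed (erase (vren s c \<Delta>) (Nm (Con (c p')))) (sren c \<sigma>1 @ sren c \<sigma>2)
    (NuC (c' p) (ren s' c' f' P))"
    by (intro typed.typed_NuC_pair[OF wf_env_vren[OF typed_NuC_pair.hyps(1), unfolded ren_unfolds] _
          IH[unfolded ren_unfolds]]) auto
  then show ?case unfolding ren_unfolds .
next
  case (typed_NuC_absent \<Delta> p' \<sigma> p P)
  from binder_agree_C[of s' c' p' P p] typed_NuC_absent.prems typed_NuC_absent.hyps(2)
  obtain c'' where "inj c''" "\<forall>n \<in> fn (swapC p p' P). hren s' c'' n = hren s c n"
    and eq: "\<And>f. ren s' c'' f (swapC p p' P) = swapC (c' p) (c p') (ren s' c' f P)"
    by auto
  note IH = typed_NuC_absent.IH[OF typed_NuC_absent.prems(1) this(1,2), of f', unfolded eq]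
  have "hren s c ` {Con p'} \<inter> (supp (vren s c Map.empty) (sren c []) \<union> fn
    (ren s' c' f' (NuC p P))) = {}"
    using typed_NuC_absent.hyps(2) typed_NuC_absent.prems by (intro fresh_ren) (auto simp: supp_def)
  moreover have "c p' \<notin> fst ` set (sren c \<sigma>)"
    using typed_NuC_absent.hyps(3) by (simp add: inj_image_mem_iff[OF inj_c])
  ultimately have "typed (erase (vren s c \<Delta>) (Nm (Con (c p')))) (sren c \<sigma>)
    (NuC (c' p) (ren s' c' f' P))"
    by (intro typed.typed_NuC_absent[OF wf_env_vren[OF typed_NuC_absent.hyps(1), unfolded
      ren_unfolds] _ _
          IH[unfolded ren_unfolds]]) auto
  then show ?case unfolding ren_unfolds .
next
  case (typed_Par \<Delta> \<sigma> \<Delta>1 \<sigma>1 P1 \<Delta>2 \<sigma>2 P2)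
  have "typed (vren s c \<Delta>1) (sren c \<sigma>1) (ren s' c' f' P1)"
    "typed (vren s c \<Delta>2) (sren c \<sigma>2) (ren s' c' f' P2)"
    using typed_Par.prems by (auto intro!: typed_Par.IH)
  with typed_Par.hyps show ?case
    by (auto intro!: typed.typed_Par[OF wf_env_vren _ _ vsplit_vren inter_sren])
next
  case (typed_Stop \<Delta>)
  then show ?case using wf_env_vren[of \<Delta> "[]"] by (auto intro!: typed.typed_Stop simp: duplicable_vren)
next
  case (typed_Succ \<Delta> w P)
  then show ?case using wf_env_vren[of \<Delta> "[]"] by (auto intro!: typed.typed_Succ)
next
  case (typed_OutF \<Delta> P h e)
  then show ?case using wf_env_vren[of \<Delta> "[]"] by (auto intro!: typed.typed_OutF simp: domIff)
next
  case (typed_InF \<Delta> P h x)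
  then show ?case using wf_env_vren[of \<Delta> "[]"] by (auto intro!: typed.typed_InF simp: domIff)
next
  case (typed_NuF \<Delta> \<sigma> P h)
  then show ?case by (auto intro!: typed.typed_NuF wf_env_vren)
next
  case (typed_Sum \<Delta> P1 P2)
  then show ?case using wf_env_vren[of \<Delta> "[]"] by (auto intro!: typed.typed_Sum)
next
  case (typed_Cond \<Delta> P1 P2 e f)
  then show ?case using wf_env_vren[of \<Delta> "[]"] by (auto intro!: typed.typed_Cond)
qed

end

lemma involutions_transpose: "involutions (transpose a b) (transpose p q)"
  by unfold_locales auto

lemma involutions_id: "involutions id id"
  by unfold_locales auto

lemma vren_id [simp]: "vren id id \<Delta> = \<Delta>"
proof
  fix k
  have "kren id id k = k" by (cases k) auto
  then show "vren id id \<Delta> k = \<Delta> k"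
    by (auto simp: vren_def intro!: option.map_ident_strong)
qed

text \<open>The identity on environments turns \<open>typed_ren\<close> into invariance under
  changes of bound names. First-order names occur in no environment, so \<open>f\<close> is
  unrestricted; this is what opening a first-order restriction needs.\<close>

lemma typed_ren_fresh:
  assumes "typed \<Delta> \<sigma> P" "inj s" "inj c" "\<forall>n \<in> fn P. hren s c n = n"
  shows "typed \<Delta> \<sigma> (ren s c f P)"
  using involutions.typed_ren[OF involutions_id assms(1-3)] assms(4) by simp

text \<open>Trades the fresh names \<open>b0\<close>, \<open>p0\<close> of an opened body for
  \<open>b'\<close>, \<open>p'\<close>. The raw map that undoes the first opening and performs the
  second agrees, on the free names of the opened body, with the transposition of the two fresh
  names, so \<open>typed_ren\<close> can apply the latter to the environment.\<close>

lemma typed_swap_binder: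
  assumes "typed \<Delta> \<sigma> (swapSC b b0 p p0 P)"
    and "{Srv b0, Con p0, Srv b', Con p'} \<inter> (fn P - {Srv b, Con p}) = {}"
  shows "typed (vren (transpose b0 b') (transpose p0 p') \<Delta>) (sren (transpose p0 p') \<sigma>)
    (swapSC b b' p p' P)"
proof -
  interpret involutions "transpose b0 b'" "transpose p0 p'" by (rule involutions_transpose)
  let ?s = "transpose b b' \<circ> transpose b b0" and ?c = "transpose p p' \<circ> transpose p p0"
  have "hren (transpose b b') (transpose p p') m
      = hren (transpose b0 b') (transpose p0 p') (hren (transpose b b0) (transpose p p0) m)"
    if "m \<in> fn P" for m
    using that assms(2) by (cases m) (auto simp: transpose_def)
  then have "\<forall>n \<in> fn (swapSC b b0 p p0 P). hren ?s ?c n = hren (transpose b0 b') (transpose p0 p') n"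
    by (auto simp: fn_ren hren_comp comp_assoc)
  from typed_ren[OF assms(1) _ _ this, of id] show ?thesis
    by (auto simp: ren_comp comp_assoc inj_compose)
qed

subsection \<open>Inversion with fresh bound names\<close>

abbreviation server_keys :: "vkey set" where
  "server_keys \<equiv> range (\<lambda>a. Nm (Srv a))"

abbreviation call_env :: "vis \<Rightarrow> hname set \<Rightarrow> sname \<Rightarrow> cname \<Rightarrow> vis" where
  "call_env \<Delta> V b p \<equiv> (erase \<Delta> Cur)(Nm (Srv b) \<mapsto> V \<union> {Srv b}, Nm (Con p) \<mapsto> V \<union> {Srv b})"

abbreviation reply_env :: "vis \<Rightarrow> hname set \<Rightarrow> sname \<Rightarrow> vis" where
  "reply_env \<Delta> V b \<equiv> (erase \<Delta> Cur)(Nm (Srv b) \<mapsto> V \<union> {Srv b})"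

abbreviation serve_env :: "vis \<Rightarrow> hname set \<Rightarrow> sname \<Rightarrow> cname \<Rightarrow> vis" where
  "serve_env \<Delta> V b p \<equiv> \<Delta>(Cur \<mapsto> V \<union> {Srv b, Con p})"

lemma typed_swap_binder_S:
  assumes "typed \<Delta> \<sigma> (swapS b b0 P)" "{Srv b0, Srv b'} \<inter> (fn P - {Srv b}) = {}"
  shows "typed (vren (transpose b0 b') id \<Delta>) \<sigma> (swapS b b' P)"
  \<comment> \<open>The continuation part is filled with transpositions of \<open>CName 0\<close>
    with itself, which are the identity.\<close>
  using typed_swap_binder[of \<Delta> \<sigma> b b0 "CName 0" "CName 0" P b' "CName 0"] assms by auto

lemma typed_swap_binder_C:
  assumes "typed \<Delta> \<sigma> (swapC p p0 P)" "{Con p0, Con p'} \<inter> (fn P - {Con p}) = {}"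
  shows "typed (vren id (transpose p0 p') \<Delta>) (sren (transpose p0 p') \<sigma>) (swapC p p' P)"
  using typed_swap_binder[of \<Delta> \<sigma> "SName 0" "SName 0" p p0 P "SName 0" p'] assms by auto

lemma involutions_transpose_S: "involutions (transpose a b) id"
  by unfold_locales auto

lemma involutions_transpose_C: "involutions id (transpose p q)"
  by unfold_locales auto

lemma swap_fresh:
  assumes "{Srv b0, Srv b', Con p0, Con p'} \<inter> X = {}" "n \<in> X"
  shows "hren (transpose b0 b') (transpose p0 p') n = n"
  using assms by (cases n) (auto simp: transpose_def)

lemma swap_fresh_S:
  assumes "{Srv b0, Srv b'} \<inter> X = {}" "n \<in> X"
  shows "hren (transpose b0 b') id n = n"
  using assms by (cases n) (auto simp: transpose_def)

lemma swap_fresh_C: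
  assumes "{Con p0, Con p'} \<inter> X = {}" "n \<in> X"
  shows "hren id (transpose p0 p') n = n"
  using assms by (cases n) (auto simp: transpose_def)

section \<open>Support, erasure and transitivity of visibility functions\<close>

lemma supp_upd: "\<Delta> k = None \<Longrightarrow> supp (\<Delta>(k \<mapsto> V)) \<sigma> = supp \<Delta> \<sigma> \<union> V \<union> {n. k = Nm n}"
  by (auto simp: supp_def)

lemma supp_Cons: "supp \<Delta> ((p, t) # \<sigma>) = insert (Con p) (supp \<Delta> \<sigma>)"
  by (auto simp: supp_def)

lemma supp_append: "supp \<Delta> (\<sigma>1 @ \<sigma>2) = supp \<Delta> \<sigma>1 \<union> supp \<Delta> \<sigma>2"
  by (auto simp: supp_def)

lemma supp_Nil_subset: "supp \<Delta> [] \<subseteq> supp \<Delta> \<sigma>"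
  by (auto simp: supp_def)

lemma suppI:
  "\<Delta> (Nm n) = Some V \<Longrightarrow> n \<in> supp \<Delta> \<sigma>"
  "\<Delta> k = Some V \<Longrightarrow> n \<in> V \<Longrightarrow> n \<in> supp \<Delta> \<sigma>"
  "(p, t) \<in> set \<sigma> \<Longrightarrow> Con p \<in> supp \<Delta> \<sigma>"
  by (force simp: supp_def ran_def)+

lemma finite_supp: "visfun \<Delta> \<Longrightarrow> finite (supp \<Delta> \<sigma>)"
proof -
  assume vis: "visfun \<Delta>"
  have "{n. Nm n \<in> dom \<Delta>} = Nm -` dom \<Delta>" by auto
  moreover have "inj Nm" by (auto intro: injI)
  ultimately have "finite {n. Nm n \<in> dom \<Delta>}"
    using vis by (simp add: visfun_def finite_vimageI)
  with vis show ?thesis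
    unfolding supp_def visfun_def using finite_ran[of \<Delta>] by blast
qed

lemma erase_Cur: "erase \<Delta> Cur = \<Delta>(Cur := None)"
  by (auto simp: erase_def fun_eq_iff intro!: option.map_ident_strong)

lemma erase_fresh: "n \<notin> supp \<Delta> \<sigma> \<Longrightarrow> erase \<Delta> (Nm n) = \<Delta>"
  by (auto simp: erase_def supp_def ran_def fun_eq_iff intro!: option.map_ident_strong)

lemma erase_commute: "erase (erase \<Delta> k) l = erase (erase \<Delta> l) k"
  by (auto simp: erase_def fun_eq_iff option.map_comp comp_def intro!: option.map_cong)

lemma erase_erase [simp]: "erase (erase \<Delta> k) k = erase \<Delta> k"
  by (auto simp: erase_def fun_eq_iff option.map_comp comp_def)

lemma erase_upd: "k \<noteq> l \<Longrightarrow> erase (\<Delta>(k \<mapsto> V)) l = (erase \<Delta> l)(k \<mapsto> {n \<in> V. Nm n \<noteq> l})"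
  by (auto simp: erase_def fun_eq_iff)

lemma dom_erase [simp]: "dom (erase \<Delta> k) = dom \<Delta> - {k}"
  by (auto simp: erase_def dom_def)

lemma erase_apply: "erase \<Delta> k l = (if l = k then None else map_option (\<lambda>V. {n \<in> V. Nm n \<noteq> k}) (\<Delta> l))"
  by (simp add: erase_def)

lemma supp_erase: "supp (erase \<Delta> k) \<sigma> \<subseteq> supp \<Delta> \<sigma>"
  unfolding supp_def dom_erase by (fastforce simp: erase_def ran_def split: if_splits)

lemma supp_erase_notin: "n \<notin> Con ` fst ` set \<sigma> \<Longrightarrow> n \<notin> supp (erase \<Delta> (Nm n)) \<sigma>"
  unfolding supp_def dom_erase by (auto simp: erase_def ran_def split: if_splits)

lemma visfunD: "visfun \<Delta> \<Longrightarrow> \<Delta> k = Some V \<Longrightarrow> n \<in> V \<Longrightarrow> \<Delta> (Nm n) = Some W \<Longrightarrow> W \<subseteq> V"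
  unfolding visfun_def by blast

lemma visfun_finite: "visfun \<Delta> \<Longrightarrow> \<Delta> k = Some V \<Longrightarrow> finite V"
  unfolding visfun_def by (blast intro: ranI)

lemma visfunI:
  assumes "finite (dom \<Delta>)" "\<And>k V. \<Delta> k = Some V \<Longrightarrow> finite V"
    "\<And>k n V W. \<Delta> k = Some V \<Longrightarrow> n \<in> V \<Longrightarrow> \<Delta> (Nm n) = Some W \<Longrightarrow> W \<subseteq> V"
  shows "visfun \<Delta>"
  using assms unfolding visfun_def ran_def by blast

lemma visfun_erase:
  assumes "visfun \<Delta>"
  shows "visfun (erase \<Delta> k)"
proof (rule visfunI)
  show "finite (dom (erase \<Delta> k))" using assms by (simp add: visfun_def)
next
  fix l V assume "erase \<Delta> k l = Some V"
  then show "finite V" using visfun_finite[OF assms] by (auto simp: erase_apply split: if_splits)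
next
  fix l n V W assume "erase \<Delta> k l = Some V" "n \<in> V" "erase \<Delta> k (Nm n) = Some W"
  then obtain V' W' where "\<Delta> l = Some V'" "\<Delta> (Nm n) = Some W'" "n \<in> V'"
    "V = {n \<in> V'. Nm n \<noteq> k}" "W = {n \<in> W'. Nm n \<noteq> k}"
    by (auto simp: erase_apply split: if_splits)
  with visfunD[OF assms this(1,3,2)] show "W \<subseteq> V" by auto
qed

lemma visfun_upd:
  assumes "visfun \<Delta>" "finite V"
    "\<And>n W. n \<in> V \<Longrightarrow> Nm n \<noteq> k \<Longrightarrow> \<Delta> (Nm n) = Some W \<Longrightarrow> W \<subseteq> V"
    "\<And>l U m. k = Nm m \<Longrightarrow> l \<noteq> k \<Longrightarrow> \<Delta> l = Some U \<Longrightarrow> m \<in> U \<Longrightarrow> V \<subseteq> U"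
  shows "visfun (\<Delta>(k \<mapsto> V))"
proof (rule visfunI)
  show "finite (dom (\<Delta>(k \<mapsto> V)))" using assms by (simp add: visfun_def)
next
  fix l U assume "(\<Delta>(k \<mapsto> V)) l = Some U"
  then show "finite U" using visfun_finite[OF assms(1)] assms(2) by (auto split: if_splits)
next
  fix l n U W assume "(\<Delta>(k \<mapsto> V)) l = Some U" "n \<in> U" "(\<Delta>(k \<mapsto> V)) (Nm n) = Some W"
  then show "W \<subseteq> U"
    using assms(3)[of n W] assms(4)[of n l U] visfunD[OF assms(1), of l U n W]
    by (cases "l = k"; cases "Nm n = k") auto
qed

section \<open>The typing rules as equivalences at any fresh names\<close>

lemma typed_wf: "typed \<Delta> \<sigma> P \<Longrightarrow> wf_env \<Delta> \<sigma>"
  by (erule typed.cases) auto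

lemma typed_visfun: "typed \<Delta> \<sigma> P \<Longrightarrow> visfun \<Delta>"
  using typed_wf wf_env_def by blast

lemma typed_stack: "typed \<Delta> \<sigma> P \<Longrightarrow> is_stack \<sigma>"
  using typed_wf wf_env_def by blast

text \<open>The rule only provides some fresh \<open>b0\<close>, \<open>p0\<close>. These and
  \<open>b'\<close>, \<open>p'\<close> are all absent from \<open>\<Delta>'\<close>,
  \<open>\<sigma>\<close> and \<open>V\<close>, so transposing them fixes everything except the
  entries just added, and the premise can be read at any fresh names of choice. The equivalences for
  the other prefixes with bound names rest on the same exchange.\<close>

lemma typed_OutS_iff:
  assumes fresh: "{Srv b', Con p'} \<inter> (supp \<Delta> \<sigma> \<union> fn (OutS a e b p P)) = {}"
  shows "typed \<Delta> \<sigma> (OutS a e b p P) \<longleftrightarrow> wf_env \<Delta> \<sigma> \<and> (\<exists>V. \<Delta> Cur = Some V \<and> Srv a \<in> V \<and>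
    typed (call_env \<Delta> V b' p') ((p', TI) # \<sigma>)
      (swapSC b b' p p' P))" (is "?L \<longleftrightarrow> ?R")
proof
  assume ?L
  then show ?R
  proof cases
    case (typed_OutS \<Delta>' V b0 p0)
    let ?s = "transpose b0 b'" and ?c = "transpose p0 p'"
    interpret involutions ?s ?c by (rule involutions_transpose)
    have "{Srv b0, Srv b', Con p0, Con p'} \<inter> (supp \<Delta>' \<sigma> \<union> V) = {}"
      using typed_OutS fresh by (auto simp: supp_upd)
    note fr = swap_fresh[OF this]
    have eqs: "vren ?s ?c \<Delta>' = \<Delta>'" "sren ?c \<sigma> = \<sigma>" "hren ?s ?c ` V = V"
      using fr by (auto intro!: vren_fresh simp: image_iff)
    have "{Srv b0, Con p0, Srv b', Con p'} \<inter> (fn P - {Srv b, Con p}) = {}"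
      using typed_OutS(5) fresh by auto
    from typed_swap_binder[OF typed_OutS(6) this, unfolded ren_unfolds eqs transpose_apply_first]
    have "typed (\<Delta>'(Nm (Srv b') \<mapsto> V \<union> {Srv b'}, Nm (Con p') \<mapsto> V \<union> {Srv b'})) ((p', TI) # \<sigma>)
        (swapSC b b' p p' P)" .
    moreover have "erase \<Delta> Cur = \<Delta>'"
      using typed_OutS(1,3) by (auto simp: erase_Cur)
    ultimately show ?thesis using typed_OutS by auto
  qed
next
  assume ?R
  then obtain V where V: "\<Delta> Cur = Some V" "Srv a \<in> V"
    "typed (call_env \<Delta> V b' p') ((p', TI) # \<sigma>)
      (swapSC b b' p p' P)" "wf_env \<Delta> \<sigma>" by blast
  have "\<Delta> = (erase \<Delta> Cur)(Cur \<mapsto> V)" using V(1) by (auto simp: erase_Cur)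
  then show ?L using typed_OutS[of "erase \<Delta> Cur" V \<sigma> a b' p' e b p P] V fresh
    by (auto simp: erase_Cur)
qed

lemma typed_OutC_iff:
  assumes fresh: "Srv b' \<notin> supp \<Delta> \<sigma> \<union> fn (OutC p e b P)"
  shows "typed \<Delta> \<sigma> (OutC p e b P) \<longleftrightarrow> wf_env \<Delta> \<sigma> \<and> (\<exists>V \<sigma>'. \<sigma> = (p, TO) # \<sigma>' \<and> \<Delta> Cur = Some V \<and> Con p \<in> V \<and>
    typed (reply_env \<Delta> V b') \<sigma>' (swapS b b' P))" (is "?L \<longleftrightarrow> ?R")
proof
  assume ?L
  then show ?R
  proof cases
    case (typed_OutC \<Delta>' V \<sigma>' b0)
    let ?s = "transpose b0 b'"
    interpret involutions ?s id by (rule involutions_transpose_S)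
    have "{Srv b0, Srv b'} \<inter> (supp \<Delta>' \<sigma>' \<union> V) = {}"
      using typed_OutC fresh by (auto simp: supp_upd supp_Cons)
    note fr = swap_fresh_S[OF this]
    have eqs: "vren ?s id \<Delta>' = \<Delta>'" "hren ?s id ` V = V"
      using fr by (auto intro!: vren_fresh simp: image_iff)
    have "{Srv b0, Srv b'} \<inter> (fn P - {Srv b}) = {}"
      using typed_OutC(6) fresh by auto
    from typed_swap_binder_S[OF typed_OutC(7) this, unfolded ren_unfolds eqs transpose_apply_first]
    have "typed (\<Delta>'(Nm (Srv b') \<mapsto> V \<union> {Srv b'})) \<sigma>' (swapS b b' P)" .
    moreover have "erase \<Delta> Cur = \<Delta>'"
      using typed_OutC(1,4) by (auto simp: erase_Cur)
    ultimately show ?thesis using typed_OutC by auto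
  qed
next
  assume ?R
  then obtain V \<sigma>' where V: "\<sigma> = (p, TO) # \<sigma>'" "\<Delta> Cur = Some V" "Con p \<in> V"
    "typed (reply_env \<Delta> V b') \<sigma>' (swapS b b' P)" "wf_env \<Delta> \<sigma>" by blast
  have "\<Delta> = (erase \<Delta> Cur)(Cur \<mapsto> V)" using V(2) by (auto simp: erase_Cur)
  then show ?L using typed_OutC[of "erase \<Delta> Cur" V p \<sigma>' b' e b P] V fresh
    by (auto simp: erase_Cur)
qed

lemma typed_InS_iff:
  assumes fresh: "{Srv b', Con p'} \<inter> (supp \<Delta> \<sigma> \<union> fn (In (InS a x b p) P)) = {}"
  shows "typed \<Delta> \<sigma> (In (InS a x b p) P) \<longleftrightarrow> wf_env \<Delta> \<sigma> \<and> \<Delta> Cur = None \<and> (\<exists>V. \<Delta> (Nm (Srv a)) = Some V \<and>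
    typed (serve_env \<Delta> V b' p') ((p', TO) # \<sigma>) (swapSC b b' p p' P))" (is "?L \<longleftrightarrow> ?R")
proof
  assume ?L
  then show ?R
  proof cases
    case (typed_InS \<Delta>' V b0 p0)
    let ?s = "transpose b0 b'" and ?c = "transpose p0 p'"
    interpret involutions ?s ?c by (rule involutions_transpose)
    have "V \<subseteq> supp \<Delta> \<sigma>" using typed_InS(1,3) by (auto simp: supp_upd)
    then have "{Srv b0, Srv b', Con p0, Con p'} \<inter> (supp \<Delta> \<sigma> \<union> V) = {}"
      using typed_InS fresh by auto
    note fr = swap_fresh[OF this]
    have eqs: "vren ?s ?c \<Delta> = \<Delta>" "sren ?c \<sigma> = \<sigma>" "hren ?s ?c ` V = V"
      using fr by (auto intro!: vren_fresh simp: image_iff)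
    have "{Srv b0, Con p0, Srv b', Con p'} \<inter> (fn P - {Srv b, Con p}) = {}"
      using typed_InS(5) fresh by auto
    from typed_swap_binder[OF typed_InS(6)[folded typed_InS(1)] this, unfolded ren_unfolds eqs
      transpose_apply_first]
    show ?thesis using typed_InS(1-4) by auto
  qed
next
  assume ?R
  then obtain V where V: "\<Delta> Cur = None" "\<Delta> (Nm (Srv a)) = Some V" "wf_env \<Delta> \<sigma>"
    "typed (serve_env \<Delta> V b' p') ((p', TO) # \<sigma>) (swapSC b b' p p' P)" by blast
  have "\<Delta> = (\<Delta>(Nm (Srv a) := None))(Nm (Srv a) \<mapsto> V)" using V(2) by auto
  then show ?L using typed_InS[of "\<Delta>(Nm (Srv a) := None)" a V \<sigma> b' p' x b p P] V fresh
    by auto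
qed

text \<open>A replicated server is a single input over a duplicable environment with empty stack. No
  fresh names appear in this form, so unfolding a replication needs no renaming.\<close>

lemma typed_RepS_iff:
  "typed \<Delta> \<sigma> (Rep (InS a x b p) P) \<longleftrightarrow> \<sigma> = [] \<and> duplicable \<Delta> \<and> typed \<Delta> [] (In (InS a x b p) P)"
  (is "?L \<longleftrightarrow> ?R")
proof
  assume ?L
  then show ?R
  proof cases
    case (typed_RepS \<Delta>' V b' p')
    have "\<Delta>' Cur = None" "duplicable \<Delta>" using typed_RepS(1,5) by (auto simp: duplicable_def)
    moreover have "{Srv b', Con p'} \<inter> (supp (\<Delta>'(Nm (Srv a) \<mapsto> V)) [] \<union> fn (In (InS a x b p) P)) = {}"
      using typed_RepS(6) by simp
    ultimately show ?thesis
      using typed_InS[OF typed_RepS(3,4) _ _ typed_RepS(7)] typed_RepS(1,2) by simp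
  qed
next
  assume R: ?R
  then have "typed \<Delta> [] (In (InS a x b p) P)" by blast
  then show ?L
  proof cases
    case (typed_InS \<Delta>' V b' p')
    have "dom \<Delta>' \<subseteq> dom \<Delta>" using typed_InS(1) by auto
    then have "duplicable \<Delta>'" using R by (auto simp: duplicable_def)
    moreover have "{Srv b', Con p'} \<inter> (supp (\<Delta>'(Nm (Srv a) \<mapsto> V)) [] \<union> fn (Rep (InS a x b p) P)) = {}"
      using typed_InS(5) by simp
    ultimately show ?thesis
      using typed_RepS[OF typed_InS(2,3) _ _ typed_InS(6)] typed_InS(1) R by simp
  qed
qed

lemma typed_InC_iff:
  assumes fresh: "Srv b' \<notin> supp \<Delta> \<sigma> \<union> fn (In (InC p x b) P)"
  shows "typed \<Delta> \<sigma> (In (InC p x b) P) \<longleftrightarrow> wf_env \<Delta> \<sigma> \<and> \<Delta> Cur = None \<and>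
    (\<exists>V q. \<sigma> = [(p, TI), (q, TO)] \<and> \<Delta> (Nm (Con p)) = Some V \<and>
    typed (\<Delta>(Nm (Con p) := None, Cur \<mapsto> V \<union> {Srv b'})) [(q, TO)] (swapS b b' P))" (is "?L \<longleftrightarrow> ?R")
proof
  assume ?L
  then show ?R
  proof cases
    case (typed_InC \<Delta>' V q b0)
    let ?s = "transpose b0 b'"
    interpret involutions ?s id by (rule involutions_transpose_S)
    have "{Srv b0, Srv b'} \<inter> (supp \<Delta>' [] \<union> V) = {}"
      using typed_InC fresh supp_Nil_subset by (fastforce simp: supp_upd)
    note fr = swap_fresh_S[OF this]
    have eqs: "vren ?s id \<Delta>' = \<Delta>'" "hren ?s id ` V = V"
      using fr by (auto intro!: vren_fresh[where \<sigma> = "[]"] simp: image_iff)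
    have "{Srv b0, Srv b'} \<inter> (fn P - {Srv b}) = {}"
      using typed_InC(6) fresh by auto
    from typed_swap_binder_S[OF typed_InC(7) this, unfolded ren_unfolds eqs transpose_apply_first]
    have "typed (\<Delta>'(Cur \<mapsto> V \<union> {Srv b'})) [(q, TO)] (swapS b b' P)" .
    moreover have "\<Delta>(Nm (Con p) := None) = \<Delta>'"
      using typed_InC(1,4) by auto
    ultimately show ?thesis using typed_InC by auto
  qed
next
  assume ?R
  then obtain V q where V: "\<sigma> = [(p, TI), (q, TO)]" "\<Delta> Cur = None" "\<Delta> (Nm (Con p)) = Some V"
    "wf_env \<Delta> \<sigma>"
    "typed (\<Delta>(Nm (Con p) := None, Cur \<mapsto> V \<union> {Srv b'})) [(q, TO)] (swapS b b' P)" by blast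
  have "\<Delta> = (\<Delta>(Nm (Con p) := None))(Nm (Con p) \<mapsto> V)" using V(3) by auto
  then show ?L using typed_InC[of "\<Delta>(Nm (Con p) := None)" p V q b' x b P] V fresh
    by auto
qed

text \<open>\<open>\<Delta>0\<close> may mention both \<open>a0\<close> and \<open>a'\<close>, so it
  is permuted as a whole. Erasing \<open>a'\<close> from the result still gives \<Delta>:
  \<open>a0\<close> has been erased from \<Delta> and \<open>a'\<close> is fresh for it, so the
  permutation fixes \<Delta>.\<close>

lemma typed_NuS_iff:
  assumes fresh: "Srv a' \<notin> supp \<Delta> \<sigma> \<union> fn (NuS a P)"
  shows "typed \<Delta> \<sigma> (NuS a P) \<longleftrightarrow> wf_env \<Delta> \<sigma> \<and>
    (\<exists>\<Delta>0. erase \<Delta>0 (Nm (Srv a')) = \<Delta> \<and> typed \<Delta>0 \<sigma> (swapS a a' P))" (is "?L \<longleftrightarrow> ?R")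
proof
  assume ?L
  then show ?R
  proof cases
    case (typed_NuS \<Delta>0 a0)
    let ?s = "transpose a0 a'"
    interpret involutions ?s id by (rule involutions_transpose_S)
    have "Srv a0 \<notin> supp \<Delta> \<sigma>"
      using supp_erase_notin[of "Srv a0" \<sigma> \<Delta>0] typed_NuS(1) by auto
    then have "{Srv a0, Srv a'} \<inter> supp \<Delta> \<sigma> = {}" using fresh by auto
    then have "vren ?s id \<Delta> = \<Delta>" using swap_fresh_S by (intro vren_fresh) auto
    then have "erase (vren ?s id \<Delta>0) (Nm (Srv a')) = \<Delta>"
      unfolding typed_NuS(1) ren_unfolds transpose_apply_first by simp
    moreover have "{Srv a0, Srv a'} \<inter> (fn P - {Srv a}) = {}"
      using typed_NuS(3) fresh by auto
    ultimately show ?thesis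
      using typed_swap_binder_S[OF typed_NuS(4)] typed_NuS(1,2) by auto
  qed
next
  assume ?R
  then show ?L using fresh by (auto intro!: typed_NuS)
qed

lemma typed_NuC_iff:
  assumes fresh: "Con p' \<notin> supp \<Delta> \<sigma> \<union> fn (NuC p P)"
  shows "typed \<Delta> \<sigma> (NuC p P) \<longleftrightarrow> wf_env \<Delta> \<sigma> \<and>
    (\<exists>\<Delta>0. erase \<Delta>0 (Nm (Con p')) = \<Delta> \<and> (typed \<Delta>0 \<sigma> (swapC p p' P) \<or>
      (\<exists>\<sigma>1 \<sigma>2. \<sigma> = \<sigma>1 @ \<sigma>2 \<and> typed \<Delta>0 (\<sigma>1 @ (p', TO) # (p', TI) # \<sigma>2) (swapC p p' P))))"
    (is "?L \<longleftrightarrow> ?R")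
proof
  assume L: ?L
  then show ?R
  proof cases
    case (typed_NuC_absent \<Delta>0 p0)
    let ?c = "transpose p0 p'"
    interpret involutions id ?c by (rule involutions_transpose_C)
    have "Con p0 \<notin> supp \<Delta> \<sigma>"
      using supp_erase_notin[of "Con p0" \<sigma> \<Delta>0] typed_NuC_absent(1,4) by auto
    then have "{Con p0, Con p'} \<inter> supp \<Delta> \<sigma> = {}" using fresh by auto
    then have eqs: "vren id ?c \<Delta> = \<Delta>" "sren ?c \<sigma> = \<sigma>"
      using swap_fresh_C by (auto intro!: vren_fresh[where \<Delta> = \<Delta> and \<sigma> = \<sigma>])
    then have "erase (vren id ?c \<Delta>0) (Nm (Con p')) = \<Delta>"
      unfolding typed_NuC_absent(1) ren_unfolds transpose_apply_first by simp
    moreover have "{Con p0, Con p'} \<inter> (fn P - {Con p}) = {}"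
      using typed_NuC_absent(3) fresh by auto
    note typed_swap_binder_C[OF typed_NuC_absent(5) this, unfolded eqs]
    ultimately show ?thesis
      using typed_wf[OF L] by blast
  next
    case (typed_NuC_pair \<Delta>0 p0 \<sigma>1 \<sigma>2)
    let ?c = "transpose p0 p'"
    interpret involutions id ?c by (rule involutions_transpose_C)
    have "distinct (\<sigma>1 @ (p0, TO) # (p0, TI) # \<sigma>2)"
      using typed_stack[OF typed_NuC_pair(5)] by (simp only: is_stack_def)
    \<comment> \<open>The pair already uses both tags of \<open>p0\<close>, and a stack has no
      repetitions.\<close>
    then have "p0 \<notin> fst ` set \<sigma>"
      unfolding typed_NuC_pair(2) by (auto, (metis tag.exhaust)+)
    then have "Con p0 \<notin> supp \<Delta> \<sigma>"
      using supp_erase_notin[of "Con p0" \<sigma> \<Delta>0] typed_NuC_pair(1) by auto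
    then have "{Con p0, Con p'} \<inter> supp \<Delta> \<sigma> = {}" using fresh by auto
    then have fr: "\<forall>n \<in> supp \<Delta> \<sigma>. hren id ?c n = n"
      using swap_fresh_C by auto
    then have "\<forall>n \<in> supp \<Delta> \<sigma>1. hren id ?c n = n" "\<forall>n \<in> supp \<Delta> \<sigma>2. hren id ?c n = n"
      unfolding typed_NuC_pair(2) supp_append by blast+
    then have eqs: "vren id ?c \<Delta> = \<Delta>" "sren ?c \<sigma>1 = \<sigma>1" "sren ?c \<sigma>2 = \<sigma>2"
      using vren_fresh by blast+
    then have "erase (vren id ?c \<Delta>0) (Nm (Con p')) = \<Delta>"
      unfolding typed_NuC_pair(1) ren_unfolds transpose_apply_first by simp
    moreover have "{Con p0, Con p'} \<inter> (fn P - {Con p}) = {}"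
      using typed_NuC_pair(4) fresh by auto
    note typed_swap_binder_C[OF typed_NuC_pair(5) this, unfolded ren_unfolds eqs transpose_apply_first]
    ultimately show ?thesis
      using typed_wf[OF L] typed_NuC_pair(2) by blast
  qed
next
  assume ?R
  moreover have "p' \<notin> fst ` set \<sigma>" using fresh by (auto simp: supp_def)
  ultimately show ?L using fresh by (auto intro: typed_NuC_absent typed_NuC_pair)
qed

subsection \<open>Stacks\<close>

lemma is_stack_Nil [simp]: "is_stack []"
  by (simp add: is_stack_def)

text \<open>Turns the condition on indices into a test on the head, which is how stacks are handled
  from here on. Below a pushed p^O, the entry p^I may only come next; below a pushed p^I there is no
  p^O at all, since its p^I would have to come after it and not at index 0.\<close>

lemma is_stack_Cons:
  "is_stack ((p, t) # \<sigma>) \<longleftrightarrow> is_stack \<sigma> \<and> (\<sigma> \<noteq> [] \<longrightarrow> snd (hd \<sigma>) \<noteq> t) \<and> (p, t) \<notin> set \<sigma> \<and>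
    (t = TO \<longrightarrow> (p, TI) \<in> set \<sigma> \<longrightarrow> hd \<sigma> = (p, TI)) \<and> (t = TI \<longrightarrow> (p, TO) \<notin> set \<sigma>)"
  (is "?L \<longleftrightarrow> ?R")
proof
  assume L: ?L
  then have alt: "\<And>i. Suc i < length ((p, t) # \<sigma>) \<Longrightarrow>
      snd (((p, t) # \<sigma>) ! i) \<noteq> snd (((p, t) # \<sigma>) ! Suc i)"
    and dist: "distinct ((p, t) # \<sigma>)"
    and pair: "\<And>i j q. i < length ((p, t) # \<sigma>) \<Longrightarrow> j < length ((p, t) # \<sigma>) \<Longrightarrow>
      ((p, t) # \<sigma>) ! i = (q, TO) \<Longrightarrow> ((p, t) # \<sigma>) ! j = (q, TI) \<Longrightarrow> j = Suc i"
    unfolding is_stack_def by blast+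
  have "is_stack \<sigma>"
    unfolding is_stack_def using alt[of "Suc _"] dist pair[of "Suc _" "Suc _"] by auto
  moreover have "\<sigma> \<noteq> [] \<longrightarrow> snd (hd \<sigma>) \<noteq> t"
    using alt[of 0] by (cases \<sigma>) auto
  moreover have "hd \<sigma> = (p, TI)" if t: "t = TO" and pI: "(p, TI) \<in> set \<sigma>"
  proof -
    obtain j where j: "j < length \<sigma>" "\<sigma> ! j = (p, TI)" using pI by (meson in_set_conv_nth)
    have "Suc j = Suc 0" by (rule pair[of 0 "Suc j" p]) (simp_all add: j t)
    moreover have "\<sigma> \<noteq> []" using j by auto
    ultimately show ?thesis using j by (simp add: hd_conv_nth)
  qed
  moreover have "(p, TO) \<notin> set \<sigma>" if "t = TI"
  proof
    assume "(p, TO) \<in> set \<sigma>"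
    then obtain i where i: "i < length \<sigma>" "\<sigma> ! i = (p, TO)" by (meson in_set_conv_nth)
    have "0 = Suc (Suc i)" by (rule pair[of "Suc i" 0 p]) (simp_all add: i that)
    then show False by simp
  qed
  ultimately show ?R using dist by auto
next
  assume R: ?R
  then have alt: "\<And>i. Suc i < length \<sigma> \<Longrightarrow> snd (\<sigma> ! i) \<noteq> snd (\<sigma> ! Suc i)"
    and dist: "distinct \<sigma>"
    and pair: "\<And>i j q. i < length \<sigma> \<Longrightarrow> j < length \<sigma> \<Longrightarrow> \<sigma> ! i = (q, TO) \<Longrightarrow> \<sigma> ! j = (q, TI) \<Longrightarrow> j = Suc i"
    unfolding is_stack_def by blast+
  show ?L
    unfolding is_stack_def
  proof (intro conjI allI impI)
    fix i assume i: "Suc i < length ((p, t) # \<sigma>)"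
    show "snd (((p, t) # \<sigma>) ! i) \<noteq> snd (((p, t) # \<sigma>) ! Suc i)"
    proof (cases i)
      case 0
      with i have "\<sigma> \<noteq> []" by auto
      with R have "snd (\<sigma> ! 0) \<noteq> t" by (metis hd_conv_nth)
      then show ?thesis unfolding 0 by auto
    next
      case (Suc i')
      with i alt[of i'] show ?thesis by simp
    qed
  next
    show "distinct ((p, t) # \<sigma>)" using R dist by simp
  next
    fix i j q
    assume ij: "i < length ((p, t) # \<sigma>)" "j < length ((p, t) # \<sigma>)"
      "((p, t) # \<sigma>) ! i = (q, TO)" "((p, t) # \<sigma>) ! j = (q, TI)"
    show "j = Suc i"
    proof (cases i)
      case 0
      with ij have pt: "p = q" "t = TO" by auto
      with ij obtain j' where j': "j = Suc j'" "j' < length \<sigma>" "\<sigma> ! j' = (q, TI)"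
        by (cases j) auto
      then have "(p, TI) \<in> set \<sigma>" "\<sigma> \<noteq> []" using pt nth_mem[OF j'(2)] by auto
      with R pt have "\<sigma> ! 0 = (q, TI)" by (metis hd_conv_nth)
      then have "j' = 0"
        using dist j' \<open>\<sigma> \<noteq> []\<close> by (metis length_greater_0_conv nth_eq_iff_index_eq)
      with 0 j' show ?thesis by simp
    next
      case (Suc i')
      then have i': "i' < length \<sigma>" "\<sigma> ! i' = (q, TO)" using ij by auto
      show ?thesis
      proof (cases j)
        case 0
        with ij have "p = q" "t = TI" by auto
        with R i' nth_mem[OF i'(1)] show ?thesis by simp
      next
        case (Suc j')
        with \<open>i = Suc i'\<close> pair[of i' j' q] i' ij show ?thesis by simp
      qed
    qed
  qed
qed

section \<open>The bottom of a stack and the count of its tags\<close>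

definition bottom_out :: "stack \<Rightarrow> bool" where
  "bottom_out \<sigma> \<longleftrightarrow> \<sigma> = [] \<or> snd (last \<sigma>) = TO"

lemma bottom_out_Nil [simp]: "bottom_out []"
  by (simp add: bottom_out_def)

lemma bottom_out_Cons: "bottom_out (x # \<sigma>) \<longleftrightarrow> (if \<sigma> = [] then snd x = TO else bottom_out \<sigma>)"
  by (auto simp: bottom_out_def)

lemma last_shuffles:
  "zs \<in> shuffles xs ys \<Longrightarrow> zs \<noteq> [] \<Longrightarrow> (xs \<noteq> [] \<and> last zs = last xs) \<or> (ys \<noteq> [] \<and> last zs = last ys)"
proof (induction xs ys arbitrary: zs rule: shuffles.induct)
  case (3 x xs y ys)
  from 3(3) consider zs' where "zs = x # zs'" "zs' \<in> shuffles xs (y # ys)"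
    | zs' where "zs = y # zs'" "zs' \<in> shuffles (x # xs) ys"
    by auto
  then show ?case
  proof cases
    case 1
    then have "zs' \<noteq> []" by (auto simp: Nil_in_shuffles)
    with 3(1)[OF 1(2) this] 1 show ?thesis by (auto split: if_splits)
  next
    case 2
    then have "zs' \<noteq> []" by (auto simp: Nil_in_shuffles)
    with 3(2)[OF 2(2) this] 2 show ?thesis by (auto split: if_splits)
  qed
qed auto

text \<open>No rule exposes an input tag at the bottom: where a call drops its p^I, or a restriction
  its pair p^O, p^I, the premise stack ends with an output tag, so the last entry is not among those
  dropped. A merge ends with the last entry of one of its parts.\<close>

lemma typed_bottom_out: "typed \<Delta> \<sigma> P \<Longrightarrow> bottom_out \<sigma>"
proof (induction rule: typed.induct)
  case (typed_Par \<Delta> \<sigma> \<Delta>1 \<sigma>1 P1 \<Delta>2 \<sigma>2 P2)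
  then show ?case using last_shuffles[of \<sigma> \<sigma>1 \<sigma>2] unfolding bottom_out_def inter_def by fastforce
qed (auto simp: bottom_out_def split: if_splits)

lemma hd_shuffles: "zs \<in> shuffles xs ys \<Longrightarrow> zs = z # zs' \<Longrightarrow>
  (\<exists>xs'. xs = z # xs' \<and> zs' \<in> shuffles xs' ys) \<or> (\<exists>ys'. ys = z # ys' \<and> zs' \<in> shuffles xs ys')"
  by (cases xs; cases ys) auto

text \<open>An output tag on top means that the process holds control. A server input is excluded
  because its own p^O would sit directly on another output tag, and if a restricted pair is on top
  of the premise stack, its p^O already forces \<open>Cur\<close>. Used to see that a process
  without \<open>Cur\<close> has room for the output tag of a received call.\<close>

lemma typed_top_out: "typed \<Delta> \<sigma> P \<Longrightarrow> \<sigma> = (p, TO) # \<sigma>' \<Longrightarrow> Cur \<in> dom \<Delta>"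
proof (induction arbitrary: p \<sigma>' rule: typed.induct)
  case (typed_InS \<Delta> a V \<sigma> b' p' x b p P)
  then show ?case using typed_stack[OF typed_InS.hyps(5)] by (simp add: is_stack_Cons)
next
  case (typed_NuC_pair \<Delta> p' \<sigma>1 \<sigma>2 p P)
  then show ?case by (cases \<sigma>1) auto
next
  case (typed_Par \<Delta> \<sigma> \<Delta>1 \<sigma>1 P1 \<Delta>2 \<sigma>2 P2)
  then have "Cur \<in> dom \<Delta>1 \<union> dom \<Delta>2"
    using hd_shuffles[of \<sigma> \<sigma>1 \<sigma>2] by (auto simp: inter_def)
  with typed_Par.hyps show ?case by (auto simp: vsplit_def vunion_def split: option.splits)
qed auto

text \<open>Counting output tags positively and input tags negatively, an alternating stack with an output
  tag at the bottom has excess 1 or 0 according to the tag at its top.\<close>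

definition excess :: "stack \<Rightarrow> int" where
  "excess \<sigma> = (\<Sum>x \<leftarrow> \<sigma>. if snd x = TO then 1 else -1)"

lemma excess_shuffles: "\<sigma> \<in> shuffles \<sigma>1 \<sigma>2 \<Longrightarrow> excess \<sigma> = excess \<sigma>1 + excess \<sigma>2"
  by (induction \<sigma>1 \<sigma>2 arbitrary: \<sigma> rule: shuffles.induct) (auto simp: excess_def)

lemma excess_stack:
  "is_stack \<sigma> \<Longrightarrow> bottom_out \<sigma> \<Longrightarrow> excess \<sigma> = (if \<sigma> \<noteq> [] \<and> snd (hd \<sigma>) = TO then 1 else 0)"
proof (induction \<sigma>)
  case (Cons x \<sigma>)
  obtain p t where "x = (p, t)" by fastforce
  with Cons show ?case
    by (cases \<sigma>; cases t) (auto simp: is_stack_Cons bottom_out_Cons excess_def split: if_splits;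
      metis tag.exhaust)+
qed (simp add: excess_def)

lemma shuffles_top_out:
  assumes "\<sigma> \<in> shuffles ((p, TO) # \<rho>) \<sigma>2" "is_stack \<sigma>" "is_stack ((p, TO) # \<rho>)" "is_stack \<sigma>2"
    "bottom_out \<sigma>" "bottom_out ((p, TO) # \<rho>)" "bottom_out \<sigma>2"
  obtains \<sigma>' where "\<sigma> = (p, TO) # \<sigma>'" "\<sigma>' \<in> shuffles \<rho> \<sigma>2"
proof -
  \<comment> \<open>Each excess is 0 or 1, so \<open>\<sigma>\<close> has 1 and
    \<open>\<sigma>2\<close> has 0: the output tag on top of \<open>\<sigma>\<close> cannot come
    from \<open>\<sigma>2\<close>.\<close>
  have "excess \<sigma> = 1 + excess \<sigma>2"
    using excess_shuffles[OF assms(1)] excess_stack[OF assms(3,6)] by simp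
  with excess_stack[OF assms(2,5)] excess_stack[OF assms(4,7)]
  have "\<sigma> \<noteq> []" "snd (hd \<sigma>) = TO" and \<sigma>2: "\<not> (\<sigma>2 \<noteq> [] \<and> snd (hd \<sigma>2) = TO)"
    by (auto split: if_splits)
  then obtain z \<sigma>' where z: "\<sigma> = z # \<sigma>'" "snd z = TO" by (cases \<sigma>) auto
  with hd_shuffles[OF assms(1) z(1)] \<sigma>2 have "z = (p, TO)" "\<sigma>' \<in> shuffles \<rho> \<sigma>2" by auto
  with z that show ?thesis by blast
qed

subsection \<open>Live names and substitution\<close>

text \<open>A rule with a continuation name as subject shows its tag in the stack, and
  \<open>Succ\<close>, whose continuation is untyped, has no live names. Under binders the fresh
  name differs from \<open>q\<close>, so the tag found in the premise survives in the
  conclusion.\<close>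

lemma live_con_in_stack: "typed \<Delta> \<sigma> P \<Longrightarrow> Con q \<in> live_fn P \<Longrightarrow> q \<in> fst ` set \<sigma>"
proof (induction rule: typed.induct)
  case (typed_OutS \<Delta> V \<sigma> a b' p' e b p P)
  then have "Con q \<in> live_fn P - {Con p}" "q \<noteq> p'" using live_fn_subset[of P] by auto
  then have "Con q \<in> live_fn (swapSC b b' p p' P)"
    by (auto simp: live_fn_ren intro!: image_eqI[of _ _ "Con q"])
  with typed_OutS \<open>q \<noteq> p'\<close> show ?case by auto
next
  case (typed_OutC \<Delta> V p \<sigma> b' e b P)
  show ?case
  proof (cases "q = p")
    case False
    with typed_OutC have "Con q \<in> live_fn (swapS b b' P)"
      by (auto simp: live_fn_ren intro!: image_eqI[of _ _ "Con q"])
    with typed_OutC show ?thesis by auto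
  qed simp
next
  case (typed_InS \<Delta> a V \<sigma> b' p' x b p P)
  then have "Con q \<in> live_fn P - {Con p}" "q \<noteq> p'" using live_fn_subset[of P] by auto
  then have "Con q \<in> live_fn (swapSC b b' p p' P)"
    by (auto simp: live_fn_ren intro!: image_eqI[of _ _ "Con q"])
  with typed_InS \<open>q \<noteq> p'\<close> show ?case by auto
next
  case (typed_RepS \<Delta> a V b' p' x b p P)
  then have "Con q \<in> live_fn P - {Con p}" "q \<noteq> p'" using live_fn_subset[of P] by auto
  then have "Con q \<in> live_fn (swapSC b b' p p' P)"
    by (auto simp: live_fn_ren intro!: image_eqI[of _ _ "Con q"])
  with typed_RepS \<open>q \<noteq> p'\<close> show ?case by auto
next
  case (typed_InC \<Delta> p V r b' x b P)
  show ?case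
  proof (cases "q = p")
    case False
    with typed_InC have "Con q \<in> live_fn (swapS b b' P)"
      by (auto simp: live_fn_ren intro!: image_eqI[of _ _ "Con q"])
    with typed_InC show ?thesis by auto
  qed simp
next
  case (typed_NuS \<Delta> a' \<sigma> a P)
  then have "Con q \<in> live_fn (swapS a a' P)"
    by (auto simp: live_fn_ren intro!: image_eqI[of _ _ "Con q"])
  with typed_NuS show ?case by auto
next
  case (typed_NuC_pair \<Delta> p' \<sigma>1 \<sigma>2 p P)
  then have "Con q \<in> live_fn P - {Con p}" "q \<noteq> p'" using live_fn_subset[of P] by auto
  then have "Con q \<in> live_fn (swapC p p' P)"
    by (auto simp: live_fn_ren intro!: image_eqI[of _ _ "Con q"])
  with typed_NuC_pair \<open>q \<noteq> p'\<close> show ?case by auto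
next
  case (typed_NuC_absent \<Delta> p' \<sigma> p P)
  then have "Con q \<in> live_fn P - {Con p}" "q \<noteq> p'" using live_fn_subset[of P] by auto
  then have "Con q \<in> live_fn (swapC p p' P)"
    by (auto simp: live_fn_ren intro!: image_eqI[of _ _ "Con q"])
  with typed_NuC_absent show ?case by auto
next
  case (typed_Par \<Delta> \<sigma> \<Delta>1 \<sigma>1 P1 \<Delta>2 \<sigma>2 P2)
  then have "set \<sigma> = set \<sigma>1 \<union> set \<sigma>2" by (auto simp: inter_def set_shuffles)
  with typed_Par show ?case by auto
qed auto

lemma live_fn_swapS_subset:
  assumes "Srv b' \<notin> fn P - {Srv b}"
  shows "live_fn (swapS b b' P) \<subseteq> (live_fn P - {Srv b}) \<union> {Srv b'}"
proof -
  have "hren (transpose b b') id n \<in> (live_fn P - {Srv b}) \<union> {Srv b'}" if "n \<in> live_fn P" for n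
    using that assms live_fn_subset[of P] by (cases n) (auto simp: transpose_def)
  then show ?thesis by (auto simp: live_fn_ren)
qed

lemma live_fn_swapC_subset:
  assumes "Con p' \<notin> fn P - {Con p}"
  shows "live_fn (swapC p p' P) \<subseteq> (live_fn P - {Con p}) \<union> {Con p'}"
proof -
  have "hren id (transpose p p') n \<in> (live_fn P - {Con p}) \<union> {Con p'}" if "n \<in> live_fn P" for n
    using that assms live_fn_subset[of P] by (cases n) (auto simp: transpose_def)
  then show ?thesis by (auto simp: live_fn_ren)
qed

lemma wf_env_erase: "wf_env \<Delta> \<sigma> \<Longrightarrow> wf_env (erase \<Delta> k) \<sigma>"
  by (simp add: wf_env_def visfun_erase)

lemma typed_psub: "typed \<Delta> \<sigma> P \<Longrightarrow> typed \<Delta> \<sigma> (psub esub x v P)"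
proof (induction rule: typed.induct)
  case (typed_OutS \<Delta> V \<sigma> a b' p' e b p P)
  then show ?case unfolding psub.simps
    by (intro typed.typed_OutS[OF typed_OutS.hyps(1-3) _ typed_OutS.IH[unfolded psub_ren]]) simp
next
  case (typed_OutC \<Delta> V p \<sigma> b' e b P)
  then show ?case unfolding psub.simps
    by (intro typed.typed_OutC[OF typed_OutC.hyps(1-3) _ typed_OutC.IH[unfolded psub_ren]]) simp
next
  case (typed_InS \<Delta> a V \<sigma> b' p' y b p P)
  show ?case
  proof (cases "x = y")
    case True
    then show ?thesis using typed.typed_InS[OF typed_InS.hyps]
      by (simp only: psub.simps in_var.simps refl if_True)
  next
    case False
    have "{Srv b', Con p'} \<inter> (supp (\<Delta>(Nm (Srv a) \<mapsto> V)) \<sigma> \<union> fn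
      (In (InS a y b p) (psub esub x v P))) = {}"
      using typed_InS.hyps(4) by simp
    from typed.typed_InS[OF typed_InS.hyps(1-3) this typed_InS.IH[unfolded psub_ren]] False show ?thesis
      by (simp only: psub.simps in_var.simps if_False)
  qed
next
  case (typed_RepS \<Delta> a V b' p' y b p P)
  show ?case
  proof (cases "x = y")
    case True
    then show ?thesis using typed.typed_RepS[OF typed_RepS.hyps]
      by (simp only: psub.simps in_var.simps refl if_True)
  next
    case False
    have "{Srv b', Con p'} \<inter> (supp (\<Delta>(Nm (Srv a) \<mapsto> V)) [] \<union> fn
      (Rep (InS a y b p) (psub esub x v P))) = {}"
      using typed_RepS.hyps(4) by simp
    from typed.typed_RepS[OF typed_RepS.hyps(1-3) this typed_RepS.IH[unfolded psub_ren]] False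
      show ?thesis
      by (simp only: psub.simps in_var.simps if_False)
  qed
next
  case (typed_InC \<Delta> p V q b' y b P)
  show ?case
  proof (cases "x = y")
    case True
    then show ?thesis using typed.typed_InC[OF typed_InC.hyps]
      by (simp only: psub.simps in_var.simps refl if_True)
  next
    case False
    have "Srv b' \<notin> supp (\<Delta>(Nm (Con p) \<mapsto> V)) [(p, TI), (q, TO)] \<union> fn (In (InC p y b) (psub esub x v P))"
      using typed_InC.hyps(4) by simp
    from typed.typed_InC[OF typed_InC.hyps(1-3) this typed_InC.IH[unfolded psub_ren]] False show ?thesis
      by (simp only: psub.simps in_var.simps if_False)
  qed
next
  case (typed_Par \<Delta> \<sigma> \<Delta>1 \<sigma>1 P1 \<Delta>2 \<sigma>2 P2)
  then show ?case unfolding psub.simps by (intro typed.typed_Par)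
qed (auto intro!: typed.intros simp: psub_ren)

subsection \<open>Weakening and strengthening\<close>

lemma visfun_submap: "visfun \<Delta> \<Longrightarrow> \<Delta>' \<subseteq>\<^sub>m \<Delta> \<Longrightarrow> visfun \<Delta>'"
proof (rule visfunI)
  assume vis: "visfun \<Delta>" and le: "\<Delta>' \<subseteq>\<^sub>m \<Delta>"
  have sub: "\<Delta> k = Some V" if "\<Delta>' k = Some V" for k V
    using le that by (metis domI map_le_def)
  show "finite (dom \<Delta>')"
    using vis map_le_implies_dom_le[OF le] by (auto simp: visfun_def intro: finite_subset)
  show "finite V" if "\<Delta>' k = Some V" for k V
    using sub[OF that] visfun_finite[OF vis] by blast
  show "W \<subseteq> V" if "\<Delta>' k = Some V" "n \<in> V" "\<Delta>' (Nm n) = Some W" for k n V W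
    using visfunD[OF vis sub[OF that(1)] that(2) sub[OF that(3)]] .
qed

text \<open>\<open>V\<close> is closed because it is the value at \<open>Cur\<close>; the new names
  are fresh, so no old entry sees them and is forced to grow.\<close>

lemma visfun_server_output:
  assumes vis: "visfun \<Delta>" and V: "\<Delta> Cur = Some V" and fr: "Srv b \<notin> supp \<Delta> \<sigma>" "Con p \<notin> supp \<Delta> \<sigma>"
  shows "visfun (reply_env \<Delta> V b)"
    "visfun (call_env \<Delta> V b p)"
proof -
  have V': "W \<subseteq> V" if "n \<in> V" "erase \<Delta> Cur (Nm n) = Some W" for n W
    using visfunD[OF vis V that(1)] that(2) by (simp add: erase_Cur)
  have b: "Srv b \<notin> U" "Con p \<notin> U" if "\<Delta> l = Some U" for l U
    using fr that suppI(2) by blast+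
  have fin: "finite (V \<union> {Srv b})" using visfun_finite[OF vis V] by simp
  show 1: "visfun (reply_env \<Delta> V b)"
    using V' b by (intro visfun_upd visfun_erase vis fin) (fastforce simp: erase_Cur split: if_splits)+
  show "visfun (call_env \<Delta> V b p)"
  proof (rule visfun_upd[OF 1 fin])
    show "W \<subseteq> V \<union> {Srv b}" if "n \<in> V \<union> {Srv b}" "Nm n \<noteq> Nm (Con p)"
      "(reply_env \<Delta> V b) (Nm n) = Some W" for n W
      using that V'[of n W] by (auto split: if_splits)
    show "V \<union> {Srv b} \<subseteq> U" if "Nm (Con p) = Nm m" "l \<noteq> Nm (Con p)"
      "(reply_env \<Delta> V b) l = Some U" "m \<in> U" for l U m
      using that b(2)[of l] b(2)[OF V] by (auto simp: erase_Cur split: if_splits)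
  qed
qed

lemma visfun_server_input:
  assumes vis: "visfun \<Delta>" and V: "\<Delta> (Nm (Srv a)) = Some V" and fr: "Srv b \<notin> supp \<Delta> \<sigma>" "Con p \<notin> supp \<Delta> \<sigma>"
  shows "visfun (serve_env \<Delta> V b p)"
proof (rule visfun_upd[OF vis])
  show "finite (V \<union> {Srv b, Con p})" using visfun_finite[OF vis V] by simp
  show "W \<subseteq> V \<union> {Srv b, Con p}" if "n \<in> V \<union> {Srv b, Con p}" "\<Delta> (Nm n) = Some W" for n W
    using that visfunD[OF vis V] fr suppI(1)[of \<Delta> n W \<sigma>] by blast
qed auto

text \<open>Two variants are kept: the typing rule for an input at \<open>p\<close> drops only the
  key \<open>p\<close>, while the environment in the theorem also has \<open>p\<close> erased from
  the values at the other old keys.\<close>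

lemma visfun_con_input:
  assumes vis: "visfun \<Delta>" and V: "\<Delta> (Nm (Con p)) = Some V" and fr: "Srv b \<notin> supp \<Delta> \<sigma>"
  shows "visfun ((erase \<Delta> (Nm (Con p)))(Cur \<mapsto> V \<union> {Srv b}))"
    "visfun (\<Delta>(Nm (Con p) := None, Cur \<mapsto> V \<union> {Srv b}))"
proof -
  have fin: "finite (V \<union> {Srv b})" using visfun_finite[OF vis V] by simp
  have V': "W \<subseteq> V \<union> {Srv b}" if "n \<in> V \<union> {Srv b}" "\<Delta> (Nm n) = Some W" for n W
    using that visfunD[OF vis V] fr suppI(1)[of \<Delta> n W \<sigma>] by blast
  show "visfun ((erase \<Delta> (Nm (Con p)))(Cur \<mapsto> V \<union> {Srv b}))"
  proof (rule visfun_upd[OF visfun_erase[OF vis] fin])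
    show "W \<subseteq> V \<union> {Srv b}" if n: "n \<in> V \<union> {Srv b}" "erase \<Delta> (Nm (Con p)) (Nm n) = Some W" for n W
    proof -
      obtain W' where "\<Delta> (Nm n) = Some W'" "W \<subseteq> W'"
        using n(2) by (auto simp: erase_apply split: if_splits)
      with V'[OF n(1)] show ?thesis by blast
    qed
  qed auto
  have "visfun (\<Delta>(Nm (Con p) := None))"
    by (rule visfun_submap[OF vis]) (auto simp: map_le_def)
  then show "visfun (\<Delta>(Nm (Con p) := None, Cur \<mapsto> V \<union> {Srv b}))"
    using V' by (intro visfun_upd fin) (auto split: if_splits)
qed

text \<open>\<open>vle N \<Delta> \<Delta>'\<close>: visibilities may grow, and the names in \<open>N\<close> may be forgotten.\<close>

definition vle :: "hname set \<Rightarrow> vis \<Rightarrow> vis \<Rightarrow> bool" where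
  "vle N \<Delta> \<Delta>' \<longleftrightarrow> dom \<Delta>' \<subseteq> dom \<Delta> \<and> dom \<Delta> - Nm ` N \<subseteq> dom \<Delta>' \<and>
     (\<forall>k V V'. \<Delta> k = Some V \<longrightarrow> \<Delta>' k = Some V' \<longrightarrow> V - N \<subseteq> V')"

lemma vleD: "vle N \<Delta> \<Delta>' \<Longrightarrow> \<Delta> k = Some V \<Longrightarrow> k \<notin> Nm ` N \<Longrightarrow> \<exists>V'. \<Delta>' k = Some V' \<and> V - N \<subseteq> V'"
  unfolding vle_def by (metis DiffI domD domI subsetD)

lemma vle_None: "vle N \<Delta> \<Delta>' \<Longrightarrow> \<Delta> k = None \<Longrightarrow> \<Delta>' k = None"
  unfolding vle_def by (metis domIff subsetD)

lemma vle_upd: "vle N \<Delta> \<Delta>' \<Longrightarrow> V - N \<subseteq> V' \<Longrightarrow> vle N (\<Delta>(k \<mapsto> V)) (\<Delta>'(k \<mapsto> V'))"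
  unfolding vle_def by auto

lemma vle_upd_None: "vle N \<Delta> \<Delta>' \<Longrightarrow> vle N (\<Delta>(k := None)) (\<Delta>'(k := None))"
  unfolding vle_def by auto

lemma vle_refl [simp]: "vle N \<Delta> \<Delta>"
  unfolding vle_def by auto

lemma vle_erase: "vle {n} \<Delta> (erase \<Delta> (Nm n))"
  unfolding vle_def by (auto simp: erase_apply split: if_splits)

text \<open>To undo the erasure of \<open>n\<close> in a larger environment, close the old value \<open>W\<close> of \<open>n\<close> under the new
  environment and let \<open>n\<close> be visible from every key that sees this closure.\<close>

lemma vle_unerase:
  assumes vis0: "visfun \<Delta>0" and vis: "visfun \<Delta>'" and le: "vle N (erase \<Delta>0 (Nm n)) \<Delta>'"
    and fr: "n \<notin> supp \<Delta>' \<sigma>" "n \<notin> N"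
  shows "\<exists>\<Delta>0'. vle N \<Delta>0 \<Delta>0' \<and> visfun \<Delta>0' \<and> erase \<Delta>0' (Nm n) = \<Delta>'"
proof -
  \<comment> \<open>The default is harmless: if \<open>n\<close> has no entry, then \<open>U\<close>
    is empty and \<open>n\<close> simply becomes visible from every key.\<close>
  define W where "W = (case \<Delta>0 (Nm n) of None \<Rightarrow> {} | Some W \<Rightarrow> W - N)"
  define U where "U = (W - {n}) \<union> \<Union> {V. \<exists>m \<in> W. \<Delta>' (Nm m) = Some V}"
  define D where "D = (\<lambda>k. if k = Nm n then (if Nm n \<in> dom \<Delta>0 then Some (insert n U) else None)
    else map_option (\<lambda>V. if U \<subseteq> V then insert n V else V) (\<Delta>' k))"
  have nV: "n \<notin> V" if "\<Delta>' k = Some V" for k V using fr(1) that suppI(2) by blast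
  have dom': "dom \<Delta>' \<subseteq> dom \<Delta>0 - {Nm n}" "dom \<Delta>0 - {Nm n} - Nm ` N \<subseteq> dom \<Delta>'"
    using le unfolding vle_def dom_erase by blast+
  have "\<Delta>' (Nm n) = None" using dom' by auto
  then have domD: "dom D = dom \<Delta>' \<union> (dom \<Delta>0 \<inter> {Nm n})"
    unfolding D_def by (auto split: if_splits)
  then have domD0: "dom D \<subseteq> dom \<Delta>0" using dom' by blast
  have finU: "finite U"
  proof -
    have "finite W" using visfun_finite[OF vis0] by (auto simp: W_def split: option.split)
    moreover have "{V. \<exists>m \<in> W. \<Delta>' (Nm m) = Some V} = (\<lambda>m. the (\<Delta>' (Nm m))) ` {m \<in> W. Nm m \<in> dom \<Delta>'}"
      by force
    ultimately show ?thesis unfolding U_def using visfun_finite[OF vis] by auto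
  qed
  have closed: "V \<subseteq> U" if "m \<in> U" "\<Delta>' (Nm m) = Some V" for m V
  proof -
    from that(1) consider "m \<in> W" | V' m' where "m' \<in> W" "\<Delta>' (Nm m') = Some V'" "m \<in> V'"
      unfolding U_def by blast
    then show ?thesis
    proof cases
      case 1 then show ?thesis using that(2) unfolding U_def by blast
    next
      case 2
      from visfunD[OF vis 2(2,3) that(2)] 2 show ?thesis unfolding U_def by blast
    qed
  qed
  have nU: "n \<notin> U" using nV by (auto simp: U_def)
  have "erase D (Nm n) = \<Delta>'"
  proof
    fix k
    have "\<Delta>' (Nm n) = None" using dom' by auto
    then show "erase D (Nm n) k = \<Delta>' k"
      using nV[of k] by (cases "\<Delta>' k") (auto simp: erase_apply D_def)
  qed
  moreover have "visfun D"
  proof (rule visfunI)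
    show "finite (dom D)" using vis0 domD0 unfolding visfun_def by (metis finite_subset)
    show "finite V" if "D k = Some V" for k V
      using that finU visfun_finite[OF vis] by (auto simp: D_def split: if_splits)
    show "Y \<subseteq> V" if k: "D k = Some V" and m: "m \<in> V" "D (Nm m) = Some Y" for k m V Y
    proof (cases "k = Nm n")
      case True
      then have V: "V = insert n U" using k by (auto simp: D_def split: if_splits)
      show ?thesis
      proof (cases "m = n")
        case True then show ?thesis using m V by (auto simp: D_def split: if_splits)
      next
        case False
        then obtain Y' where Y': "\<Delta>' (Nm m) = Some Y'" "Y \<subseteq> insert n Y'"
          using m by (auto simp: D_def split: if_splits)
        with closed[of m Y'] False m(1) V show ?thesis by blast
      qed
    next
      case False
      then obtain V' where V': "\<Delta>' k = Some V'" "V = (if U \<subseteq> V' then insert n V' else V')"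
        using k by (auto simp: D_def)
      show ?thesis
      proof (cases "m = n")
        case True
        then have "U \<subseteq> V'" using m(1) V' nV[OF V'(1)] by (auto split: if_splits)
        moreover have "Y = insert n U" using m(2) True by (auto simp: D_def split: if_splits)
        ultimately show ?thesis using V' by auto
      next
        case False
        then obtain Y' where Y': "\<Delta>' (Nm m) = Some Y'" "Y = (if U \<subseteq> Y' then insert n Y' else Y')"
          using m by (auto simp: D_def)
        have "m \<in> V'" using m(1) V' False by (auto split: if_splits)
        from visfunD[OF vis V'(1) this Y'(1)] show ?thesis using V' Y' by auto
      qed
    qed
  qed
  moreover have "vle N \<Delta>0 D"
    unfolding vle_def
  proof (intro conjI allI impI)
    show "dom D \<subseteq> dom \<Delta>0" by (rule domD0)
    show "dom \<Delta>0 - Nm ` N \<subseteq> dom D" unfolding domD using dom' by blast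
    fix k V V'
    assume k: "\<Delta>0 k = Some V" "D k = Some V'"
    show "V - N \<subseteq> V'"
    proof (cases "k = Nm n")
      case True
      then show ?thesis using k by (auto simp: D_def U_def W_def split: if_splits)
    next
      case False
      then have "erase \<Delta>0 (Nm n) k = Some (V - {n})" using k by (auto simp: erase_apply)
      moreover obtain Y where Y1: "\<Delta>' k = Some Y" using k(2) False by (auto simp: D_def)
      ultimately have Y: "\<Delta>' k = Some Y" "V - {n} - N \<subseteq> Y" using le unfolding vle_def by blast+
      \<comment> \<open>This is why \<open>D\<close> is large enough: a key that saw
        \<open>n\<close> before saw all of \<open>W\<close> by transitivity. Its value
        \<open>Y\<close> still contains \<open>W\<close> up to \<open>n\<close> and is closed under
        \<Delta>', hence contains \<open>U\<close>, so \<open>n\<close> is put back wherever it is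
        required.\<close>
      have "U \<subseteq> Y" if "n \<in> V"
      proof (cases "Nm n \<in> dom \<Delta>0")
        case True
        then have "W \<subseteq> V - N" using visfunD[OF vis0 k(1) that] by (auto simp: W_def)
        moreover have "X \<subseteq> Y" if "m \<in> W" "\<Delta>' (Nm m) = Some X" for m X
        proof (cases "m = n")
          case True
          then show ?thesis using that \<open>\<Delta>' (Nm n) = None\<close> by simp
        next
          case False
          then have "m \<in> Y" using that \<open>W \<subseteq> V - N\<close> Y by auto
          from visfunD[OF vis Y(1) this that(2)] show ?thesis .
        qed
        ultimately show ?thesis using Y unfolding U_def by blast
      next
        case False
        then show ?thesis by (auto simp: U_def W_def split: option.splits)
      qed
      with Y k False show ?thesis by (auto simp: D_def split: if_splits)
    qed
  qed
  ultimately show ?thesis by blast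
qed

section \<open>Splitting an environment into restrictions\<close>

lemma vsplitI:
  assumes "visfun \<Delta>" "\<Delta>1 \<subseteq>\<^sub>m \<Delta>" "\<Delta>2 \<subseteq>\<^sub>m \<Delta>" "dom \<Delta> = dom \<Delta>1 \<union> dom \<Delta>2"
    "dom \<Delta>1 \<inter> dom \<Delta>2 \<subseteq> server_keys"
  shows "(\<Delta>1, \<Delta>2) \<in> vsplit \<Delta>"
proof -
  have "vunion \<Delta>1 \<Delta>2 k = \<Delta> k" for k
  proof -
    have 1: "\<Delta> k = Some V" if "\<Delta>1 k = Some V" for V using assms(2) that by (metis domI map_le_def)
    have 2: "\<Delta> k = Some V" if "\<Delta>2 k = Some V" for V using assms(3) that by (metis domI map_le_def)
    have 3: "\<Delta> k = None" if "\<Delta>1 k = None" "\<Delta>2 k = None" using assms(4) that by (metis UnE domIff)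
    show ?thesis
      unfolding vunion_def using 1 2 3 by (cases "\<Delta>1 k"; cases "\<Delta>2 k") auto
  qed
  then have "vunion \<Delta>1 \<Delta>2 = \<Delta>" ..
  moreover have "dom (vinter \<Delta>1 \<Delta>2) = dom \<Delta>1 \<inter> dom \<Delta>2"
    by (auto simp: vinter_def split: option.splits)
  ultimately show ?thesis
    using assms visfun_submap by (auto simp: vsplit_def duplicable_def)
qed

lemma vsplit_dom:
  assumes "(\<Delta>1, \<Delta>2) \<in> vsplit \<Delta>"
  shows "dom \<Delta> = dom \<Delta>1 \<union> dom \<Delta>2" "dom \<Delta>1 \<inter> dom \<Delta>2 \<subseteq> server_keys"
proof -
  have "dom (vinter \<Delta>1 \<Delta>2) = dom \<Delta>1 \<inter> dom \<Delta>2"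
    by (auto simp: vinter_def split: option.splits)
  then show "dom \<Delta>1 \<inter> dom \<Delta>2 \<subseteq> server_keys"
    using assms by (auto simp: vsplit_def duplicable_def)
  have "dom (vunion \<Delta>1 \<Delta>2) = dom \<Delta>1 \<union> dom \<Delta>2"
    by (auto simp: vunion_def split: option.splits)
  then show "dom \<Delta> = dom \<Delta>1 \<union> dom \<Delta>2" using assms by (auto simp: vsplit_def)
qed

text \<open>The values of a component lie inside those of \<Delta>, so the restriction of \<Delta>'
  to its keys is large enough for it, and no pointwise union of values has to be split.\<close>

lemma vsplit_vle_restrict:
  assumes sp: "(\<Delta>1, \<Delta>2) \<in> vsplit \<Delta>" and le: "vle N \<Delta> \<Delta>'" and D: "D = \<Delta>1 \<or> D = \<Delta>2"
  shows "vle N D (\<Delta>' |` dom D)"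
proof -
  have "vunion \<Delta>1 \<Delta>2 = \<Delta>" using sp by (simp add: vsplit_def)
  then have big: "\<exists>V'. \<Delta> k = Some V' \<and> V \<subseteq> V'" if "D k = Some V" for k V
    using that D by (auto simp: vunion_def split: option.splits)
  have dom: "dom D - Nm ` N \<subseteq> dom \<Delta>'"
    using D vsplit_dom(1)[OF sp] le unfolding vle_def by blast
  have val: "V - N \<subseteq> V'" if V: "D k = Some V" "\<Delta>' k = Some V'" for k V V'
  proof -
    obtain Y where "\<Delta> k = Some Y" "V \<subseteq> Y" using big[OF V(1)] by blast
    with le V(2) show ?thesis unfolding vle_def by blast
  qed
  show ?thesis
    unfolding vle_def dom_restrict
  proof (intro conjI allI impI)
    show "dom D - Nm ` N \<subseteq> dom \<Delta>' \<inter> dom D" using dom by blast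
  qed (use val in \<open>auto simp: restrict_map_def split: if_splits\<close>)
qed

lemma restrict_map_submap: "\<Delta> |` D \<subseteq>\<^sub>m \<Delta>"
  by (auto simp: map_le_def)

lemma vsplit_restrict:
  assumes "(\<Delta>1, \<Delta>2) \<in> vsplit \<Delta>" "vle N \<Delta> \<Delta>'" "visfun \<Delta>'"
  shows "(\<Delta>' |` dom \<Delta>1, \<Delta>' |` dom \<Delta>2) \<in> vsplit \<Delta>'"
  using vsplit_dom[OF assms(1)] assms(2)
  by (intro vsplitI assms(3) restrict_map_submap) (auto simp: vle_def)

text \<open>Induction on the size of the process, not on the derivation: binders must be opened at
  names fresh for both environments and for \<open>N\<close>, and renaming preserves size. The
  subject of a prefix is live, hence not in \<open>N\<close>, so the entry or visibility that its
  rule demands is not lost. Restrictions are the hard case, where \<open>vle_unerase\<close>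
  rebuilds the environment of the premise.\<close>

lemma typed_vle:
  fixes P :: "'e proc"
  assumes "finite N"
  shows "typed \<Delta> \<sigma> P \<Longrightarrow> vle N \<Delta> \<Delta>' \<Longrightarrow> N \<inter> live_fn P = {} \<Longrightarrow> visfun \<Delta>' \<Longrightarrow> typed \<Delta>' \<sigma> P"
proof (induction "size P" arbitrary: \<Delta> \<Delta>' \<sigma> P rule: less_induct)
  case less
  note ty = less.prems(1) and le = less.prems(2) and N = less.prems(3) and vis' = less.prems(4)
  have wf': "wf_env \<Delta>' \<sigma>" using vis' typed_stack[OF ty] by (simp add: wf_env_def)
  have fin: "finite (N \<union> supp \<Delta> \<sigma> \<union> supp \<Delta>' \<sigma> \<union> fn P)"
    using finite_supp typed_visfun[OF ty] vis' assms by auto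
  obtain b' where b': "Srv b' \<notin> N \<union> supp \<Delta> \<sigma> \<union> supp \<Delta>' \<sigma> \<union> fn P" using ex_fresh_srv[OF fin] by blast
  obtain p' where p': "Con p' \<notin> N \<union> supp \<Delta> \<sigma> \<union> supp \<Delta>' \<sigma> \<union> fn P" using ex_fresh_con[OF fin] by blast
  have dup: "duplicable \<Delta>'" if "duplicable \<Delta>" using that le unfolding duplicable_def vle_def by blast
  have Cur: "Cur \<in> dom \<Delta> \<longleftrightarrow> Cur \<in> dom \<Delta>'" using le unfolding vle_def by blast
  have N_SC: "N \<inter> live_fn (swapSC b b' p p' Q) = {}"
    if "{Srv b', Con p'} \<inter> (fn Q - {Srv b, Con p}) = {}" "N \<inter> (live_fn Q - {Srv b, Con p}) = {}"
    for b p and Q :: "'e proc"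
    using live_fn_swapSC_subset[OF that(1)] that(2) b' p' by blast
  have N_S: "N \<inter> live_fn (swapS b b' Q) = {}"
    if "Srv b' \<notin> fn Q - {Srv b}" "N \<inter> (live_fn Q - {Srv b}) = {}" for b and Q :: "'e proc"
    using live_fn_swapS_subset[OF that(1)] that(2) b' by blast
  have N_C: "N \<inter> live_fn (swapC p p' Q) = {}"
    if "Con p' \<notin> fn Q - {Con p}" "N \<inter> (live_fn Q - {Con p}) = {}" for p and Q :: "'e proc"
    using live_fn_swapC_subset[OF that(1)] that(2) p' by blast
  \<comment> \<open>Shared by single and replicated inputs. \<open>P\<close> may be either, so it
    enters only through its size and its free and live names.\<close>
  have InS_case: "typed \<Delta>' \<sigma> (In (InS a x b p) Q)"
    if "typed \<Delta> \<sigma> (In (InS a x b p) Q)" "size Q < size P" "fn (In (InS a x b p) Q) = fn P"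
      "live_fn (In (InS a x b p) Q) = live_fn P" for a x b p and Q :: "'e proc"
  proof -
    have f: "{Srv b', Con p'} \<inter> (supp \<Delta> \<sigma> \<union> fn (In (InS a x b p) Q)) = {}"
      and f': "{Srv b', Con p'} \<inter> (supp \<Delta>' \<sigma> \<union> fn (In (InS a x b p) Q)) = {}"
      using b' p' that(2,3) by auto
    from that(1)[unfolded typed_InS_iff[OF f]] obtain V
      where V: "\<Delta> (Nm (Srv a)) = Some V" "\<Delta> Cur = None"
      "typed (serve_env \<Delta> V b' p') ((p', TO) # \<sigma>) (swapSC b b' p p' Q)" by blast
    have "Nm (Srv a) \<notin> Nm ` N" using N that(4) by auto
    from vleD[OF le V(1) this] obtain V' where V': "\<Delta>' (Nm (Srv a)) = Some V'" "V - N \<subseteq> V'" by blast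
    have "typed (serve_env \<Delta>' V' b' p') ((p', TO) # \<sigma>) (swapSC b b' p p' Q)"
    proof (rule less.hyps[OF _ V(3)])
      show "size (swapSC b b' p p' Q) < size P" using that(2) by simp
      show "N \<inter> live_fn (swapSC b b' p p' Q) = {}" using N that(4) f by (intro N_SC) auto
      show "vle N (serve_env \<Delta> V b' p') (serve_env \<Delta>' V' b' p')"
        using V' le by (intro vle_upd) auto
      show "visfun (serve_env \<Delta>' V' b' p')"
        using b' p' by (intro visfun_server_input[OF vis' V'(1)]) blast+
    qed
    then show ?thesis unfolding typed_InS_iff[OF f'] using V(2) V'(1) wf' that(3) vle_None[OF le]
      by blast
  qed
  show ?case
  proof (cases P)
    case (OutS a e b p Q)
    have f: "{Srv b', Con p'} \<inter> (supp \<Delta> \<sigma> \<union> fn (OutS a e b p Q)) = {}"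
      and f': "{Srv b', Con p'} \<inter> (supp \<Delta>' \<sigma> \<union> fn (OutS a e b p Q)) = {}"
      using b' p' OutS by blast+
    from ty[unfolded OutS typed_OutS_iff[OF f]] obtain V where V: "\<Delta> Cur = Some V" "Srv a \<in> V"
      "typed (call_env \<Delta> V b' p') ((p', TI) # \<sigma>)
        (swapSC b b' p p' Q)" by blast
    from vleD[OF le V(1)] obtain V' where V': "\<Delta>' Cur = Some V'" "V - N \<subseteq> V'" by blast
    have "typed (call_env \<Delta>' V' b' p') ((p', TI) # \<sigma>)
        (swapSC b b' p p' Q)"
    proof (rule less.hyps[OF _ V(3)])
      show "size (swapSC b b' p p' Q) < size P" by (simp add: OutS)
      show "N \<inter> live_fn (swapSC b b' p p' Q) = {}" using N OutS f by (intro N_SC) auto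
      show "vle N (call_env \<Delta> V b' p')
          (call_env \<Delta>' V' b' p')"
        unfolding erase_Cur using V' le by (intro vle_upd vle_upd_None) auto
      show "visfun (call_env \<Delta>' V' b' p')"
        using b' p' by (intro visfun_server_output[OF vis' V'(1)]) blast+
    qed
    then show ?thesis unfolding OutS typed_OutS_iff[OF f'] using V(2) V' wf' N OutS by auto
  next
    case (OutC p e b Q)
    have f: "Srv b' \<notin> supp \<Delta> \<sigma> \<union> fn (OutC p e b Q)" and f': "Srv b' \<notin> supp \<Delta>' \<sigma> \<union> fn (OutC p e b Q)"
      using b' OutC by blast+
    from ty[unfolded OutC typed_OutC_iff[OF f]] obtain V \<sigma>' where V: "\<Delta> Cur = Some V" "Con p \<in> V"
      "typed (reply_env \<Delta> V b') \<sigma>' (swapS b b' Q)" "\<sigma> = (p, TO) # \<sigma>'" by blast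
    from vleD[OF le V(1)] obtain V' where V': "\<Delta>' Cur = Some V'" "V - N \<subseteq> V'" by blast
    have "typed (reply_env \<Delta>' V' b') \<sigma>' (swapS b b' Q)"
    proof (rule less.hyps[OF _ V(3)])
      show "size (swapS b b' Q) < size P" by (simp add: OutC)
      show "N \<inter> live_fn (swapS b b' Q) = {}" using N OutC f by (intro N_S) auto
      show "vle N (reply_env \<Delta> V b') (reply_env \<Delta>' V' b')"
        unfolding erase_Cur using V' le by (intro vle_upd vle_upd_None) auto
      show "visfun (reply_env \<Delta>' V' b')"
        using b' p' by (intro visfun_server_output(1)[OF vis' V'(1)]) blast+
    qed
    then show ?thesis unfolding OutC typed_OutC_iff[OF f'] using V(2,4) V' wf' N OutC by auto
  next
    case (OutF h e Q)
    from ty[unfolded OutF] show ?thesis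
    proof cases
      case typed_OutF
      then have "typed \<Delta>' [] Q" using less.hyps[of Q \<Delta> "[]" \<Delta>'] le N vis' OutF by simp
      then show ?thesis using wf' typed_OutF Cur unfolding OutF by (auto intro!: typed.typed_OutF)
    qed
  next
    case (In \<alpha> Q)
    show ?thesis
    proof (cases \<alpha>)
      case (InS a x b p)
      show ?thesis using InS_case[of a x b p Q] ty unfolding In InS by simp
    next
      case (InC p x b)
      note In = In[unfolded InC]
      have f: "Srv b' \<notin> supp \<Delta> \<sigma> \<union> fn (In (InC p x b) Q)"
        and f': "Srv b' \<notin> supp \<Delta>' \<sigma> \<union> fn (In (InC p x b) Q)"
        using b' In by blast+
      from ty[unfolded In typed_InC_iff[OF f]] obtain V q
        where V: "\<Delta> (Nm (Con p)) = Some V" "\<Delta> Cur = None"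
        "typed (\<Delta>(Nm (Con p) := None, Cur \<mapsto> V \<union> {Srv b'})) [(q, TO)] (swapS b b' Q)"
        "\<sigma> = [(p, TI), (q, TO)]" by blast
      have "Nm (Con p) \<notin> Nm ` N" using N In by auto
      from vleD[OF le V(1) this] obtain V' where V': "\<Delta>' (Nm (Con p)) = Some V'" "V - N \<subseteq> V'" by blast
      have "typed (\<Delta>'(Nm (Con p) := None, Cur \<mapsto> V' \<union> {Srv b'})) [(q, TO)] (swapS b b' Q)"
      proof (rule less.hyps[OF _ V(3)])
        show "size (swapS b b' Q) < size P" by (simp add: In)
        show "N \<inter> live_fn (swapS b b' Q) = {}" using N In f by (intro N_S) auto
        show "vle N (\<Delta>(Nm (Con p) := None, Cur \<mapsto> V \<union> {Srv b'}))
          (\<Delta>'(Nm (Con p) := None, Cur \<mapsto> V' \<union> {Srv b'}))"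
          using V' le by (intro vle_upd vle_upd_None) auto
        show "visfun (\<Delta>'(Nm (Con p) := None, Cur \<mapsto> V' \<union> {Srv b'}))"
          using b' by (intro visfun_con_input(2)[OF vis' V'(1)]) blast+
      qed
      then show ?thesis unfolding In typed_InC_iff[OF f'] using V(2,4) V'(1) wf' vle_None[OF le]
        by blast
    next
      case (InF h x)
      from ty[unfolded In InF] show ?thesis
      proof cases
        case typed_InF
        then have "typed \<Delta>' [] Q" using less.hyps[of Q \<Delta> "[]" \<Delta>'] le N vis' In InF by simp
        then show ?thesis using wf' typed_InF Cur unfolding In InF by (auto intro!: typed.typed_InF)
      qed
    qed
  next
    case (Rep \<alpha> Q)
    obtain a x b p where \<alpha>: "\<alpha> = InS a x b p" using ty[unfolded Rep] by cases auto
    show ?thesis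
      using InS_case[of a x b p Q] ty dup unfolding Rep \<alpha> typed_RepS_iff by auto
  next
    case (NuS a Q)
    have f: "Srv b' \<notin> supp \<Delta> \<sigma> \<union> fn (NuS a Q)" and f': "Srv b' \<notin> supp \<Delta>' \<sigma> \<union> fn (NuS a Q)"
      using b' NuS by blast+
    from ty[unfolded NuS typed_NuS_iff[OF f]] obtain \<Delta>0 where D: "erase \<Delta>0 (Nm (Srv b')) = \<Delta>"
      "typed \<Delta>0 \<sigma> (swapS a b' Q)" by blast
    have "Srv b' \<notin> supp \<Delta>' \<sigma>" "Srv b' \<notin> N" using b' by blast+
    from vle_unerase[OF typed_visfun[OF D(2)] vis' _ this] D(1) le obtain \<Delta>0' where
      D': "vle N \<Delta>0 \<Delta>0'" "visfun \<Delta>0'" "erase \<Delta>0' (Nm (Srv b')) = \<Delta>'" by blast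
    have "typed \<Delta>0' \<sigma> (swapS a b' Q)"
      using N NuS f by (intro less.hyps[OF _ D(2) D'(1) N_S D'(2)]) auto
    then show ?thesis unfolding NuS typed_NuS_iff[OF f'] using D'(3) wf' by blast
  next
    case (NuC p Q)
    have f: "Con p' \<notin> supp \<Delta> \<sigma> \<union> fn (NuC p Q)" and f': "Con p' \<notin> supp \<Delta>' \<sigma> \<union> fn (NuC p Q)"
      using p' NuC by blast+
    from ty[unfolded NuC typed_NuC_iff[OF f]] obtain \<Delta>0 \<sigma>0 where D: "erase \<Delta>0 (Nm (Con p')) = \<Delta>"
      "typed \<Delta>0 \<sigma>0 (swapC p p' Q)"
      "\<sigma>0 = \<sigma> \<or> (\<exists>\<sigma>1 \<sigma>2. \<sigma> = \<sigma>1 @ \<sigma>2 \<and> \<sigma>0 = \<sigma>1 @ (p', TO) # (p', TI) # \<sigma>2)" by blast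
    have "Con p' \<notin> supp \<Delta>' \<sigma>" "Con p' \<notin> N" using p' by blast+
    from vle_unerase[OF typed_visfun[OF D(2)] vis' _ this] D(1) le obtain \<Delta>0' where
      D': "vle N \<Delta>0 \<Delta>0'" "visfun \<Delta>0'" "erase \<Delta>0' (Nm (Con p')) = \<Delta>'" by blast
    have "typed \<Delta>0' \<sigma>0 (swapC p p' Q)"
      using N NuC f by (intro less.hyps[OF _ D(2) D'(1) N_C D'(2)]) auto
    then show ?thesis unfolding NuC typed_NuC_iff[OF f'] using D'(3) D(3) wf' by blast
  next
    case (NuF h Q)
    from ty[unfolded NuF] show ?thesis
    proof cases
      case typed_NuF
      then have "typed \<Delta>' \<sigma> Q" using less.hyps[of Q \<Delta> \<sigma> \<Delta>'] le N vis' NuF by simp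
      then show ?thesis using wf' unfolding NuF by (auto intro!: typed.typed_NuF)
    qed
  next
    case (Par Q R)
    from ty[unfolded Par] show ?thesis
    proof cases
      case (typed_Par \<Delta>1 \<sigma>1 \<Delta>2 \<sigma>2)
      note sp = vsplit_restrict[OF typed_Par(4) le vis']
      then have v: "visfun (\<Delta>' |` dom \<Delta>1)" "visfun (\<Delta>' |` dom \<Delta>2)" by (auto simp: vsplit_def)
      have "typed (\<Delta>' |` dom \<Delta>1) \<sigma>1 Q" "typed (\<Delta>' |` dom \<Delta>2) \<sigma>2 R"
        using less.hyps[OF _ typed_Par(2) vsplit_vle_restrict[OF typed_Par(4) le] _ v(1)]
          less.hyps[OF _ typed_Par(3) vsplit_vle_restrict[OF typed_Par(4) le] _ v(2)] N Par by auto
      then show ?thesis unfolding Par using typed.typed_Par[OF wf' _ _ sp typed_Par(5)] by blast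
    qed
  next
    case Stop
    from ty[unfolded Stop] show ?thesis unfolding Stop
      by cases (use dup wf' in \<open>auto intro!: typed.typed_Stop\<close>)
  next
    case (Succ w Q)
    from ty[unfolded Succ] show ?thesis unfolding Succ
      by cases (use wf' in \<open>auto intro!: typed.typed_Succ\<close>)
  next
    case (Sum Q R)
    from ty[unfolded Sum] show ?thesis
    proof cases
      case typed_Sum
      then have "typed \<Delta>' [] Q" "typed \<Delta>' [] R"
        using less.hyps[of Q \<Delta> "[]" \<Delta>'] less.hyps[of R \<Delta> "[]" \<Delta>'] le N vis' Sum by auto
      then show ?thesis using wf' typed_Sum unfolding Sum by (auto intro!: typed.typed_Sum)
    qed
  next
    case (Cond e f Q R)
    from ty[unfolded Cond] show ?thesis
    proof cases
      case typed_Cond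
      then have "typed \<Delta>' [] Q" "typed \<Delta>' [] R"
        using less.hyps[of Q \<Delta> "[]" \<Delta>'] less.hyps[of R \<Delta> "[]" \<Delta>'] le N vis' Cond by auto
      then show ?thesis using wf' typed_Cond unfolding Cond by (auto intro!: typed.typed_Cond)
    qed
  qed
qed

lemma typed_weaken: "typed \<Delta> \<sigma> P \<Longrightarrow> vle {} \<Delta> \<Delta>' \<Longrightarrow> visfun \<Delta>' \<Longrightarrow> typed \<Delta>' \<sigma> P"
  by (rule typed_vle[of "{}"]) auto

lemma typed_erase: "typed \<Delta> \<sigma> P \<Longrightarrow> n \<notin> live_fn P \<Longrightarrow> typed (erase \<Delta> (Nm n)) \<sigma> P"
  by (rule typed_vle[of "{n}", OF _ _ vle_erase]) (auto intro: visfun_erase typed_visfun)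

lemma typed_erase_con: "typed \<Delta> \<sigma> P \<Longrightarrow> p \<notin> fst ` set \<sigma> \<Longrightarrow> typed (erase \<Delta> (Nm (Con p))) \<sigma> P"
  using typed_erase live_con_in_stack by blast

lemma typed_ParI:
  assumes "wf_env \<Delta> \<sigma>" "typed \<Delta>1 \<sigma>1 P" "typed \<Delta>2 \<sigma>2 Q" "\<Delta>1 \<subseteq>\<^sub>m \<Delta>" "\<Delta>2 \<subseteq>\<^sub>m \<Delta>"
    "dom \<Delta> = dom \<Delta>1 \<union> dom \<Delta>2" "dom \<Delta>1 \<inter> dom \<Delta>2 \<subseteq> server_keys" "\<sigma> \<in> shuffles \<sigma>1 \<sigma>2"
  shows "typed \<Delta> \<sigma> (Par P Q)"
  using typed_Par[OF assms(1-3) vsplitI[OF _ assms(4-7)]] assms(1,8)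
    by (auto simp: wf_env_def inter_def)

text \<open>Normal form of a split. The rule allows the two components to give a shared server
  different values whose union is that of \<Delta>; by weakening, each can be retyped at the
  restriction of \<Delta> to its own keys, so both may be taken to be submaps of \<Delta>.\<close>

lemma typed_ParE:
  assumes "typed \<Delta> \<sigma> (Par P Q)"
  obtains \<Delta>1 \<Delta>2 \<sigma>1 \<sigma>2 where "typed \<Delta>1 \<sigma>1 P" "typed \<Delta>2 \<sigma>2 Q" "\<Delta>1 \<subseteq>\<^sub>m \<Delta>" "\<Delta>2 \<subseteq>\<^sub>m \<Delta>"
    "dom \<Delta> = dom \<Delta>1 \<union> dom \<Delta>2" "dom \<Delta>1 \<inter> dom \<Delta>2 \<subseteq> server_keys" "\<sigma> \<in> shuffles \<sigma>1 \<sigma>2"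
  using assms
proof cases
  case (typed_Par \<Delta>1 \<sigma>1 \<Delta>2 \<sigma>2)
  have vis: "visfun \<Delta>" using typed_Par(1) by (simp add: wf_env_def)
  note sp = vsplit_restrict[OF typed_Par(4) vle_refl[of "{}"] vis]
  then have v: "visfun (\<Delta> |` dom \<Delta>1)" "visfun (\<Delta> |` dom \<Delta>2)" by (auto simp: vsplit_def)
  note le = vsplit_vle_restrict[OF typed_Par(4) vle_refl[of "{}"]]
  show ?thesis
    using that[OF typed_weaken[OF typed_Par(2) le v(1)] typed_weaken[OF typed_Par(3) le v(2)]
        restrict_map_submap restrict_map_submap vsplit_dom[OF sp]] typed_Par(5)
    by (auto simp: inter_def)
qed

lemma typed_Par_commute:
  assumes "typed \<Delta> \<sigma> (Par P Q)"
  shows "typed \<Delta> \<sigma> (Par Q P)"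
proof -
  from assms obtain \<Delta>1 \<Delta>2 \<sigma>1 \<sigma>2 where *: "typed \<Delta>1 \<sigma>1 P" "typed \<Delta>2 \<sigma>2 Q" "\<Delta>1 \<subseteq>\<^sub>m \<Delta>" "\<Delta>2 \<subseteq>\<^sub>m \<Delta>"
    "dom \<Delta> = dom \<Delta>1 \<union> dom \<Delta>2" "dom \<Delta>1 \<inter> dom \<Delta>2 \<subseteq> server_keys" "\<sigma> \<in> shuffles \<sigma>1 \<sigma>2"
    by (rule typed_ParE)
  show ?thesis
    using typed_ParI[OF typed_wf[OF assms] *(2,1,4,3)] *(5-7)
      by (simp add: Un_commute Int_commute shuffles_commutes)
qed

section \<open>Submaps, merged stacks and removal of a pair\<close>

lemma map_leI: "(\<And>k V. \<Delta>1 k = Some V \<Longrightarrow> \<Delta> k = Some V) \<Longrightarrow> \<Delta>1 \<subseteq>\<^sub>m \<Delta>"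
  by (auto simp: map_le_def dom_def)

lemma map_le_Some: "\<Delta>1 \<subseteq>\<^sub>m \<Delta> \<Longrightarrow> \<Delta>1 k = Some V \<Longrightarrow> \<Delta> k = Some V"
  by (metis domI map_le_def)

lemma map_le_erase: "\<Delta>1 \<subseteq>\<^sub>m \<Delta> \<Longrightarrow> erase \<Delta>1 k \<subseteq>\<^sub>m erase \<Delta> k"
  by (rule map_leI) (auto simp: erase_apply dest: map_le_Some split: if_splits)

lemma supp_mono:
  assumes "\<Delta>1 \<subseteq>\<^sub>m \<Delta>" "set \<sigma>1 \<subseteq> set \<sigma>"
  shows "supp \<Delta>1 \<sigma>1 \<subseteq> supp \<Delta> \<sigma>"
proof -
  have "ran \<Delta>1 \<subseteq> ran \<Delta>"
    using map_le_Some[OF assms(1)] by (auto simp: ran_def)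
  then show ?thesis
    unfolding supp_def using map_le_implies_dom_le[OF assms(1)] assms(2) by blast
qed

lemma shuffles_disjoint: "zs \<in> shuffles xs ys \<Longrightarrow> distinct zs \<Longrightarrow> set xs \<inter> set ys = {}"
proof (induction xs ys arbitrary: zs rule: shuffles.induct)
  case (3 x xs y ys)
  from 3(3) consider zs' where "zs = x # zs'" "zs' \<in> shuffles xs (y # ys)"
    | zs' where "zs = y # zs'" "zs' \<in> shuffles (x # xs) ys"
    by auto
  then show ?case
  proof cases
    case 1
    then show ?thesis using 3(1)[OF 1(2)] 3(4) set_shuffles[OF 1(2)] by auto
  next
    case 2
    then show ?thesis using 3(2)[OF 2(2)] 3(4) set_shuffles[OF 2(2)] by auto
  qed
qed auto

text \<open>By alternation the entry above the removed pair is an input tag and the one below it an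
  output tag. So alternation survives the removal and no other pair is affected.\<close>

lemma is_stack_remove: "is_stack (\<sigma>1 @ (p, TO) # (p, TI) # \<sigma>2) \<Longrightarrow> is_stack (\<sigma>1 @ \<sigma>2)"
proof (induction \<sigma>1)
  case Nil
  then show ?case by (simp add: is_stack_Cons)
next
  case (Cons x \<sigma>1)
  obtain q t where x: "x = (q, t)" by fastforce
  let ?\<sigma> = "\<sigma>1 @ (p, TO) # (p, TI) # \<sigma>2"
  have st: "is_stack ?\<sigma>" "snd (hd ?\<sigma>) \<noteq> t" "(q, t) \<notin> set ?\<sigma>"
    "t = TO \<Longrightarrow> (q, TI) \<in> set ?\<sigma> \<Longrightarrow> hd ?\<sigma> = (q, TI)" "t = TI \<Longrightarrow> (q, TO) \<notin> set ?\<sigma>"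
    using Cons.prems unfolding x append_Cons is_stack_Cons by auto
  have IH: "is_stack (\<sigma>1 @ \<sigma>2)" by (rule Cons.IH[OF st(1)])
  show ?case
  proof (cases "\<sigma>1 = []")
    case True
    then have "t = TI" using st(2) by (cases t) auto
    moreover have "snd (hd \<sigma>2) \<noteq> TI" if "\<sigma>2 \<noteq> []"
      using st(1) that unfolding True by (simp add: is_stack_Cons)
    ultimately show ?thesis using st(3,5) IH unfolding x append_Cons is_stack_Cons True by auto
  next
    case False
    then have "hd (\<sigma>1 @ \<sigma>2) = hd ?\<sigma>" by simp
    then show ?thesis using st IH unfolding x append_Cons is_stack_Cons by auto
  qed
qed

subsection \<open>Moves of environments\<close>

text \<open>The clauses produce the environments in the conclusion of the theorem.
  \<open>env_Tau\<close> also covers a server call, whose new names are restricted in the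
  derivative, and a reply at a restricted name; \<open>env_Pair\<close> is a reply at a name still
  listed in the stack. Success has no clause: nothing is claimed about its derivative.\<close>

inductive env_step :: "vis \<Rightarrow> stack \<Rightarrow> 'v act \<Rightarrow> vis \<Rightarrow> stack \<Rightarrow> bool" where
  env_Tau: "env_step \<Delta> \<sigma> Tau \<Delta> \<sigma>"
| env_Pair: "env_step \<Delta> ((p, TO) # (p, TI) # \<sigma>) Tau (erase \<Delta> (Nm (Con p))) \<sigma>"
| env_SOut: "\<Delta> Cur = Some V \<Longrightarrow> Srv a \<in> V \<Longrightarrow> env_step \<Delta> \<sigma> (ASOut a v b p)
    (call_env \<Delta> V b p) ((p, TI) # \<sigma>)"
| env_COut: "\<Delta> Cur = Some V \<Longrightarrow> Con p \<in> V \<Longrightarrow> env_step \<Delta> ((p, TO) # \<sigma>) (ACOut p v b)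
    (reply_env \<Delta> V b) \<sigma>"
| env_SIn: "\<Delta> (Nm (Srv a)) = Some V \<Longrightarrow> env_step \<Delta> \<sigma> (ASIn a v b p)
    (serve_env \<Delta> V b p) ((p, TO) # \<sigma>)"
| env_CIn: "\<Delta> (Nm (Con p)) = Some V \<Longrightarrow> env_step \<Delta> ((p, TI) # (q, TO) # \<sigma>) (ACIn p v b)
    ((erase \<Delta> (Nm (Con p)))(Cur \<mapsto> V \<union> {Srv b})) ((q, TO) # \<sigma>)"
| env_FIn: "env_step \<Delta> \<sigma> (AFIn h v) \<Delta> \<sigma>"
| env_FOut: "env_step \<Delta> \<sigma> (AFOut h v) \<Delta> \<sigma>"

text \<open>The cases in which a move is owed. Inputs at server and continuation names count only
  when \<open>Cur\<close> is absent, and at a continuation name only when its tag is on top. Outputs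
  at such names need no condition, because typing itself makes the sender own
  \<open>Cur\<close>.\<close>

definition enabled :: "vis \<Rightarrow> stack \<Rightarrow> 'v act \<Rightarrow> bool" where
  "enabled \<Delta> \<sigma> \<mu> \<longleftrightarrow> (case \<mu> of ASIn a v b p \<Rightarrow> Cur \<notin> dom \<Delta>
     | ACIn p v b \<Rightarrow> Cur \<notin> dom \<Delta> \<and> (\<exists>\<sigma>'. \<sigma> = (p, TI) # \<sigma>') | ASucc w \<Rightarrow> False | _ \<Rightarrow> True)"

text \<open>The first clause holds even where no move is owed. It locates p^I in the stack of the
  receiver of a reply, and in that of the acting component of a parallel composition, before the tag
  is known to be on top there.\<close>

definition good :: "vis \<Rightarrow> stack \<Rightarrow> 'v act \<Rightarrow> 'e proc \<Rightarrow> bool" where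
  "good \<Delta> \<sigma> \<mu> P' \<longleftrightarrow> (\<forall>p v b. \<mu> = ACIn p v b \<longrightarrow> (p, TI) \<in> set \<sigma>) \<and>
     (enabled \<Delta> \<sigma> \<mu> \<longrightarrow> (\<exists>\<Delta>' \<sigma>'. env_step \<Delta> \<sigma> \<mu> \<Delta>' \<sigma>' \<and> typed \<Delta>' \<sigma>' P'))"

lemma goodI: "(\<And>p v b. \<mu> = ACIn p v b \<Longrightarrow> (p, TI) \<in> set \<sigma>) \<Longrightarrow>
  (enabled \<Delta> \<sigma> \<mu> \<Longrightarrow> \<exists>\<Delta>' \<sigma>'. env_step \<Delta> \<sigma> \<mu> \<Delta>' \<sigma>' \<and> typed \<Delta>' \<sigma>' P') \<Longrightarrow> good \<Delta> \<sigma> \<mu> P'"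
  unfolding good_def by blast

lemma enabled_erase [simp]: "enabled (erase \<Delta> (Nm n)) \<sigma> \<mu> \<longleftrightarrow> enabled \<Delta> \<sigma> \<mu>"
  by (auto simp: enabled_def erase_apply split: act.splits)

lemma env_step_erase:
  assumes "env_step \<Delta> \<sigma> \<mu> \<Delta>' \<sigma>'" "n \<notin> act_names \<mu>"
  shows "env_step (erase \<Delta> (Nm n)) \<sigma> \<mu> (erase \<Delta>' (Nm n)) \<sigma>'"
  using assms(1)
proof cases
  case (env_Pair p)
  show ?thesis unfolding env_Pair erase_commute[of \<Delta> _ "Nm n"] by (rule env_step.env_Pair)
next
  case (env_SOut V a v b p)
  let ?V = "{m \<in> V. Nm m \<noteq> Nm n}"
  have n: "n \<noteq> Srv a" "n \<noteq> Srv b" "n \<noteq> Con p" using assms(2) env_SOut by auto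
  then have "{m \<in> V \<union> {Srv b}. Nm m \<noteq> Nm n} = ?V \<union> {Srv b}" by auto
  then have eq: "erase \<Delta>' (Nm n) = (erase (erase \<Delta> (Nm n)) Cur)(Nm (Srv b) \<mapsto> ?V \<union> {Srv b}, Nm
    (Con p) \<mapsto> ?V \<union> {Srv b})"
    using n unfolding env_SOut by (simp only: erase_upd erase_commute[of _ Cur] vkey.inject
      simp_thms not_sym)
  have "erase \<Delta> (Nm n) Cur = Some ?V" "Srv a \<in> ?V" using env_SOut n by (auto simp: erase_apply)
  from env_step.env_SOut[where \<Delta> = "erase \<Delta> (Nm n)", OF this] show ?thesis unfolding eq env_SOut(1,3) .
next
  case (env_COut V p v b)
  let ?V = "{m \<in> V. Nm m \<noteq> Nm n}"
  have n: "n \<noteq> Con p" "n \<noteq> Srv b" using assms(2) env_COut by auto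
  then have "{m \<in> V \<union> {Srv b}. Nm m \<noteq> Nm n} = ?V \<union> {Srv b}" by auto
  then have eq: "erase \<Delta>' (Nm n) = (erase (erase \<Delta> (Nm n)) Cur)(Nm (Srv b) \<mapsto> ?V \<union> {Srv b})"
    using n unfolding env_COut by (simp only: erase_upd erase_commute[of _ Cur] vkey.inject
      simp_thms not_sym)
  have "erase \<Delta> (Nm n) Cur = Some ?V" "Con p \<in> ?V" using env_COut n by (auto simp: erase_apply)
  from env_step.env_COut[where \<Delta> = "erase \<Delta> (Nm n)", OF this] show ?thesis unfolding eq env_COut(1,2) .
next
  case (env_SIn a V v b p)
  let ?V = "{m \<in> V. Nm m \<noteq> Nm n}"
  have n: "n \<noteq> Srv a" "n \<noteq> Srv b" "n \<noteq> Con p" using assms(2) env_SIn by auto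
  then have "{m \<in> V \<union> {Srv b, Con p}. Nm m \<noteq> Nm n} = ?V \<union> {Srv b, Con p}" by auto
  then have eq: "erase \<Delta>' (Nm n) = (erase \<Delta> (Nm n))(Cur \<mapsto> ?V \<union> {Srv b, Con p})"
    unfolding env_SIn by (simp add: erase_upd)
  have "erase \<Delta> (Nm n) (Nm (Srv a)) = Some ?V" using env_SIn n by (auto simp: erase_apply)
  from env_step.env_SIn[where \<Delta> = "erase \<Delta> (Nm n)", OF this] show ?thesis unfolding eq env_SIn(1,3) .
next
  case (env_CIn p V q \<tau> v b)
  let ?V = "{m \<in> V. Nm m \<noteq> Nm n}"
  have n: "n \<noteq> Con p" "n \<noteq> Srv b" using assms(2) env_CIn by auto
  then have "{m \<in> V \<union> {Srv b}. Nm m \<noteq> Nm n} = ?V \<union> {Srv b}" by auto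
  then have eq: "erase \<Delta>' (Nm n) = (erase (erase \<Delta> (Nm n)) (Nm (Con p)))(Cur \<mapsto> ?V \<union> {Srv b})"
    unfolding env_CIn by (simp add: erase_upd erase_commute[of _ "Nm n"])
  have "erase \<Delta> (Nm n) (Nm (Con p)) = Some ?V" using env_CIn n by (auto simp: erase_apply)
  from env_step.env_CIn[where \<Delta> = "erase \<Delta> (Nm n)", OF this] show ?thesis unfolding eq env_CIn(1,2,4) .
qed (auto intro: env_step.intros)

text \<open>Moves act only on the top of the stack, so a pair p^O, p^I that is not consumed is still
  there afterwards and can be taken out before or after the move. The move that consumes this very
  pair gives the second alternative, which restriction turns into an internal step.\<close>

lemma env_step_remove_pair:
  assumes "env_step \<Delta> (\<sigma>1 @ (p, TO) # (p, TI) # \<sigma>2) \<mu> \<Delta>' \<sigma>'" "Con p \<notin> act_names \<mu>"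
    and st: "is_stack \<sigma>'" "bottom_out \<sigma>'"
  shows "(\<exists>\<tau>1 \<tau>2. \<sigma>' = \<tau>1 @ (p, TO) # (p, TI) # \<tau>2 \<and> env_step \<Delta> (\<sigma>1 @ \<sigma>2) \<mu> \<Delta>' (\<tau>1 @ \<tau>2)) \<or>
    (\<mu> = Tau \<and> \<sigma>1 = [] \<and> \<sigma>' = \<sigma>2 \<and> \<Delta>' = erase \<Delta> (Nm (Con p)))"
  using assms(1)
proof cases
  case env_Tau
  then show ?thesis
    by (intro disjI1 exI[of _ \<sigma>1] exI[of _ \<sigma>2]) (simp add: env_step.env_Tau)
next
  case (env_Pair q)
  show ?thesis
  proof (cases \<sigma>1)
    case Nil
    then show ?thesis using env_Pair by auto
  next
    case (Cons x \<tau>)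
    with env_Pair obtain \<tau>' where "\<sigma>1 = (q, TO) # (q, TI) # \<tau>'" "\<sigma>' = \<tau>' @ (p, TO) # (p, TI) # \<sigma>2"
      by (cases \<tau>) auto
    then show ?thesis using env_step.env_Pair[of \<Delta> q "\<tau>' @ \<sigma>2"] env_Pair by auto
  qed
next
  case (env_SOut V a v b q)
  then show ?thesis using env_step.env_SOut[of \<Delta> V a "\<sigma>1 @ \<sigma>2" v b q] by (metis append_Cons)
next
  case (env_COut V q v b)
  with assms(2) obtain \<tau> where "\<sigma>1 = (q, TO) # \<tau>" "\<sigma>' = \<tau> @ (p, TO) # (p, TI) # \<sigma>2"
    by (cases \<sigma>1) auto
  then show ?thesis using env_step.env_COut[of \<Delta> V q "\<tau> @ \<sigma>2" v b] env_COut by (metis append_Cons)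
next
  case (env_SIn a V v b q)
  then show ?thesis using env_step.env_SIn[of \<Delta> a V "\<sigma>1 @ \<sigma>2" v b q] by (metis append_Cons)
next
  case (env_CIn q V r \<rho> v b)
  then obtain \<tau> where \<tau>: "\<sigma>1 = (q, TI) # \<tau>" "(r, TO) # \<rho> = \<tau> @ (p, TO) # (p, TI) # \<sigma>2"
    by (cases \<sigma>1) auto
  \<comment> \<open>The move for an input requires an output tag under q^I. If that was the p^O of
    the removed pair, the stack must still end with an output tag, so \<open>\<sigma>2\<close> is
    nonempty and by alternation starts with one.\<close>
  have "\<exists>r' \<rho>'. \<tau> @ \<sigma>2 = (r', TO) # \<rho>'"
  proof (cases \<tau>)
    case Nil
    with \<tau> env_CIn st have "is_stack ((p, TO) # (p, TI) # \<sigma>2)"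
      "bottom_out ((p, TO) # (p, TI) # \<sigma>2)" by auto
    then have "\<sigma>2 \<noteq> []" "snd (hd \<sigma>2) \<noteq> TI" by (auto simp: is_stack_Cons bottom_out_Cons split:
      if_splits)
    then show ?thesis using Nil by (cases \<sigma>2) (auto intro: tag.exhaust)
  next
    case (Cons x \<tau>')
    then show ?thesis using \<tau> by auto
  qed
  then obtain r' \<rho>' where "\<tau> @ \<sigma>2 = (r', TO) # \<rho>'" by blast
  then show ?thesis
    using env_step.env_CIn[of \<Delta> q V r' \<rho>' v b] env_CIn \<tau> by (metis append_Cons)
next
  case (env_FIn h v)
  then show ?thesis
    by (intro disjI1 exI[of _ \<sigma>1] exI[of _ \<sigma>2]) (simp add: env_step.env_FIn)
next
  case (env_FOut h v)
  then show ?thesis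
    by (intro disjI1 exI[of _ \<sigma>1] exI[of _ \<sigma>2]) (simp add: env_step.env_FOut)
qed

section \<open>Renaming of moves, and environments that avoid given names\<close>

context involutions
begin

lemma typed_ren_env:
  assumes "typed \<Delta> \<sigma> P" "\<forall>n \<in> fn P. hren s c n = n"
  shows "typed (vren s c \<Delta>) (sren c \<sigma>) P"
  using typed_ren[OF assms(1), of id id id] assms(2) by simp

lemma env_step_ren:
  assumes "env_step \<Delta> \<sigma> \<mu> \<Delta>' \<sigma>'" "\<forall>n \<in> act_names \<mu>. hren s c n = n"
  shows "env_step (vren s c \<Delta>) (sren c \<sigma>) \<mu> (vren s c \<Delta>') (sren c \<sigma>')"
  using assms(1)
proof cases
  case (env_Pair p)
  show ?thesis unfolding env_Pair ren_unfolds by (rule env_step.env_Pair)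
next
  case (env_SOut V a v b p)
  have n: "s a = a" "s b = b" "c p = p" using assms(2) env_SOut(1) by auto
  have "vren s c \<Delta> Cur = Some (hren s c ` V)" "Srv a \<in> hren s c ` V"
    using env_SOut(4,5) n by (auto simp: image_iff intro!: bexI[of _ "Srv a"])
  from env_step.env_SOut[where \<Delta> = "vren s c \<Delta>", OF this] show ?thesis
    unfolding env_SOut(1-3) ren_unfolds n .
next
  case (env_COut V p v b)
  have n: "s b = b" "c p = p" using assms(2) env_COut(2) by auto
  have "vren s c \<Delta> Cur = Some (hren s c ` V)" "Con p \<in> hren s c ` V"
    using env_COut(4,5) n by (auto simp: image_iff intro!: bexI[of _ "Con p"])
  from env_step.env_COut[where \<Delta> = "vren s c \<Delta>", OF this] show ?thesis
    unfolding env_COut(1-3) ren_unfolds n .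
next
  case (env_SIn a V v b p)
  have n: "s a = a" "s b = b" "c p = p" using assms(2) env_SIn(1) by auto
  have "vren s c \<Delta> (Nm (Srv a)) = Some (hren s c ` V)"
    using env_SIn(4) vren_Nm(1)[of \<Delta> a] n by simp
  from env_step.env_SIn[where \<Delta> = "vren s c \<Delta>", OF this] show ?thesis
    unfolding env_SIn(1-3) ren_unfolds n .
next
  case (env_CIn p V q \<tau> v b)
  have n: "s b = b" "c p = p" using assms(2) env_CIn(2) by auto
  have "vren s c \<Delta> (Nm (Con p)) = Some (hren s c ` V)"
    using env_CIn(5) vren_Nm(2)[of \<Delta> p] n by simp
  from env_step.env_CIn[where \<Delta> = "vren s c \<Delta>", OF this] show ?thesis
    unfolding env_CIn(1-4) ren_unfolds n .
qed (auto intro: env_step.intros)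

lemma good_ren:
  assumes "good \<Delta> \<sigma> \<mu> P'" "\<forall>n \<in> act_names \<mu> \<union> fn P'. hren s c n = n"
  shows "good (vren s c \<Delta>) (sren c \<sigma>) \<mu> P'"
proof (rule goodI)
  fix p v b assume \<mu>: "\<mu> = ACIn p v b"
  then have "c p = p" using assms(2) by auto
  with \<mu> assms(1) show "(p, TI) \<in> set (sren c \<sigma>)"
    by (auto simp: good_def sren_def intro!: image_eqI[of _ _ "(p, TI)"])
next
  assume en: "enabled (vren s c \<Delta>) (sren c \<sigma>) \<mu>"
  have "\<exists>\<sigma>''. \<sigma> = (p, TI) # \<sigma>''" if "sren c \<sigma> = (p, TI) # \<sigma>'" "c p = p" for p \<sigma>'
    using arg_cong[OF that(1), of "sren c"] that(2) by simp
  with en assms(2) have "enabled \<Delta> \<sigma> \<mu>"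
    by (auto simp: enabled_def domIff split: act.splits)
  with assms(1) obtain \<Delta>' \<sigma>' where "env_step \<Delta> \<sigma> \<mu> \<Delta>' \<sigma>'" "typed \<Delta>' \<sigma>' P'"
    by (auto simp: good_def)
  with env_step_ren typed_ren_env assms(2)
  show "\<exists>\<Delta>' \<sigma>'. env_step (vren s c \<Delta>) (sren c \<sigma>) \<mu> \<Delta>' \<sigma>' \<and> typed \<Delta>' \<sigma>' P'"
    by blast
qed

lemma fresh_vren_iff: "hren s c n = n \<Longrightarrow> n \<in> supp (vren s c \<Delta>) (sren c \<sigma>) \<longleftrightarrow> n \<in> supp \<Delta> \<sigma>"
  unfolding supp_vren by (metis hren_hren image_iff)

end

text \<open>Exchange \<open>n\<close> with a name \<open>m\<close> that occurs nowhere. The free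
  names of the process stay fixed, so the permuted environment still types it and avoids
  \<open>n\<close>; there \<open>G\<close> holds, and applying the involution again carries it back.
  \<open>X\<close> collects the names on which \<open>G\<close> depends and which the permutation
  must therefore fix.\<close>

lemma fresh_env_wlog:
  assumes ty: "typed \<Delta> \<sigma> P" and n: "n \<notin> fn P \<union> X" and "finite X"
    and G: "\<And>\<Delta> \<sigma>. typed \<Delta> \<sigma> P \<Longrightarrow> n \<notin> supp \<Delta> \<sigma> \<Longrightarrow> G \<Delta> \<sigma>"
    and eqvt: "\<And>s c \<Delta> \<sigma>. involutions s c \<Longrightarrow> \<forall>m \<in> X. hren s c m = m \<Longrightarrow> G \<Delta> \<sigma> \<Longrightarrow> G (vren s c \<Delta>) (sren c \<sigma>)"
  shows "G \<Delta> \<sigma>"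
proof -
  have fin: "finite (supp \<Delta> \<sigma> \<union> fn P \<union> X)"
    using finite_supp[OF typed_visfun[OF ty]] \<open>finite X\<close> by simp
  have "\<exists>s c m. involutions s c \<and> hren s c m = n \<and> m \<notin> supp \<Delta> \<sigma> \<and> (\<forall>k \<in> fn P \<union> X. hren s c k = k)"
  proof (cases n)
    case (Srv a)
    obtain a' where "Srv a' \<notin> supp \<Delta> \<sigma> \<union> fn P \<union> X" using ex_fresh_srv[OF fin] by blast
    then show ?thesis
      using Srv n swap_fresh_S[of a a' "fn P \<union> X"]
      by (intro exI[of _ "transpose a a'"] exI[of _ id] exI[of _ "Srv a'"])
        (auto intro: involutions_transpose_S)
  next
    case (Con p)
    obtain p' where "Con p' \<notin> supp \<Delta> \<sigma> \<union> fn P \<union> X" using ex_fresh_con[OF fin] by blast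
    then show ?thesis
      using Con n swap_fresh_C[of p p' "fn P \<union> X"]
      by (intro exI[of _ "transpose p p'"] exI[of _ id] exI[of _ "Con p'"])
        (auto intro: involutions_transpose_C)
  qed
  then obtain s c m where inv: "involutions s c" and m: "hren s c m = n" "m \<notin> supp \<Delta> \<sigma>"
    and fix_names: "\<forall>k \<in> fn P \<union> X. hren s c k = k" by blast
  interpret involutions s c by fact
  have "typed (vren s c \<Delta>) (sren c \<sigma>) P" using typed_ren_env[OF ty] fix_names by blast
  moreover have "n \<notin> supp (vren s c \<Delta>) (sren c \<sigma>)"
    using m unfolding supp_vren by auto
  ultimately have "G (vren s c \<Delta>) (sren c \<sigma>)" by (rule G)
  from eqvt[OF inv _ this] fix_names show ?thesis by auto
qed

lemma fresh_env_wlog_set: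
  assumes "finite N" "finite X" "typed \<Delta> \<sigma> P" "N \<inter> (fn P \<union> X) = {}"
    and "\<And>\<Delta> \<sigma>. typed \<Delta> \<sigma> P \<Longrightarrow> N \<inter> supp \<Delta> \<sigma> = {} \<Longrightarrow> G \<Delta> \<sigma>"
    and "\<And>s c \<Delta> \<sigma>. involutions s c \<Longrightarrow> \<forall>m \<in> X. hren s c m = m \<Longrightarrow> G \<Delta> \<sigma> \<Longrightarrow> G (vren s c \<Delta>) (sren c \<sigma>)"
  shows "G \<Delta> \<sigma>"
  using assms
proof (induction N arbitrary: G X \<Delta> \<sigma> rule: finite_induct)
  case empty
  then show ?case by blast
next
  case (insert n N)
  show ?case
  proof (rule fresh_env_wlog[OF insert.prems(2), where n = n and X = X and G = G])
    fix \<Delta> \<sigma> assume ty: "typed \<Delta> \<sigma> P" and n: "n \<notin> supp \<Delta> \<sigma>"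
    \<comment> \<open>Later permutations must not bring \<open>n\<close> back: its freshness becomes
      a premise of the property, and \<open>n\<close> joins the names that are kept fixed.\<close>
    have "n \<notin> supp \<Delta> \<sigma> \<longrightarrow> G \<Delta> \<sigma>"
    proof (rule insert.IH[where X = "insert n X"])
      fix \<Delta> \<sigma> assume "typed \<Delta> \<sigma> P" "N \<inter> supp \<Delta> \<sigma> = {}"
      then show "n \<notin> supp \<Delta> \<sigma> \<longrightarrow> G \<Delta> \<sigma>" by (auto intro: insert.prems(4))
    next
      fix s c \<Delta> \<sigma>
      assume inv: "involutions s c" "\<forall>m \<in> insert n X. hren s c m = m" and G: "n \<notin> supp \<Delta> \<sigma> \<longrightarrow> G \<Delta> \<sigma>"
      then show "n \<notin> supp (vren s c \<Delta>) (sren c \<sigma>) \<longrightarrow> G (vren s c \<Delta>) (sren c \<sigma>)"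
        using involutions.fresh_vren_iff[OF inv(1)] insert.prems(5)[OF inv(1)] by simp
    qed (use insert ty in auto)
    with n show "G \<Delta> \<sigma>" by blast
  qed (use insert.prems insert.hyps in auto)
qed

lemma typed_fresh_wlog:
  assumes "finite N" "typed \<Delta> \<sigma> P" "N \<inter> (fn P \<union> fn R) = {}"
    and "\<And>\<Delta> \<sigma>. typed \<Delta> \<sigma> P \<Longrightarrow> N \<inter> supp \<Delta> \<sigma> = {} \<Longrightarrow> typed \<Delta> \<sigma> R"
  shows "typed \<Delta> \<sigma> R"
  by (rule fresh_env_wlog_set[OF assms(1) finite_fn assms(2,3), where G = "\<lambda>\<Delta> \<sigma>. typed \<Delta> \<sigma> R"])
    (auto intro: assms(4) involutions.typed_ren_env)

lemma good_fresh_wlog: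
  assumes "finite N" "typed \<Delta> \<sigma> P" "N \<inter> (fn P \<union> (act_names \<mu> \<union> fn R)) = {}"
    and bn: "bn \<mu> \<inter> supp \<Delta> \<sigma> = {}"
    and good: "\<And>\<Delta> \<sigma>. typed \<Delta> \<sigma> P \<Longrightarrow> bn \<mu> \<inter> supp \<Delta> \<sigma> = {} \<Longrightarrow> N \<inter> supp \<Delta> \<sigma> = {} \<Longrightarrow> good \<Delta> \<sigma> \<mu> R"
  shows "good \<Delta> \<sigma> \<mu> R"
proof -
  have "bn \<mu> \<inter> supp \<Delta> \<sigma> = {} \<longrightarrow> good \<Delta> \<sigma> \<mu> R"
  proof (rule fresh_env_wlog_set[OF assms(1) _ assms(2,3)])
    fix s c \<Delta> \<sigma>
    assume inv: "involutions s c" and fix_names: "\<forall>m \<in> act_names \<mu> \<union> fn R. hren s c m = m"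
      and G: "bn \<mu> \<inter> supp \<Delta> \<sigma> = {} \<longrightarrow> good \<Delta> \<sigma> \<mu> R"
    interpret involutions s c by fact
    have "bn \<mu> \<inter> supp (vren s c \<Delta>) (sren c \<sigma>) = bn \<mu> \<inter> supp \<Delta> \<sigma>"
      using fresh_vren_iff fix_names bn_subset_act_names[of \<mu>] by blast
    then show "bn \<mu> \<inter> supp (vren s c \<Delta>) (sren c \<sigma>) = {} \<longrightarrow> good (vren s c \<Delta>) (sren c \<sigma>) \<mu> R"
      using good_ren[OF _ fix_names] G by simp
  qed (auto intro: good)
  with bn show ?thesis by blast
qed

subsection \<open>Parallel composition\<close>

lemma top_outE:
  assumes "\<sigma> \<noteq> []" "snd (hd \<sigma>) \<noteq> TI"
  obtains q \<rho> where "\<sigma> = (q, TO) # \<rho>"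
proof -
  obtain q t \<rho> where "\<sigma> = (q, t) # \<rho>" using assms(1) by (cases \<sigma>) auto
  with assms(2) that show ?thesis by (cases t) auto
qed

text \<open>A move of one component is a move of the whole. Two points need care. The part of
  \<open>\<sigma>1\<close> that the move uses must also be on top of the merged stack, which comes
  from counting tags. And the idle component must follow an erasure of \<open>p\<close>: its stack
  does not contain \<open>p\<close>, so it stays typed when \<open>p\<close> is erased.\<close>

lemma env_step_ParL:
  assumes ty: "typed \<Delta> \<sigma> (Par P0 Q)" and ty1: "typed \<Delta>1 \<sigma>1 P0" and ty2: "typed \<Delta>2 \<sigma>2 Q"
    and le: "\<Delta>1 \<subseteq>\<^sub>m \<Delta>" "\<Delta>2 \<subseteq>\<^sub>m \<Delta>" and dom: "dom \<Delta> = dom \<Delta>1 \<union> dom \<Delta>2"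
    and srv: "dom \<Delta>1 \<inter> dom \<Delta>2 \<subseteq> server_keys" and sh: "\<sigma> \<in> shuffles \<sigma>1 \<sigma>2"
    and fresh: "bn \<mu> \<inter> supp \<Delta> \<sigma> = {}" and en: "enabled \<Delta> \<sigma> \<mu>"
    and es: "env_step \<Delta>1 \<sigma>1 \<mu> \<Delta>1' \<sigma>1'" and ty': "typed \<Delta>1' \<sigma>1' P'"
  shows "\<exists>\<Delta>' \<sigma>'. env_step \<Delta> \<sigma> \<mu> \<Delta>' \<sigma>' \<and> typed \<Delta>' \<sigma>' (Par P' Q)"
proof -
  note wf = typed_wf[OF ty] and vis = typed_visfun[OF ty]
  note st = typed_stack[OF ty] typed_stack[OF ty1] typed_stack[OF ty2]
  note bo = typed_bottom_out[OF ty] typed_bottom_out[OF ty1] typed_bottom_out[OF ty2]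
  note disj = shuffles_disjoint[OF sh] and set_sh = set_shuffles[OF sh]
  have dist: "distinct \<sigma>" using st(1) by (simp add: is_stack_def)
  \<comment> \<open>\<open>Cur\<close> is not a server key, so at most one component has it.\<close>
  have Cur2: "Cur \<notin> dom \<Delta>2" if "\<Delta>1 Cur = Some V" for V using srv that by auto
  show ?thesis
    using es
  proof cases
    case env_Tau
    then show ?thesis using typed_ParI[OF wf ty' ty2 _ le(2)] le dom srv sh env_step.env_Tau by blast
  next
    case (env_FIn h v)
    then have "typed \<Delta> \<sigma> (Par P' Q)" using typed_ParI[OF wf _ ty2 le dom srv sh] ty' by blast
    then show ?thesis unfolding env_FIn using env_step.env_FIn by metis
  next
    case (env_FOut h v)
    then have "typed \<Delta> \<sigma> (Par P' Q)" using typed_ParI[OF wf _ ty2 le dom srv sh] ty' by blast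
    then show ?thesis unfolding env_FOut using env_step.env_FOut by metis
  next
    case (env_Pair p)
    from shuffles_top_out[OF sh[unfolded env_Pair] st(1) st(2)[unfolded env_Pair] st(3) bo(1)
      bo(2)[unfolded env_Pair] bo(3)]
    obtain \<tau> where \<tau>: "\<sigma> = (p, TO) # \<tau>" "\<tau> \<in> shuffles ((p, TI) # \<sigma>1') \<sigma>2" by blast
    have "(p, TI) \<in> set \<tau>" using set_shuffles[OF \<tau>(2)] by auto
    \<comment> \<open>The stack condition on the merge: p^I, being present, must follow p^O
      directly, so nothing of \<open>\<sigma>2\<close> lies between them.\<close>
    then have "hd \<tau> = (p, TI)" "\<tau> \<noteq> []" using st(1) \<tau>(1) by (auto simp: is_stack_Cons)
    then obtain \<tau>' where \<tau>': "\<tau> = (p, TI) # \<tau>'" by (cases \<tau>) auto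
    have p2: "(p, TI) \<notin> set \<sigma>2" "(p, TO) \<notin> set \<sigma>2" using disj dist env_Pair by auto
    with hd_shuffles[OF \<tau>(2) \<tau>'] have sh': "\<tau>' \<in> shuffles \<sigma>1' \<sigma>2" by auto
    have "p \<notin> fst ` set \<sigma>2" using p2 by (auto, metis tag.exhaust)
    from typed_erase_con[OF ty2 this] have ty2': "typed (erase \<Delta>2 (Nm (Con p))) \<sigma>2 Q" .
    have "typed (erase \<Delta> (Nm (Con p))) \<tau>' (Par P' Q)"
    proof (rule typed_ParI[OF _ ty'[unfolded env_Pair] ty2' map_le_erase[OF le(1)] map_le_erase[OF
      le(2)] _ _ sh'])
      show "wf_env (erase \<Delta> (Nm (Con p))) \<tau>'"
        using st(1) \<tau>(1) \<tau>' by (simp add: wf_env_def visfun_erase[OF vis] is_stack_Cons)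
    qed (use dom srv in \<open>auto simp del: map_le_erase\<close>)
    then show ?thesis unfolding env_Pair(2) \<tau>(1) \<tau>' using env_step.env_Pair by blast
  next
    case (env_SOut V a v b p)
    have fr: "Srv b \<notin> supp \<Delta> \<sigma>" "Con p \<notin> supp \<Delta> \<sigma>" using fresh env_SOut by auto
    have V: "\<Delta> Cur = Some V" using map_le_Some[OF le(1) env_SOut(4)] .
    \<comment> \<open>The new p^I may not be pushed on another input tag. The derivative is typed
      with p^I on \<open>\<sigma>1\<close>, so \<open>\<sigma>1\<close> starts with an output tag,
      and then so does \<open>\<sigma>\<close>.\<close>
    have "\<sigma>1 \<noteq> []" "snd (hd \<sigma>1) \<noteq> TI"
      using typed_bottom_out[OF ty'] typed_stack[OF ty'] unfolding env_SOut
      by (auto simp: bottom_out_Cons is_stack_Cons split: if_splits)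
    then obtain q \<rho> where "\<sigma>1 = (q, TO) # \<rho>" by (rule top_outE)
    from shuffles_top_out[OF sh[unfolded this] st(1) st(2)[unfolded this] st(3) bo(1)
      bo(2)[unfolded this] bo(3)]
    obtain \<tau> where \<tau>: "\<sigma> = (q, TO) # \<tau>" by blast
    have pn: "(p, t) \<notin> set \<sigma>" for t using fr suppI(3) by blast
    let ?D = "call_env \<Delta> V b p"
    have none: "\<Delta> (Nm (Srv b)) = None" "\<Delta> (Nm (Con p)) = None" using fr by (auto simp: supp_def)
    then have b2: "\<Delta>2 (Nm (Srv b)) = None" "\<Delta>2 (Nm (Con p)) = None" using dom
      by (auto simp: domIff[symmetric])
    have T: "typed ?D ((p, TI) # \<sigma>) (Par P' Q)"
    proof (rule typed_ParI[OF _ ty'[unfolded env_SOut] ty2])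
      show "wf_env ?D ((p, TI) # \<sigma>)"
        using visfun_server_output(2)[OF vis V fr] st(1) pn[of TO] pn[of TI] \<tau>
          by (simp add: wf_env_def is_stack_Cons)
      show "call_env \<Delta>1 V b p \<subseteq>\<^sub>m ?D"
        using map_le_Some[OF le(1)] by (intro map_leI) (auto simp: erase_Cur split: if_splits)
      show "\<Delta>2 \<subseteq>\<^sub>m ?D"
        using map_le_Some[OF le(2)] b2 Cur2[OF env_SOut(4)]
        by (intro map_leI) (auto simp: erase_Cur split: if_splits)
      show "dom ?D = dom (call_env \<Delta>1 V b p) \<union> dom \<Delta>2"
        using dom Cur2[OF env_SOut(4)] by auto
      show "dom (call_env \<Delta>1 V b p) \<inter> dom \<Delta>2
          \<subseteq> server_keys"
        using srv b2 by auto
      show "(p, TI) # \<sigma> \<in> shuffles ((p, TI) # \<sigma>1) \<sigma>2" using sh by (rule Cons_in_shuffles_leftI)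
    qed
    show ?thesis unfolding env_SOut(1)
      by (intro exI conjI, rule env_step.env_SOut[where \<Delta> = \<Delta>, OF V env_SOut(5)], rule T)
  next
    case (env_COut V p v b)
    have fr: "Srv b \<notin> supp \<Delta> \<sigma>" using fresh env_COut by auto
    \<comment> \<open>\<open>visfun_server_output\<close> treats calls and replies together;
      \<open>r\<close> supplies the fresh continuation name that a reply lacks.\<close>
    obtain r where r: "Con r \<notin> supp \<Delta> \<sigma>" using ex_fresh_con[OF finite_supp[OF vis]] by blast
    have V: "\<Delta> Cur = Some V" using map_le_Some[OF le(1) env_COut(4)] .
    from shuffles_top_out[OF sh[unfolded env_COut(1)] st(1) st(2)[unfolded env_COut(1)] st(3)
      bo(1) bo(2)[unfolded env_COut(1)] bo(3)]
    obtain \<tau> where \<tau>: "\<sigma> = (p, TO) # \<tau>" "\<tau> \<in> shuffles \<sigma>1' \<sigma>2" by blast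
    let ?D = "reply_env \<Delta> V b"
    have none: "\<Delta> (Nm (Srv b)) = None" using fr by (auto simp: supp_def)
    then have b2: "\<Delta>2 (Nm (Srv b)) = None" using dom by (auto simp: domIff[symmetric])
    have T: "typed ?D \<tau> (Par P' Q)"
    proof (rule typed_ParI[OF _ ty'[unfolded env_COut(3)] ty2])
      show "wf_env ?D \<tau>"
        using visfun_server_output(1)[OF vis V fr r] st(1) \<tau> by (simp add: wf_env_def is_stack_Cons)
      show "reply_env \<Delta>1 V b \<subseteq>\<^sub>m ?D"
        using map_le_Some[OF le(1)] by (intro map_leI) (auto simp: erase_Cur split: if_splits)
      show "\<Delta>2 \<subseteq>\<^sub>m ?D"
        using map_le_Some[OF le(2)] b2 Cur2[OF env_COut(4)]
        by (intro map_leI) (auto simp: erase_Cur split: if_splits)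
      show "dom ?D = dom (reply_env \<Delta>1 V b) \<union> dom \<Delta>2"
        using dom Cur2[OF env_COut(4)] by auto
      show "dom (reply_env \<Delta>1 V b) \<inter> dom \<Delta>2 \<subseteq> server_keys"
        using srv b2 by auto
      show "\<tau> \<in> shuffles \<sigma>1' \<sigma>2" by fact
    qed
    show ?thesis unfolding env_COut(2) \<tau>(1)
      by (intro exI conjI, rule env_step.env_COut[where \<Delta> = \<Delta>, OF V env_COut(5)], rule T)
  next
    case (env_SIn a V v b p)
    have fr: "Srv b \<notin> supp \<Delta> \<sigma>" "Con p \<notin> supp \<Delta> \<sigma>" using fresh env_SIn by auto
    have V: "\<Delta> (Nm (Srv a)) = Some V" using map_le_Some[OF le(1) env_SIn(4)] .
    have Cur: "Cur \<notin> dom \<Delta>" using en env_SIn(1) by (simp add: enabled_def)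
    \<comment> \<open>Without \<open>Cur\<close> there is no output tag on top, so the new p^O
      respects alternation.\<close>
    have hd: "\<sigma> \<noteq> [] \<longrightarrow> snd (hd \<sigma>) \<noteq> TO"
    proof (intro impI notI)
      assume "\<sigma> \<noteq> []" "snd (hd \<sigma>) = TO"
      then obtain q \<tau> where "\<sigma> = (q, TO) # \<tau>" by (cases \<sigma>) auto
      with typed_top_out[OF ty this] Cur show False by simp
    qed
    have pn: "(p, t) \<notin> set \<sigma>" for t using fr suppI(3) by blast
    let ?D = "serve_env \<Delta> V b p"
    have T: "typed ?D ((p, TO) # \<sigma>) (Par P' Q)"
    proof (rule typed_ParI[OF _ ty'[unfolded env_SIn] ty2])
      show "wf_env ?D ((p, TO) # \<sigma>)"
        using visfun_server_input[OF vis V fr] st(1) pn[of TO] pn[of TI] hd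
          by (simp add: wf_env_def is_stack_Cons)
      show "serve_env \<Delta>1 V b p \<subseteq>\<^sub>m ?D"
        using map_le_Some[OF le(1)] by (intro map_leI) (auto split: if_splits)
      show "\<Delta>2 \<subseteq>\<^sub>m ?D"
        using map_le_Some[OF le(2)] Cur dom by (intro map_leI) (auto split: if_splits)
      show "dom ?D = dom (serve_env \<Delta>1 V b p) \<union> dom \<Delta>2" using dom by auto
      show "dom (serve_env \<Delta>1 V b p) \<inter> dom \<Delta>2 \<subseteq> server_keys"
        using srv Cur dom by auto
      show "(p, TO) # \<sigma> \<in> shuffles ((p, TO) # \<sigma>1) \<sigma>2" using sh by (rule Cons_in_shuffles_leftI)
    qed
    show ?thesis unfolding env_SIn(1)
      by (intro exI conjI, rule env_step.env_SIn[where \<Delta> = \<Delta>, OF V], rule T)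
  next
    case (env_CIn p V q \<rho> v b)
    have fr: "Srv b \<notin> supp \<Delta> \<sigma>" using fresh env_CIn by auto
    have V: "\<Delta> (Nm (Con p)) = Some V" using map_le_Some[OF le(1) env_CIn(5)] .
    have Cur: "Cur \<notin> dom \<Delta>" and "\<exists>\<tau>. \<sigma> = (p, TI) # \<tau>" using en env_CIn(2) by (auto simp: enabled_def)
    then obtain \<tau> where \<tau>: "\<sigma> = (p, TI) # \<tau>" by blast
    have p2: "(p, TI) \<notin> set \<sigma>2" using disj dist env_CIn by auto
    have "(p, TO) \<notin> set \<sigma>" using st(1) \<tau> by (simp add: is_stack_Cons)
    then have "p \<notin> fst ` set \<sigma>2" using p2 set_sh by (auto, metis UnCI tag.exhaust)
    from typed_erase_con[OF ty2 this] have ty2': "typed (erase \<Delta>2 (Nm (Con p))) \<sigma>2 Q" .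
    have sh': "\<tau> \<in> shuffles ((q, TO) # \<rho>) \<sigma>2"
      using hd_shuffles[OF sh \<tau>] p2 env_CIn(1) by auto
    have "\<tau> \<noteq> []" using set_shuffles[OF sh'] by auto
    then have st': "is_stack \<tau>" "bottom_out \<tau>" using st(1) bo(1) \<tau>
      by (auto simp: is_stack_Cons bottom_out_Cons)
    \<comment> \<open>After the pop, q^O is on top of the acting component, hence also on top of the
      merged stack, as the move requires.\<close>
    from shuffles_top_out[OF sh' st'(1) typed_stack[OF ty', unfolded env_CIn] st(3) st'(2)
        typed_bottom_out[OF ty', unfolded env_CIn] bo(3)]
    obtain \<tau>' where \<tau>': "\<tau> = (q, TO) # \<tau>'" by blast
    let ?D = "(erase \<Delta> (Nm (Con p)))(Cur \<mapsto> V \<union> {Srv b})"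
    have T: "typed ?D \<tau> (Par P' Q)"
    proof (rule typed_ParI[OF _ ty'[unfolded env_CIn] ty2' _ _ _ _ sh'])
      show "wf_env ?D \<tau>" using visfun_con_input(1)[OF vis V fr] st' by (simp add: wf_env_def)
      show "(erase \<Delta>1 (Nm (Con p)))(Cur \<mapsto> V \<union> {Srv b}) \<subseteq>\<^sub>m ?D"
        using map_le_Some[OF map_le_erase[OF le(1)]] by (intro map_leI) (auto split: if_splits)
      show "erase \<Delta>2 (Nm (Con p)) \<subseteq>\<^sub>m ?D"
        using map_le_Some[OF map_le_erase[OF le(2), of "Nm (Con p)"]] Cur dom
        by (intro map_leI) (auto simp: erase_apply split: if_splits)
      show "dom ?D = dom ((erase \<Delta>1 (Nm (Con p)))(Cur \<mapsto> V \<union> {Srv b})) \<union> dom (erase \<Delta>2 (Nm (Con p)))"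
        using dom by auto
      show "dom ((erase \<Delta>1 (Nm (Con p)))(Cur \<mapsto> V \<union> {Srv b})) \<inter> dom (erase \<Delta>2 (Nm (Con p)))
          \<subseteq> server_keys"
        using srv Cur dom by auto
    qed
    show ?thesis unfolding env_CIn(2) \<tau> \<tau>'
      by (intro exI conjI, rule env_step.env_CIn[where \<Delta> = \<Delta>, OF V], rule T[unfolded \<tau>'])
  qed
qed

text \<open>A bound name of a transition may be free in a discarded branch of a choice or conditional.
  Therefore the freshness of bound names refers to a process \<open>P0\<close> in which these branches are pruned.\<close>

definition prunes :: "'e proc \<Rightarrow> 'v act \<Rightarrow> 'e proc \<Rightarrow> 'e proc \<Rightarrow> bool" where
  "prunes P \<mu> P' P0 \<longleftrightarrow> (\<forall>\<Delta> \<sigma>. typed \<Delta> \<sigma> P \<longrightarrow> typed \<Delta> \<sigma> P0) \<and> bn \<mu> \<inter> fn P0 = {} \<and>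
     (\<forall>\<Delta> \<sigma>. typed \<Delta> \<sigma> P0 \<longrightarrow> bn \<mu> \<inter> supp \<Delta> \<sigma> = {} \<longrightarrow> good \<Delta> \<sigma> \<mu> P')"

definition preserves :: "'e proc \<Rightarrow> 'v act \<Rightarrow> 'e proc \<Rightarrow> bool" where
  "preserves P \<mu> P' \<longleftrightarrow> (\<exists>P0. prunes P \<mu> P' P0)"

lemma preservesI:
  fixes P P' P0 :: "'e proc"
  assumes "\<And>\<Delta> \<sigma>. typed \<Delta> \<sigma> P \<Longrightarrow> typed \<Delta> \<sigma> P0" "bn \<mu> \<inter> fn P0 = {}"
    "\<And>\<Delta> \<sigma>. typed \<Delta> \<sigma> P0 \<Longrightarrow> bn \<mu> \<inter> supp \<Delta> \<sigma> = {} \<Longrightarrow> good \<Delta> \<sigma> \<mu> P'"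
  shows "preserves P \<mu> P'"
  unfolding preserves_def prunes_def by (rule exI[of _ P0]) (simp add: assms)

lemma prunesD:
  assumes "prunes P \<mu> P' P0"
  shows "typed \<Delta> \<sigma> P \<Longrightarrow> typed \<Delta> \<sigma> P0" "bn \<mu> \<inter> fn P0 = {}"
    "typed \<Delta> \<sigma> P0 \<Longrightarrow> bn \<mu> \<inter> supp \<Delta> \<sigma> = {} \<Longrightarrow> good \<Delta> \<sigma> \<mu> P'"
  using assms by (simp_all add: prunes_def)

text \<open>The pruned process of \<open>Q\<close> also serves \<open>P\<close>. Rules that merely
  pass a transition on are instances: replication, choice, conditional, first-order restriction and
  the mirrored parallel rules.\<close>

lemma preserves_mono:
  fixes P P' Q Q' :: "'e proc"
  assumes "preserves Q \<mu> Q'" "\<And>\<Delta> \<sigma>. typed \<Delta> \<sigma> P \<Longrightarrow> typed \<Delta> \<sigma> Q" "\<And>\<Delta> \<sigma>. typed \<Delta> \<sigma> Q' \<Longrightarrow> typed \<Delta> \<sigma> P'"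
  shows "preserves P \<mu> P'"
proof -
  from assms(1) obtain P0 where "prunes Q \<mu> Q' P0"
    unfolding preserves_def by blast
  note P0 = prunesD[OF this]
  have "good \<Delta> \<sigma> \<mu> P'" if "good \<Delta> \<sigma> \<mu> Q'" for \<Delta> \<sigma>
    using that assms(3) unfolding good_def by blast
  then show ?thesis
    by (intro preservesI[of P P0]) (simp_all add: P0 assms(2))
qed

lemma preserves_ParL:
  fixes P P' Q :: "'e proc"
  assumes "preserves P \<mu> P'" "bn \<mu> \<inter> fn Q = {}"
  shows "preserves (Par P Q) \<mu> (Par P' Q)"
proof -
  from assms(1) obtain P0 where "prunes P \<mu> P' P0"
    unfolding preserves_def by blast
  note P0 = prunesD[OF this]
  show ?thesis
  proof (rule preservesI)
    fix \<Delta> \<sigma> assume "typed \<Delta> \<sigma> (Par P Q)"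
    then show "typed \<Delta> \<sigma> (Par P0 Q)" by cases (blast intro: typed_Par P0(1))
  next
    show "bn \<mu> \<inter> fn (Par P0 Q) = {}" using P0(2) assms(2) by auto
  next
    fix \<Delta> \<sigma> assume ty: "typed \<Delta> \<sigma> (Par P0 Q)" and fresh: "bn \<mu> \<inter> supp \<Delta> \<sigma> = {}"
    from ty obtain \<Delta>1 \<Delta>2 \<sigma>1 \<sigma>2 where ty1: "typed \<Delta>1 \<sigma>1 P0" and ty2: "typed \<Delta>2 \<sigma>2 Q"
      and le: "\<Delta>1 \<subseteq>\<^sub>m \<Delta>" "\<Delta>2 \<subseteq>\<^sub>m \<Delta>" and dom: "dom \<Delta> = dom \<Delta>1 \<union> dom \<Delta>2"
      and srv: "dom \<Delta>1 \<inter> dom \<Delta>2 \<subseteq> server_keys" and sh: "\<sigma> \<in> shuffles \<sigma>1 \<sigma>2"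
      by (rule typed_ParE)
    have set_sh: "set \<sigma> = set \<sigma>1 \<union> set \<sigma>2" using set_shuffles[OF sh] .
    have "supp \<Delta>1 \<sigma>1 \<subseteq> supp \<Delta> \<sigma>" using supp_mono[OF le(1)] set_sh by auto
    with P0(3)[OF ty1] fresh have good1: "good \<Delta>1 \<sigma>1 \<mu> P'" by blast
    show "good \<Delta> \<sigma> \<mu> (Par P' Q)"
    proof (rule goodI)
      fix p v b assume "\<mu> = ACIn p v b"
      then show "(p, TI) \<in> set \<sigma>" using good1 set_sh by (auto simp: good_def)
    next
      assume en: "enabled \<Delta> \<sigma> \<mu>"
      \<comment> \<open>The tag on top of the merge belongs to the acting component:
        \<open>good\<close> places it in \<open>\<sigma>1\<close>, and no entry lies in both parts.
        Hence the input is enabled there too.\<close>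
      have "\<exists>\<rho>. \<sigma>1 = (p, TI) # \<rho>" if "\<mu> = ACIn p v b" "\<sigma> = (p, TI) # \<tau>" for p v b \<tau>
      proof -
        have "(p, TI) \<in> set \<sigma>1" using good1 that(1) by (auto simp: good_def)
        then have "(p, TI) \<notin> set \<sigma>2"
          using shuffles_disjoint[OF sh] typed_stack[OF ty] by (auto simp: is_stack_def)
        then show ?thesis using hd_shuffles[OF sh that(2)] by auto
      qed
      with en dom have "enabled \<Delta>1 \<sigma>1 \<mu>" by (auto simp: enabled_def split: act.splits)
      with good1 obtain \<Delta>1' \<sigma>1' where "env_step \<Delta>1 \<sigma>1 \<mu> \<Delta>1' \<sigma>1'" "typed \<Delta>1' \<sigma>1' P'"
        by (auto simp: good_def)
      from env_step_ParL[OF ty ty1 ty2 le dom srv sh fresh en this]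
      show "\<exists>\<Delta>' \<sigma>'. env_step \<Delta> \<sigma> \<mu> \<Delta>' \<sigma>' \<and> typed \<Delta>' \<sigma>' (Par P' Q)" .
    qed
  qed
qed

lemma preserves_ParR:
  assumes "preserves Q \<mu> Q'" "bn \<mu> \<inter> fn P = {}"
  shows "preserves (Par P Q) \<mu> (Par P Q')"
  by (rule preserves_mono[OF preserves_ParL[OF assms]]) (rule typed_Par_commute, assumption)+

subsection \<open>Communication\<close>

text \<open>The environment in the middle of a communication, before the sent names are restricted:
  the receiver holds \<open>Cur\<close> and the sender has left the entries of these names.
  \<open>Cur\<close> sees them, so transitivity requires its value to contain theirs.\<close>

lemma visfun_com:
  assumes vis: "visfun \<Delta>" and V: "\<Delta> Cur = Some V" and fr: "Srv b \<notin> supp \<Delta> \<sigma>" "Con p \<notin> supp \<Delta> \<sigma>"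
  shows "visfun (\<Delta>(Cur \<mapsto> V \<union> {Srv b}, Nm (Srv b) \<mapsto> V \<union> {Srv b}))"
    "visfun (\<Delta>(Cur \<mapsto> V \<union> {Srv b, Con p}, Nm (Srv b) \<mapsto> V \<union> {Srv b}, Nm (Con p) \<mapsto> V \<union> {Srv b}))"
proof -
  have fin: "finite V" using visfun_finite[OF vis V] .
  have V': "W \<subseteq> V" if "n \<in> V" "\<Delta> (Nm n) = Some W" for n W
    using visfunD[OF vis V that] .
  note out = visfun_server_output[OF vis V fr]
  have "visfun ((erase \<Delta> Cur)(Nm (Srv b) \<mapsto> V \<union> {Srv b}, Cur \<mapsto> V \<union> {Srv b}))"
  proof (rule visfun_upd[OF out(1)])
    show "W \<subseteq> V \<union> {Srv b}" if "n \<in> V \<union> {Srv b}" "(reply_env \<Delta> V b) (Nm n) = Some W" for n W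
      using that V'[of n W] by (auto simp: erase_Cur split: if_splits)
  qed (use fin in auto)
  moreover have "(erase \<Delta> Cur)(Nm (Srv b) \<mapsto> V \<union> {Srv b}, Cur \<mapsto> V \<union> {Srv b}) =
      \<Delta>(Cur \<mapsto> V \<union> {Srv b}, Nm (Srv b) \<mapsto> V \<union> {Srv b})"
    unfolding erase_Cur by (auto simp: fun_eq_iff)
  ultimately show "visfun (\<Delta>(Cur \<mapsto> V \<union> {Srv b}, Nm (Srv b) \<mapsto> V \<union> {Srv b}))" by metis
  have "visfun ((erase \<Delta> Cur)(Nm (Srv b) \<mapsto> V \<union> {Srv b}, Nm (Con p) \<mapsto> V \<union> {Srv b}, Cur \<mapsto> V \<union>
    {Srv b, Con p}))"
  proof (rule visfun_upd[OF out(2)])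
    show "W \<subseteq> V \<union> {Srv b, Con p}" if "n \<in> V \<union> {Srv b, Con p}"
      "(call_env \<Delta> V b p) (Nm n) = Some W" for n W
      using that V'[of n W] by (auto simp: erase_Cur split: if_splits)
  qed (use fin in auto)
  moreover have "(erase \<Delta> Cur)(Nm (Srv b) \<mapsto> V \<union> {Srv b}, Nm (Con p) \<mapsto> V \<union> {Srv b}, Cur \<mapsto> V \<union>
    {Srv b, Con p}) =
      \<Delta>(Cur \<mapsto> V \<union> {Srv b, Con p}, Nm (Srv b) \<mapsto> V \<union> {Srv b}, Nm (Con p) \<mapsto> V \<union> {Srv b})"
    unfolding erase_Cur by (auto simp: fun_eq_iff)
  ultimately show "visfun (\<Delta>(Cur \<mapsto> V \<union> {Srv b, Con p}, Nm (Srv b) \<mapsto> V \<union> {Srv b}, Nm (Con p) \<mapsto> V \<union>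
    {Srv b}))" by metis
qed

lemma typed_NuS_same: "typed \<Delta> \<sigma> P \<Longrightarrow> typed (erase \<Delta> (Nm (Srv a))) \<sigma> (NuS a P)"
  by (rule typed_NuS) (auto intro: wf_env_erase typed_wf)

lemma typed_NuC_pair_same:
  "typed \<Delta> (\<sigma>1 @ (p, TO) # (p, TI) # \<sigma>2) P \<Longrightarrow> typed (erase \<Delta> (Nm (Con p))) (\<sigma>1 @ \<sigma>2) (NuC p P)"
  by (rule typed_NuC_pair) (auto intro: is_stack_remove typed_stack visfun_erase typed_visfun
    simp: wf_env_def)

lemma typed_NuC_absent_same:
  "typed \<Delta> \<sigma> P \<Longrightarrow> p \<notin> fst ` set \<sigma> \<Longrightarrow> typed (erase \<Delta> (Nm (Con p))) \<sigma> (NuC p P)"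
  by (rule typed_NuC_absent) (auto intro: wf_env_erase typed_wf)

text \<open>The server consumes the caller's \<open>cur\<close>: its own visibility \<open>\<Delta>(a)\<close> is contained in \<open>\<Delta>(cur)\<close> because
  \<open>a \<in> \<Delta>(cur)\<close>, so by weakening it can take over the full visibility of the caller.\<close>

lemma typed_server_com:
  assumes ty: "typed \<Delta> \<sigma> (Par P Q)" and fr: "Srv b \<notin> supp \<Delta> \<sigma>" "Con p \<notin> supp \<Delta> \<sigma>"
    and good1: "\<And>\<Delta>1 \<sigma>1. typed \<Delta>1 \<sigma>1 P \<Longrightarrow> {Srv b, Con p} \<inter> supp \<Delta>1 \<sigma>1 = {} \<Longrightarrow>
      good \<Delta>1 \<sigma>1 (ASOut a v b p) P'"
    and good2: "\<And>\<Delta>2 \<sigma>2. typed \<Delta>2 \<sigma>2 Q \<Longrightarrow> {Srv b, Con p} \<inter> supp \<Delta>2 \<sigma>2 = {} \<Longrightarrow> good \<Delta>2 \<sigma>2 (ASIn a v b p) Q'"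
    and R: "\<And>\<Delta> \<sigma>. typed \<Delta> \<sigma> (Par P' Q') \<Longrightarrow> typed \<Delta> \<sigma> R"
  shows "typed \<Delta> \<sigma> (NuS b (NuC p R))"
proof -
  from ty obtain \<Delta>1 \<Delta>2 \<sigma>1 \<sigma>2 where ty1: "typed \<Delta>1 \<sigma>1 P" and ty2: "typed \<Delta>2 \<sigma>2 Q"
    and le: "\<Delta>1 \<subseteq>\<^sub>m \<Delta>" "\<Delta>2 \<subseteq>\<^sub>m \<Delta>" and dom: "dom \<Delta> = dom \<Delta>1 \<union> dom \<Delta>2"
    and srv: "dom \<Delta>1 \<inter> dom \<Delta>2 \<subseteq> server_keys" and sh: "\<sigma> \<in> shuffles \<sigma>1 \<sigma>2"
    by (rule typed_ParE)
  note vis = typed_visfun[OF ty]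
  note st = typed_stack[OF ty] typed_stack[OF ty1] typed_stack[OF ty2]
  note bo = typed_bottom_out[OF ty] typed_bottom_out[OF ty1] typed_bottom_out[OF ty2]
  have set_sh: "set \<sigma> = set \<sigma>1 \<union> set \<sigma>2" using set_shuffles[OF sh] .
  have sub: "supp \<Delta>1 \<sigma>1 \<subseteq> supp \<Delta> \<sigma>" "supp \<Delta>2 \<sigma>2 \<subseteq> supp \<Delta> \<sigma>"
    using supp_mono[OF le(1)] supp_mono[OF le(2)] set_sh by auto
  have "good \<Delta>1 \<sigma>1 (ASOut a v b p) P'" using good1[OF ty1] sub fr by blast
  then obtain \<Delta>1' \<sigma>1' where "env_step \<Delta>1 \<sigma>1 (ASOut a v b p) \<Delta>1' \<sigma>1'" "typed \<Delta>1' \<sigma>1' P'"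
    by (auto simp: good_def enabled_def)
  then obtain V where V1: "\<Delta>1 Cur = Some V" "Srv a \<in> V"
    and ty1': "typed (call_env \<Delta>1 V b p) ((p, TI) # \<sigma>1) P'"
    by cases auto
  \<comment> \<open>The caller owns \<open>Cur\<close>, so the server does not, and its input is
    enabled.\<close>
  have Cur2: "Cur \<notin> dom \<Delta>2" using srv V1(1) by auto
  have "good \<Delta>2 \<sigma>2 (ASIn a v b p) Q'" using good2[OF ty2] sub fr by blast
  with Cur2 obtain \<Delta>2' \<sigma>2' where "env_step \<Delta>2 \<sigma>2 (ASIn a v b p) \<Delta>2' \<sigma>2'" "typed \<Delta>2' \<sigma>2' Q'"
    by (auto simp: good_def enabled_def)
  then obtain V2 where V2: "\<Delta>2 (Nm (Srv a)) = Some V2"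
    and ty2': "typed (serve_env \<Delta>2 V2 b p) ((p, TO) # \<sigma>2) Q'"
    by cases auto
  have V: "\<Delta> Cur = Some V" using map_le_Some[OF le(1) V1(1)] .
  have "V2 \<subseteq> V" using visfunD[OF vis V V1(2) map_le_Some[OF le(2) V2]] .
  have bp: "Srv b \<notin> U" "Con p \<notin> U" if "\<Delta> k = Some U" for k U using fr that suppI(2) by blast+
  have none: "\<Delta> (Nm (Srv b)) = None" "\<Delta> (Nm (Con p)) = None" using fr by (auto simp: supp_def)
  then have none2: "\<Delta>2 (Nm (Srv b)) = None" "\<Delta>2 (Nm (Con p)) = None" using dom
    by (auto simp: domIff[symmetric])
  \<comment> \<open>Growth is forced: the server sees \<open>b\<close>, whose entry is
    \<open>V\<close> together with \<open>b\<close>, so transitivity of the combined environment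
    requires the server's \<open>Cur\<close> to contain \<open>V\<close>.\<close>
  have ty2'': "typed (serve_env \<Delta>2 V b p) ((p, TO) # \<sigma>2) Q'"
  proof (rule typed_weaken[OF ty2'])
    show "vle {} (serve_env \<Delta>2 V2 b p) (serve_env \<Delta>2 V b p)"
      using \<open>V2 \<subseteq> V\<close> by (intro vle_upd) auto
    show "visfun (serve_env \<Delta>2 V b p)"
    proof (rule visfun_upd[OF typed_visfun[OF ty2]])
      show "finite (V \<union> {Srv b, Con p})" using visfun_finite[OF vis V] by simp
      show "W \<subseteq> V \<union> {Srv b, Con p}" if "n \<in> V \<union> {Srv b, Con p}" "\<Delta>2 (Nm n) = Some W" for n W
      proof -
        have "\<Delta> (Nm n) = Some W" using map_le_Some[OF le(2) that(2)] .
        with that none visfunD[OF vis V, of n W] show ?thesis by auto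
      qed
    qed auto
  qed
  have "\<sigma>1 \<noteq> []" "snd (hd \<sigma>1) \<noteq> TI"
    using typed_bottom_out[OF ty1'] typed_stack[OF ty1']
    by (auto simp: bottom_out_Cons is_stack_Cons split: if_splits)
  then obtain q \<rho> where \<rho>: "\<sigma>1 = (q, TO) # \<rho>" by (rule top_outE)
  obtain \<tau> where \<tau>: "\<sigma> = (q, TO) # \<tau>"
    by (rule shuffles_top_out[OF sh[unfolded \<rho>] st(1) st(2)[unfolded \<rho>] st(3) bo(1) bo(2)[unfolded
      \<rho>] bo(3)])
  have pn: "(p, t) \<notin> set \<sigma>" for t using fr suppI(3) by blast
  let ?D = "\<Delta>(Cur \<mapsto> V \<union> {Srv b, Con p}, Nm (Srv b) \<mapsto> V \<union> {Srv b}, Nm (Con p) \<mapsto> V \<union> {Srv b})"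
  have "typed ?D ((p, TO) # (p, TI) # \<sigma>) (Par P' Q')"
  proof (rule typed_ParI[OF _ ty1' ty2''])
    show "wf_env ?D ((p, TO) # (p, TI) # \<sigma>)"
      using visfun_com(2)[OF vis V fr] st(1) pn[of TO] pn[of TI] \<tau>
        by (simp add: wf_env_def is_stack_Cons)
    show "call_env \<Delta>1 V b p \<subseteq>\<^sub>m ?D"
      using map_le_Some[OF le(1)] by (intro map_leI) (auto simp: erase_Cur split: if_splits)
    show "serve_env \<Delta>2 V b p \<subseteq>\<^sub>m ?D"
      using map_le_Some[OF le(2)] none2 by (intro map_leI) (auto split: if_splits)
    show "dom ?D = dom (call_env \<Delta>1 V b p)
        \<union> dom (serve_env \<Delta>2 V b p)"
      using dom by auto
    show "dom (call_env \<Delta>1 V b p)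
        \<inter> dom (serve_env \<Delta>2 V b p) \<subseteq> server_keys"
      using srv none2 by auto
    show "(p, TO) # (p, TI) # \<sigma> \<in> shuffles ((p, TI) # \<sigma>1) ((p, TO) # \<sigma>2)"
      using sh by (intro Cons_in_shuffles_rightI Cons_in_shuffles_leftI)
  qed
  \<comment> \<open>The server's p^O lies on the caller's p^I. Restricting \<open>p\<close> removes
    the pair, and erasing both fresh names leaves \<Delta>.\<close>
  from typed_NuS_same[OF typed_NuC_pair_same[of _ "[]", simplified, OF R[OF this]], of b]
  have "typed (erase (erase ?D (Nm (Con p))) (Nm (Srv b))) \<sigma> (NuS b (NuC p R))" .
  moreover have "erase (erase ?D (Nm (Con p))) (Nm (Srv b)) = \<Delta>"
  proof
    fix k
    show "erase (erase ?D (Nm (Con p))) (Nm (Srv b)) k = \<Delta> k"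
      using none V bp[OF V] bp[of k] by (cases "\<Delta> k") (auto simp: erase_apply)
  qed
  ultimately show ?thesis by metis
qed

lemma typed_con_com:
  assumes ty: "typed \<Delta> \<sigma> (Par P Q)" and fr: "Srv b \<notin> supp \<Delta> \<sigma>"
    and good1: "\<And>\<Delta>1 \<sigma>1. typed \<Delta>1 \<sigma>1 P \<Longrightarrow> {Srv b} \<inter> supp \<Delta>1 \<sigma>1 = {} \<Longrightarrow> good \<Delta>1 \<sigma>1 (ACOut p v b) P'"
    and good2: "\<And>\<Delta>2 \<sigma>2. typed \<Delta>2 \<sigma>2 Q \<Longrightarrow> {Srv b} \<inter> supp \<Delta>2 \<sigma>2 = {} \<Longrightarrow> good \<Delta>2 \<sigma>2 (ACIn p v b) Q'"
    and R: "\<And>\<Delta> \<sigma>. typed \<Delta> \<sigma> (Par P' Q') \<Longrightarrow> typed \<Delta> \<sigma> R"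
  shows "\<exists>\<tau>. \<sigma> = (p, TO) # (p, TI) # \<tau> \<and> typed (erase \<Delta> (Nm (Con p))) \<tau> (NuS b R)"
proof -
  from ty obtain \<Delta>1 \<Delta>2 \<sigma>1 \<sigma>2 where ty1: "typed \<Delta>1 \<sigma>1 P" and ty2: "typed \<Delta>2 \<sigma>2 Q"
    and le: "\<Delta>1 \<subseteq>\<^sub>m \<Delta>" "\<Delta>2 \<subseteq>\<^sub>m \<Delta>" and dom: "dom \<Delta> = dom \<Delta>1 \<union> dom \<Delta>2"
    and srv: "dom \<Delta>1 \<inter> dom \<Delta>2 \<subseteq> server_keys" and sh: "\<sigma> \<in> shuffles \<sigma>1 \<sigma>2"
    by (rule typed_ParE)
  note vis = typed_visfun[OF ty]
  note st = typed_stack[OF ty] typed_stack[OF ty1] typed_stack[OF ty2]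
  note bo = typed_bottom_out[OF ty] typed_bottom_out[OF ty1] typed_bottom_out[OF ty2]
  have set_sh: "set \<sigma> = set \<sigma>1 \<union> set \<sigma>2" using set_shuffles[OF sh] .
  have disj: "set \<sigma>1 \<inter> set \<sigma>2 = {}" using shuffles_disjoint[OF sh] st(1) by (simp add: is_stack_def)
  have sub: "supp \<Delta>1 \<sigma>1 \<subseteq> supp \<Delta> \<sigma>" "supp \<Delta>2 \<sigma>2 \<subseteq> supp \<Delta> \<sigma>"
    using supp_mono[OF le(1)] supp_mono[OF le(2)] set_sh by auto
  have "good \<Delta>1 \<sigma>1 (ACOut p v b) P'" using good1[OF ty1] sub fr by blast
  then obtain \<Delta>1' \<rho>1 where "env_step \<Delta>1 \<sigma>1 (ACOut p v b) \<Delta>1' \<rho>1" "typed \<Delta>1' \<rho>1 P'"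
    by (auto simp: good_def enabled_def)
  then obtain V where V1: "\<Delta>1 Cur = Some V" "Con p \<in> V" and \<sigma>1: "\<sigma>1 = (p, TO) # \<rho>1"
    and ty1': "typed (reply_env \<Delta>1 V b) \<rho>1 P'"
    by cases auto
  have Cur2: "Cur \<notin> dom \<Delta>2" using srv V1(1) by auto
  have good2': "good \<Delta>2 \<sigma>2 (ACIn p v b) Q'" using good2[OF ty2] sub fr by blast
  \<comment> \<open>Only membership so far; the receiver's move is used after p^I has been found on
    top of \<open>\<sigma>2\<close>.\<close>
  then have pI: "(p, TI) \<in> set \<sigma>2" by (auto simp: good_def)
  obtain \<tau>0 where \<tau>0: "\<sigma> = (p, TO) # \<tau>0" "\<tau>0 \<in> shuffles \<rho>1 \<sigma>2"
    by (rule shuffles_top_out[OF sh[unfolded \<sigma>1] st(1) st(2)[unfolded \<sigma>1] st(3) bo(1)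
      bo(2)[unfolded \<sigma>1] bo(3)])
  have "(p, TI) \<in> set \<tau>0" using set_shuffles[OF \<tau>0(2)] pI by auto
  then have "hd \<tau>0 = (p, TI)" "\<tau>0 \<noteq> []" using st(1) \<tau>0(1) by (auto simp: is_stack_Cons)
  then obtain \<tau> where \<tau>: "\<tau>0 = (p, TI) # \<tau>" by (cases \<tau>0) auto
  have "(p, TI) \<notin> set \<rho>1" using disj pI \<sigma>1 by auto
  with hd_shuffles[OF \<tau>0(2) \<tau>] obtain \<rho>2 where \<sigma>2: "\<sigma>2 = (p, TI) # \<rho>2"
    and sh': "\<tau> \<in> shuffles \<rho>1 \<rho>2" by auto
  obtain \<Delta>2' \<sigma>2' where "env_step \<Delta>2 \<sigma>2 (ACIn p v b) \<Delta>2' \<sigma>2'" "typed \<Delta>2' \<sigma>2' Q'"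
    using good2' Cur2 \<sigma>2 by (auto simp: good_def enabled_def)
  then obtain V2 where V2: "\<Delta>2 (Nm (Con p)) = Some V2"
    and ty2': "typed ((erase \<Delta>2 (Nm (Con p)))(Cur \<mapsto> V2 \<union> {Srv b})) \<rho>2 Q'"
    using \<sigma>2 by cases auto
  have V: "\<Delta> Cur = Some V" using map_le_Some[OF le(1) V1(1)] .
  have "V2 \<subseteq> V" using visfunD[OF vis V V1(2) map_le_Some[OF le(2) V2]] .
  have "(p, TO) \<notin> set \<tau>" "(p, TI) \<notin> set \<tau>" and st\<tau>: "is_stack \<tau>"
    using st(1) by (auto simp: \<tau>0(1) \<tau> is_stack_Cons)
  then have "p \<notin> fst ` set \<tau>" by (auto, metis tag.exhaust)
  \<comment> \<open>With both tags consumed, \<open>p\<close> is live in neither derivative, so each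
    can be retyped with \<open>p\<close> erased.\<close>
  then have pn: "p \<notin> fst ` set \<rho>1" "p \<notin> fst ` set \<rho>2" using set_shuffles[OF sh'] by auto
  let ?E = "erase \<Delta> (Nm (Con p))" and ?V = "{n \<in> V. Nm n \<noteq> Nm (Con p)}"
  let ?DP = "(erase (erase \<Delta>1 Cur) (Nm (Con p)))(Nm (Srv b) \<mapsto> ?V \<union> {Srv b})"
  let ?DQ = "(erase \<Delta>2 (Nm (Con p)))(Cur \<mapsto> ?V \<union> {Srv b})"
  have VE: "?E Cur = Some ?V" using V by (simp add: erase_apply)
  have visE: "visfun ?E" using visfun_erase[OF vis] .
  have frE: "Srv b \<notin> supp ?E []"
    using fr supp_erase[of \<Delta> "Nm (Con p)" "[]"] supp_Nil_subset[of \<Delta> \<sigma>] by blast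
  have none: "\<Delta> (Nm (Srv b)) = None" using fr by (auto simp: supp_def)
  then have none2: "\<Delta>2 (Nm (Srv b)) = None" using dom by (auto simp: domIff[symmetric])
  have "erase (reply_env \<Delta>1 V b) (Nm (Con p)) = ?DP"
    by (subst erase_upd) (auto simp: Collect_disj_eq intro!: arg_cong[where f = "\<lambda>U. _(_ \<mapsto> U)"])
  with typed_erase_con[OF ty1' pn(1)] have ty1'': "typed ?DP \<rho>1 P'" by metis
  have "erase ((erase \<Delta>2 (Nm (Con p)))(Cur \<mapsto> V2 \<union> {Srv b})) (Nm (Con p)) =
      (erase \<Delta>2 (Nm (Con p)))(Cur \<mapsto> {n \<in> V2 \<union> {Srv b}. Nm n \<noteq> Nm (Con p)})"
    by (subst erase_upd) auto
  with typed_erase_con[OF ty2' pn(2)]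
  have "typed ((erase \<Delta>2 (Nm (Con p)))(Cur \<mapsto> {n \<in> V2 \<union> {Srv b}. Nm n \<noteq> Nm (Con p)})) \<rho>2 Q'" by metis
  \<comment> \<open>As for a call, transitivity through \<open>b\<close> forces the receiver's
    \<open>Cur\<close> to grow; since \<open>p\<close> is in \<open>V\<close>, its old visibility
    \<open>V2\<close> lies inside \<open>V\<close>, so this is a weakening.\<close>
  then have ty2'': "typed ?DQ \<rho>2 Q'"
  proof (rule typed_weaken)
    show "vle {} ((erase \<Delta>2 (Nm (Con p)))(Cur \<mapsto> {n \<in> V2 \<union> {Srv b}. Nm n \<noteq> Nm (Con p)})) ?DQ"
      using \<open>V2 \<subseteq> V\<close> by (intro vle_upd) auto
    show "visfun ?DQ"
    proof (rule visfun_upd[OF visfun_erase[OF typed_visfun[OF ty2]]])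
      show "finite (?V \<union> {Srv b})" using visfun_finite[OF vis V] by simp
      show "W \<subseteq> ?V \<union> {Srv b}" if "n \<in> ?V \<union> {Srv b}" "erase \<Delta>2 (Nm (Con p)) (Nm n) = Some W" for n W
      proof -
        have "?E (Nm n) = Some W" using map_le_Some[OF map_le_erase[OF le(2)] that(2)] .
        moreover have "n \<noteq> Srv b" using that(2) none2 by (auto simp: erase_apply)
        ultimately show ?thesis using that(1) visfunD[OF visE VE, of n W] by auto
      qed
    qed auto
  qed
  obtain r where r: "Con r \<notin> supp ?E []" using ex_fresh_con[OF finite_supp[OF visE]] by blast
  let ?D = "?E(Cur \<mapsto> ?V \<union> {Srv b}, Nm (Srv b) \<mapsto> ?V \<union> {Srv b})"
  have "typed ?D \<tau> (Par P' Q')"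
  proof (rule typed_ParI[OF _ ty1'' ty2'' _ _ _ _ sh'])
    show "wf_env ?D \<tau>"
      using visfun_com(1)[OF visE VE frE r] st\<tau> by (simp only: wf_env_def)
    show "?DP \<subseteq>\<^sub>m ?D"
      using map_le_Some[OF map_le_erase[OF le(1), of "Nm (Con p)"]] unfolding erase_commute[of _ Cur]
      by (intro map_leI) (auto simp: erase_Cur split: if_splits)
    show "?DQ \<subseteq>\<^sub>m ?D"
      using map_le_Some[OF le(2)] none2 by (intro map_leI) (auto simp: erase_apply split: if_splits)
    show "dom ?D = dom ?DP \<union> dom ?DQ" using dom by auto
    show "dom ?DP \<inter> dom ?DQ \<subseteq> server_keys" using srv none2 by auto
  qed
  from typed_NuS_same[OF R[OF this], of b] have "typed (erase ?D (Nm (Srv b))) \<tau> (NuS b R)" .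
  moreover have "erase ?D (Nm (Srv b)) = ?E"
  proof
    fix k
    have bE: "Srv b \<notin> U" if "?E l = Some U" for l U using frE suppI(2)[of ?E, OF that] by blast
    have "?E (Nm (Srv b)) = None" using none by (simp add: erase_apply)
    then show "erase ?D (Nm (Srv b)) k = ?E k"
      using VE bE[OF VE] bE[of k] by (cases "?E k") (auto simp: erase_apply[of _ "Nm (Srv b)"])
  qed
  ultimately show ?thesis using \<tau>0(1) \<tau> by metis
qed

lemma good_moveI:
  fixes \<mu> :: "'v act"
  assumes "env_step \<Delta> \<sigma> \<mu> \<Delta>' \<sigma>'" "typed \<Delta>' \<sigma>' P'" "\<And>p v b. \<mu> = ACIn p v b \<Longrightarrow> (p, TI) \<in> set \<sigma>"
  shows "good \<Delta> \<sigma> \<mu> P'"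
  using assms unfolding good_def by blast

lemma stack_subset_supp: "Con ` fst ` set \<sigma> \<subseteq> supp \<Delta> \<sigma>"
  by (auto simp: supp_def)

text \<open>\<open>R\<close> stands for the parallel composition of the derivatives in either order,
  which settles both orientations of the communication. \<open>b\<close> and \<open>p\<close> are
  not free in the pruned processes and are bound in the result, so the environment may be assumed to
  avoid them.\<close>

lemma preserves_server_com:
  fixes P P' Q Q' R :: "'e proc"
  assumes P: "preserves P (ASOut a v b p) P'" and Q: "preserves Q (ASIn a v b p) Q'"
    and R: "\<And>\<Delta> \<sigma>. typed \<Delta> \<sigma> (Par P' Q') \<Longrightarrow> typed \<Delta> \<sigma> R"
  shows "preserves (Par P Q) Tau (NuS b (NuC p R))"
proof -
  from P obtain P0 where "prunes P (ASOut a v b p) P' P0"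
    unfolding preserves_def by blast
  note P0 = prunesD[OF this, unfolded bn.simps]
  from Q obtain Q0 where "prunes Q (ASIn a v b p) Q' Q0"
    unfolding preserves_def by blast
  note Q0 = prunesD[OF this, unfolded bn.simps]
  let ?R = "NuS b (NuC p R)"
  show ?thesis
  proof (rule preservesI)
    fix \<Delta> \<sigma> assume "typed \<Delta> \<sigma> (Par P Q)"
    then show "typed \<Delta> \<sigma> (Par P0 Q0)" by cases (blast intro: typed_Par P0(1) Q0(1))
  next
    fix \<Delta> \<sigma> assume ty: "typed \<Delta> \<sigma> (Par P0 Q0)"
    have "typed \<Delta> \<sigma> ?R"
    proof (rule typed_fresh_wlog[OF _ ty, where N = "{Srv b, Con p}"])
      show "{Srv b, Con p} \<inter> (fn (Par P0 Q0) \<union> fn ?R) = {}" using P0(2) Q0(2) by auto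
      fix \<Delta> \<sigma> assume "typed \<Delta> \<sigma> (Par P0 Q0)" "{Srv b, Con p} \<inter> supp \<Delta> \<sigma> = {}"
      then show "typed \<Delta> \<sigma> ?R"
        using typed_server_com[OF _ _ _ P0(3) Q0(3) R] by blast
    qed simp
    then show "good \<Delta> \<sigma> Tau ?R" by (rule good_moveI[OF env_Tau]) simp
  qed simp
qed

lemma preserves_con_com:
  fixes P P' Q Q' R :: "'e proc"
  assumes P: "preserves P (ACOut p v b) P'" and Q: "preserves Q (ACIn p v b) Q'"
    and R: "\<And>\<Delta> \<sigma>. typed \<Delta> \<sigma> (Par P' Q') \<Longrightarrow> typed \<Delta> \<sigma> R"
  shows "preserves (Par P Q) (Tau :: 'v act) (NuS b R)"
proof -
  from P obtain P0 where "prunes P (ACOut p v b) P' P0"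
    unfolding preserves_def by blast
  note P0 = prunesD[OF this, unfolded bn.simps]
  from Q obtain Q0 where "prunes Q (ACIn p v b) Q' Q0"
    unfolding preserves_def by blast
  note Q0 = prunesD[OF this, unfolded bn.simps]
  let ?R = "NuS b R"
  show ?thesis
  proof (rule preservesI)
    fix \<Delta> \<sigma> assume "typed \<Delta> \<sigma> (Par P Q)"
    then show "typed \<Delta> \<sigma> (Par P0 Q0)" by cases (blast intro: typed_Par P0(1) Q0(1))
  next
    fix \<Delta> \<sigma> assume ty: "typed \<Delta> \<sigma> (Par P0 Q0)"
    show "good \<Delta> \<sigma> (Tau :: 'v act) ?R"
    proof (rule good_fresh_wlog[OF _ ty, where N = "{Srv b}"])
      show "{Srv b} \<inter> (fn (Par P0 Q0) \<union> (act_names (Tau :: 'v act) \<union> fn ?R)) = {}"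
        using P0(2) Q0(2) by auto
      fix \<Delta> \<sigma> assume ty: "typed \<Delta> \<sigma> (Par P0 Q0)" and b: "{Srv b} \<inter> supp \<Delta> \<sigma> = {}"
      then have "Srv b \<notin> supp \<Delta> \<sigma>" by simp
      from typed_con_com[OF ty this P0(3) Q0(3) R]
      obtain \<tau> where "\<sigma> = (p, TO) # (p, TI) # \<tau>" "typed (erase \<Delta> (Nm (Con p))) \<tau> ?R" by blast
      then show "good \<Delta> \<sigma> (Tau :: 'v act) ?R" by (auto intro: good_moveI[OF env_Pair])
    qed simp_all
  qed simp
qed

lemma preserves_fo_com:
  fixes P P' Q Q' R :: "'e proc"
  assumes P: "preserves P \<mu> P'" and Q: "preserves Q \<mu>' Q'"
    and \<mu>: "\<mu> = AFOut h v \<and> \<mu>' = AFIn h v \<or> \<mu> = AFIn h v \<and> \<mu>' = AFOut h v"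
  shows "preserves (Par P Q) (Tau :: 'v act) (Par P' Q')"
proof -
  from P obtain P0 where "prunes P \<mu> P' P0"
    unfolding preserves_def by blast
  note P0 = prunesD[OF this]
  from Q obtain Q0 where "prunes Q \<mu>' Q' Q0"
    unfolding preserves_def by blast
  note Q0 = prunesD[OF this]
  have fo: "typed \<Delta> \<sigma> S" if "good \<Delta> \<sigma> \<nu> S" "\<nu> = AFOut h v \<or> \<nu> = AFIn h v"
    for \<Delta> \<sigma> and \<nu> :: "'x act" and h v and S :: "'e proc"
  proof -
    have "enabled \<Delta> \<sigma> \<nu>" using that(2) by (auto simp: enabled_def)
    with that(1) obtain \<Delta>' \<sigma>' where es: "env_step \<Delta> \<sigma> \<nu> \<Delta>' \<sigma>'" and ty: "typed \<Delta>' \<sigma>' S"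
      by (auto simp: good_def)
    from es that(2) have "\<Delta>' = \<Delta> \<and> \<sigma>' = \<sigma>" by cases auto
    with ty show ?thesis by simp
  qed
  have bn: "bn \<mu> = {}" "bn \<mu>' = {}" using \<mu> by auto
  show ?thesis
  proof (rule preservesI)
    fix \<Delta> \<sigma> assume ty: "typed \<Delta> \<sigma> (Par P Q)"
    then show "typed \<Delta> \<sigma> (Par P Q)" .
    from ty have "typed \<Delta> \<sigma> (Par P' Q')"
    proof cases
      case (typed_Par \<Delta>1 \<sigma>1 \<Delta>2 \<sigma>2)
      have "typed \<Delta>1 \<sigma>1 P'" using fo[OF P0(3)[OF P0(1)[OF typed_Par(2)]]] bn \<mu> by auto
      moreover have "typed \<Delta>2 \<sigma>2 Q'" using fo[OF Q0(3)[OF Q0(1)[OF typed_Par(3)]]] bn \<mu> by auto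
      ultimately show ?thesis using typed.typed_Par typed_Par by blast
    qed
    then show "good \<Delta> \<sigma> (Tau :: 'v act) (Par P' Q')" by (rule good_moveI[OF env_Tau]) simp
  qed simp
qed

subsection \<open>Restriction\<close>

text \<open>Undoing the erasure of \<open>m\<close> may bring back names of \<open>X\<close>, for
  they can occur in the old value at \<open>m\<close>. They are neither live in \<open>P\<close> nor
  in the stack, so they can be erased from \<open>\<Delta>0\<close> as well; \<Delta> avoids them
  and is unchanged by this.\<close>

lemma typed_avoid:
  assumes "finite X" "typed \<Delta>0 \<sigma> P" "erase \<Delta>0 (Nm m) = \<Delta>" "X \<inter> (fn P \<union> supp \<Delta> \<sigma>') = {}"
    "X \<inter> Con ` fst ` set \<sigma> = {}"
  shows "\<exists>\<Delta>1. typed \<Delta>1 \<sigma> P \<and> erase \<Delta>1 (Nm m) = \<Delta> \<and> X \<inter> supp \<Delta>1 \<sigma> = {}"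
  using assms
proof (induction X rule: finite_induct)
  case empty
  then show ?case by auto
next
  case (insert n X)
  then obtain \<Delta>1 where D: "typed \<Delta>1 \<sigma> P" "erase \<Delta>1 (Nm m) = \<Delta>" "X \<inter> supp \<Delta>1 \<sigma> = {}" by auto
  have "n \<notin> live_fn P" using insert.prems live_fn_subset[of P] by auto
  from typed_erase[OF D(1) this] have "typed (erase \<Delta>1 (Nm n)) \<sigma> P" .
  moreover have "erase (erase \<Delta>1 (Nm n)) (Nm m) = \<Delta>"
    using D(2) erase_fresh[of n \<Delta> \<sigma>'] insert.prems by (subst erase_commute) auto
  moreover have "n \<notin> supp (erase \<Delta>1 (Nm n)) \<sigma>" using insert.prems by (intro supp_erase_notin) auto
  ultimately show ?case using D(3) supp_erase[of \<Delta>1 "Nm n" \<sigma>] by blast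
qed

lemma finite_bn [simp]: "finite (bn \<mu>)"
  by (cases \<mu>) auto

text \<open>The transition chooses \<open>a'\<close> fresh for process and action only, so the
  environment is moved away from \<open>a'\<close>. Inversion then yields an environment for the
  body, which is cleared of the bound names of the action before the induction hypothesis is
  applied.\<close>

lemma preserves_NuS:
  fixes P P' :: "'e proc"
  assumes P: "preserves (swapS a a' P) \<mu> P'" and a': "Srv a' \<notin> fn (NuS a P)" "Srv a' \<notin> act_names \<mu>"
  shows "preserves (NuS a P) \<mu> (NuS a' P')"
proof -
  from P obtain P0 where "prunes (swapS a a' P) \<mu> P' P0"
    unfolding preserves_def by blast
  note P0 = prunesD[OF this]
  \<comment> \<open>\<open>P0\<close> is already opened at \<open>a'\<close>, and exchanging
    \<open>a'\<close> with itself does nothing.\<close>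
  have iff0: "typed \<Delta> \<sigma> (NuS a' P0) \<longleftrightarrow> wf_env \<Delta> \<sigma> \<and> (\<exists>\<Delta>0. erase \<Delta>0 (Nm (Srv a')) = \<Delta> \<and> typed \<Delta>0 \<sigma> P0)"
    if "Srv a' \<notin> supp \<Delta> \<sigma>" for \<Delta> \<sigma>
    using typed_NuS_iff[of a' \<Delta> \<sigma> a' P0] that by simp
  show ?thesis
  proof (rule preservesI)
    fix \<Delta> \<sigma> assume ty: "typed \<Delta> \<sigma> (NuS a P)"
    show "typed \<Delta> \<sigma> (NuS a' P0)"
    proof (rule typed_fresh_wlog[OF _ ty, where N = "{Srv a'}"])
      show "{Srv a'} \<inter> (fn (NuS a P) \<union> fn (NuS a' P0)) = {}" using a' by simp
      fix \<Delta> \<sigma> assume ty: "typed \<Delta> \<sigma> (NuS a P)" and "{Srv a'} \<inter> supp \<Delta> \<sigma> = {}"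
      then have fr: "Srv a' \<notin> supp \<Delta> \<sigma>" by simp
      then have "Srv a' \<notin> supp \<Delta> \<sigma> \<union> fn (NuS a P)" using a' by blast
      from ty[unfolded typed_NuS_iff[OF this]] P0(1) show "typed \<Delta> \<sigma> (NuS a' P0)"
        unfolding iff0[OF fr] by blast
    qed simp
  next
    show "bn \<mu> \<inter> fn (NuS a' P0) = {}" using P0(2) by auto
  next
    fix \<Delta> \<sigma> assume ty: "typed \<Delta> \<sigma> (NuS a' P0)" and bn: "bn \<mu> \<inter> supp \<Delta> \<sigma> = {}"
    let ?R = "NuS a' P'"
    show "good \<Delta> \<sigma> \<mu> ?R"
    proof (rule good_fresh_wlog[OF _ ty _ bn, where N = "{Srv a'}"])
      show "{Srv a'} \<inter> (fn (NuS a' P0) \<union> (act_names \<mu> \<union> fn ?R)) = {}" using a' by simp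
      fix \<Delta> \<sigma>
      assume ty: "typed \<Delta> \<sigma> (NuS a' P0)" and bn: "bn \<mu> \<inter> supp \<Delta> \<sigma> = {}" and "{Srv a'} \<inter> supp \<Delta> \<sigma> = {}"
      then have fr: "Srv a' \<notin> supp \<Delta> \<sigma>" by simp
      from ty[unfolded iff0[OF fr]] obtain \<Delta>0 where D0: "erase \<Delta>0 (Nm (Srv a')) = \<Delta>"
        "typed \<Delta>0 \<sigma> P0" by blast
      have "\<exists>\<Delta>1. typed \<Delta>1 \<sigma> P0 \<and> erase \<Delta>1 (Nm (Srv a')) = \<Delta> \<and> bn \<mu> \<inter> supp \<Delta>1 \<sigma> = {}"
        by (rule typed_avoid[OF finite_bn D0(2,1),
          where \<sigma>' = \<sigma>]) (use P0(2) bn stack_subset_supp[of \<sigma> \<Delta>] in blast)+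
      then obtain \<Delta>1 where D1: "typed \<Delta>1 \<sigma> P0" "erase \<Delta>1 (Nm (Srv a')) = \<Delta>"
        "bn \<mu> \<inter> supp \<Delta>1 \<sigma> = {}" by blast
      have g: "good \<Delta>1 \<sigma> \<mu> P'" by (rule P0(3)[OF D1(1,3)])
      show "good \<Delta> \<sigma> \<mu> ?R"
      proof (rule goodI)
        fix q v b assume "\<mu> = ACIn q v b"
        then show "(q, TI) \<in> set \<sigma>" using g by (auto simp: good_def)
      next
        assume "enabled \<Delta> \<sigma> \<mu>"
        then have "enabled \<Delta>1 \<sigma> \<mu>" unfolding D1(2)[symmetric] by simp
        with g obtain \<Delta>' \<sigma>' where *: "env_step \<Delta>1 \<sigma> \<mu> \<Delta>' \<sigma>'" "typed \<Delta>' \<sigma>' P'" by (auto simp: good_def)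
        from env_step_erase[OF *(1) a'(2)] typed_NuS_same[OF *(2), of a']
        show "\<exists>\<Delta>' \<sigma>'. env_step \<Delta> \<sigma> \<mu> \<Delta>' \<sigma>' \<and> typed \<Delta>' \<sigma>' ?R" unfolding D1(2) by blast
      qed
    qed simp
  qed
qed

lemma preserves_NuC:
  fixes P P' :: "'e proc"
  assumes P: "preserves (swapC p p' P) \<mu> P'" and p': "Con p' \<notin> fn (NuC p P)" "Con p' \<notin> act_names \<mu>"
  shows "preserves (NuC p P) \<mu> (NuC p' P')"
proof -
  from P obtain P0 where "prunes (swapC p p' P) \<mu> P' P0"
    unfolding preserves_def by blast
  note P0 = prunesD[OF this]
  have iff0: "typed \<Delta> \<sigma> (NuC p' P0) \<longleftrightarrow> wf_env \<Delta> \<sigma> \<and> (\<exists>\<Delta>0. erase \<Delta>0 (Nm (Con p')) = \<Delta> \<and> (typed \<Delta>0 \<sigma> P0 \<or>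
      (\<exists>\<sigma>1 \<sigma>2. \<sigma> = \<sigma>1 @ \<sigma>2 \<and> typed \<Delta>0 (\<sigma>1 @ (p', TO) # (p', TI) # \<sigma>2) P0)))"
    if "Con p' \<notin> supp \<Delta> \<sigma>" for \<Delta> \<sigma>
    using typed_NuC_iff[of p' \<Delta> \<sigma> p' P0] that by simp
  show ?thesis
  proof (rule preservesI)
    fix \<Delta> \<sigma> assume ty: "typed \<Delta> \<sigma> (NuC p P)"
    show "typed \<Delta> \<sigma> (NuC p' P0)"
    proof (rule typed_fresh_wlog[OF _ ty, where N = "{Con p'}"])
      show "{Con p'} \<inter> (fn (NuC p P) \<union> fn (NuC p' P0)) = {}" using p' by simp
      fix \<Delta> \<sigma> assume ty: "typed \<Delta> \<sigma> (NuC p P)" and "{Con p'} \<inter> supp \<Delta> \<sigma> = {}"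
      then have fr: "Con p' \<notin> supp \<Delta> \<sigma>" by simp
      then have "Con p' \<notin> supp \<Delta> \<sigma> \<union> fn (NuC p P)" using p' by blast
      from ty[unfolded typed_NuC_iff[OF this]] P0(1) show "typed \<Delta> \<sigma> (NuC p' P0)"
        unfolding iff0[OF fr] by blast
    qed simp
  next
    show "bn \<mu> \<inter> fn (NuC p' P0) = {}" using P0(2) by auto
  next
    fix \<Delta> \<sigma> assume ty: "typed \<Delta> \<sigma> (NuC p' P0)" and bn: "bn \<mu> \<inter> supp \<Delta> \<sigma> = {}"
    let ?R = "NuC p' P'"
    show "good \<Delta> \<sigma> \<mu> ?R"
    proof (rule good_fresh_wlog[OF _ ty _ bn, where N = "{Con p'}"])
      show "{Con p'} \<inter> (fn (NuC p' P0) \<union> (act_names \<mu> \<union> fn ?R)) = {}" using p' by simp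
      fix \<Delta> \<sigma>
      assume ty: "typed \<Delta> \<sigma> (NuC p' P0)" and bn: "bn \<mu> \<inter> supp \<Delta> \<sigma> = {}" and "{Con p'} \<inter> supp \<Delta> \<sigma> = {}"
      then have fr: "Con p' \<notin> supp \<Delta> \<sigma>" by simp
      have p_bn: "Con p' \<notin> bn \<mu>" using p'(2) bn_subset_act_names by blast
      have p_\<sigma>: "p' \<notin> fst ` set \<sigma>" using fr by (auto simp: supp_def)
      from ty[unfolded iff0[OF fr]] obtain \<Delta>0 \<sigma>0 where D0: "erase \<Delta>0 (Nm (Con p')) = \<Delta>" "typed \<Delta>0 \<sigma>0 P0"
        and \<sigma>0: "\<sigma>0 = \<sigma> \<or> (\<exists>\<sigma>1 \<sigma>2. \<sigma> = \<sigma>1 @ \<sigma>2 \<and> \<sigma>0 = \<sigma>1 @ (p', TO) # (p', TI) # \<sigma>2)" by blast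
      have "bn \<mu> \<inter> Con ` fst ` set \<sigma> = {}" using bn stack_subset_supp[of \<sigma> \<Delta>] by blast
      moreover have "fst ` set \<sigma>0 \<subseteq> insert p' (fst ` set \<sigma>)" using \<sigma>0 by auto
      ultimately have bn0: "bn \<mu> \<inter> Con ` fst ` set \<sigma>0 = {}" using p_bn by blast
      have "\<exists>\<Delta>1. typed \<Delta>1 \<sigma>0 P0 \<and> erase \<Delta>1 (Nm (Con p')) = \<Delta> \<and> bn \<mu> \<inter> supp \<Delta>1 \<sigma>0 = {}"
        by (rule typed_avoid[OF finite_bn D0(2,1), where \<sigma>' = \<sigma>]) (use P0(2) bn bn0 in blast)+
      then obtain \<Delta>1 where D1: "typed \<Delta>1 \<sigma>0 P0" "erase \<Delta>1 (Nm (Con p')) = \<Delta>"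
        "bn \<mu> \<inter> supp \<Delta>1 \<sigma>0 = {}" by blast
      have g: "good \<Delta>1 \<sigma>0 \<mu> P'" by (rule P0(3)[OF D1(1,3)])
      show "good \<Delta> \<sigma> \<mu> ?R"
      proof (rule goodI)
        fix q v b assume \<mu>: "\<mu> = ACIn q v b"
        then have "(q, TI) \<in> set \<sigma>0" "q \<noteq> p'" using g p'(2) by (auto simp: good_def)
        then show "(q, TI) \<in> set \<sigma>" using \<sigma>0 by auto
      next
        assume en: "enabled \<Delta> \<sigma> \<mu>"
        then have en1: "enabled \<Delta>1 \<sigma> \<mu>" unfolding D1(2)[symmetric] by simp
        from \<sigma>0 show "\<exists>\<Delta>' \<sigma>'. env_step \<Delta> \<sigma> \<mu> \<Delta>' \<sigma>' \<and> typed \<Delta>' \<sigma>' ?R"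
        proof
          assume \<sigma>0: "\<sigma>0 = \<sigma>"
          with g en1 obtain \<Delta>' \<sigma>' where *: "env_step \<Delta>1 \<sigma> \<mu> \<Delta>' \<sigma>'" "typed \<Delta>' \<sigma>' P'"
            by (auto simp: good_def)
          \<comment> \<open>A move pushes only names of the action, so \<open>p'\<close> remains
            absent from the stack.\<close>
          have "p' \<notin> fst ` set \<sigma>'" using *(1) p_\<sigma> p'(2) by cases auto
          from env_step_erase[OF *(1) p'(2)] typed_NuC_absent_same[OF *(2) this]
          show ?thesis unfolding D1(2) by blast
        next
          assume "\<exists>\<sigma>1 \<sigma>2. \<sigma> = \<sigma>1 @ \<sigma>2 \<and> \<sigma>0 = \<sigma>1 @ (p', TO) # (p', TI) # \<sigma>2"
          then obtain \<sigma>1 \<sigma>2 where \<sigma>: "\<sigma> = \<sigma>1 @ \<sigma>2" "\<sigma>0 = \<sigma>1 @ (p', TO) # (p', TI) # \<sigma>2" by blast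
          \<comment> \<open>The hidden pair changes the top of the stack only by sitting there
            itself. Then its p^O forces \<open>Cur\<close>, so the action is not an input at a
            server or continuation name.\<close>
          have "enabled \<Delta>1 \<sigma>0 \<mu>"
          proof (cases \<sigma>1)
            case Nil
            then have "Cur \<in> dom \<Delta>1" using typed_top_out[OF D1(1)] \<sigma>(2) by auto
            with en1 show ?thesis by (auto simp: enabled_def split: act.splits)
          next
            case (Cons x \<tau>)
            with en1 \<sigma> show ?thesis by (auto simp: enabled_def split: act.splits)
          qed
          with g obtain \<Delta>' \<sigma>' where *: "env_step \<Delta>1 \<sigma>0 \<mu> \<Delta>' \<sigma>'" "typed \<Delta>' \<sigma>' P'"
            by (auto simp: good_def)
          from env_step_remove_pair[OF *(1)[unfolded \<sigma>(2)] p'(2) typed_stack[OF *(2)]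
            typed_bottom_out[OF *(2)]]
          show ?thesis
          proof
            assume "\<exists>\<tau>1 \<tau>2. \<sigma>' = \<tau>1 @ (p', TO) # (p', TI) # \<tau>2 \<and> env_step \<Delta>1 (\<sigma>1 @ \<sigma>2) \<mu> \<Delta>' (\<tau>1 @ \<tau>2)"
            then obtain \<tau>1 \<tau>2 where \<tau>: "\<sigma>' = \<tau>1 @ (p', TO) # (p', TI) # \<tau>2"
              "env_step \<Delta>1 \<sigma> \<mu> \<Delta>' (\<tau>1 @ \<tau>2)"
              using \<sigma>(1) by blast
            from env_step_erase[OF \<tau>(2) p'(2)] typed_NuC_pair_same[OF *(2)[unfolded \<tau>(1)]]
            show ?thesis unfolding D1(2) by blast
          next
            \<comment> \<open>A reply at the restricted name: the pair is used up, and from outside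
              this is an internal step that changes neither \<Delta> nor
              \<open>\<sigma>\<close>.\<close>
            assume "\<mu> = Tau \<and> \<sigma>1 = [] \<and> \<sigma>' = \<sigma>2 \<and> \<Delta>' = erase \<Delta>1 (Nm (Con p'))"
            then have \<mu>: "\<mu> = Tau" and "typed \<Delta> \<sigma> P'" using *(2) \<sigma>(1) D1(2) by auto
            from typed_NuC_absent_same[OF this(2) p_\<sigma>] have "typed \<Delta> \<sigma> ?R"
              using erase_fresh[OF fr] by simp
            then show ?thesis unfolding \<mu> using env_step.env_Tau by blast
          qed
        qed
      qed
    qed simp
  qed
qed

subsection \<open>Preservation\<close>

lemma preserves_refl:
  "bn \<mu> \<inter> fn P = {} \<Longrightarrow> (\<And>\<Delta> \<sigma>. typed \<Delta> \<sigma> P \<Longrightarrow> bn \<mu> \<inter> supp \<Delta> \<sigma> = {} \<Longrightarrow> good \<Delta> \<sigma> \<mu> P') \<Longrightarrow> preserves P \<mu> P'"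
  by (rule preservesI)

lemma step_preserves: "step esub ev P \<mu> P' \<Longrightarrow> preserves P \<mu> P'"
proof (induction rule: step.induct)
  case (step_InS b' p' a x b p P v)
  show ?case
  proof (rule preserves_refl)
    show "bn (ASIn a v b' p') \<inter> fn (In (InS a x b p) P) = {}" using step_InS by simp
    fix \<Delta> \<sigma> assume ty: "typed \<Delta> \<sigma> (In (InS a x b p) P)" and fr: "bn (ASIn a v b' p') \<inter> supp \<Delta> \<sigma> = {}"
    have "{Srv b', Con p'} \<inter> (supp \<Delta> \<sigma> \<union> fn (In (InS a x b p) P)) = {}" using step_InS fr
      unfolding bn.simps by blast
    from ty[unfolded typed_InS_iff[OF this]] obtain V where V: "\<Delta> (Nm (Srv a)) = Some V"
      "typed (serve_env \<Delta> V b' p') ((p', TO) # \<sigma>) (swapSC b b' p p' P)" by blast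
    show "good \<Delta> \<sigma> (ASIn a v b' p') (psub esub x v (swapSC b b' p p' P))"
      by (rule good_moveI[OF env_SIn[where \<Delta> = \<Delta>, OF V(1)] typed_psub[OF V(2)]]) simp
  qed
next
  case (step_InC b' p x b P v)
  show ?case
  proof (rule preserves_refl)
    show "bn (ACIn p v b') \<inter> fn (In (InC p x b) P) = {}" using step_InC by simp
    fix \<Delta> \<sigma> assume ty: "typed \<Delta> \<sigma> (In (InC p x b) P)" and fr: "bn (ACIn p v b') \<inter> supp \<Delta> \<sigma> = {}"
    have fr': "Srv b' \<notin> supp \<Delta> \<sigma>" using fr by simp
    then have "Srv b' \<notin> supp \<Delta> \<sigma> \<union> fn (In (InC p x b) P)" using step_InC by blast
    from ty[unfolded typed_InC_iff[OF this]] obtain V q where \<sigma>: "\<sigma> = [(p, TI), (q, TO)]"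
      and V: "\<Delta> (Nm (Con p)) = Some V"
      and ty': "typed (\<Delta>(Nm (Con p) := None, Cur \<mapsto> V \<union> {Srv b'})) [(q, TO)] (swapS b b' P)" by blast
    have "p \<noteq> q" using typed_stack[OF ty] unfolding \<sigma> by (auto simp: is_stack_Cons)
    then have "typed (erase (\<Delta>(Nm (Con p) := None, Cur \<mapsto> V \<union> {Srv b'})) (Nm (Con p))) [(q, TO)]
      (swapS b b' P)"
      by (intro typed_erase_con[OF ty']) simp
    \<comment> \<open>The erasure also took \<open>p\<close> out of the value at \<open>Cur\<close>,
      where \<open>V\<close> may contain it; weakening restores it.\<close>
    then have "typed ((erase \<Delta> (Nm (Con p)))(Cur \<mapsto> V \<union> {Srv b'})) [(q, TO)] (swapS b b' P)"
    proof (rule typed_weaken)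
      show "visfun ((erase \<Delta> (Nm (Con p)))(Cur \<mapsto> V \<union> {Srv b'}))"
        by (rule visfun_con_input(1)[OF typed_visfun[OF ty] V fr'])
      show "vle {} (erase (\<Delta>(Nm (Con p) := None, Cur \<mapsto> V \<union> {Srv b'})) (Nm (Con p)))
        ((erase \<Delta> (Nm (Con p)))(Cur \<mapsto> V \<union> {Srv b'}))"
        unfolding vle_def by (auto simp: erase_apply split: if_splits)
    qed
    from typed_psub[OF this] show "good \<Delta> \<sigma> (ACIn p v b') (psub esub x v (swapS b b' P))"
      unfolding \<sigma> by (rule good_moveI[OF env_CIn[where \<Delta> = \<Delta>, OF V]]) simp
  qed
next
  case (step_InF h x P v)
  show ?case
  proof (rule preserves_refl)
    fix \<Delta> \<sigma> assume "typed \<Delta> \<sigma> (In (InF h x) P)"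
    then have "typed \<Delta> \<sigma> P" by cases auto
    from good_moveI[OF env_FIn typed_psub[OF this]] show "good \<Delta> \<sigma> (AFIn h v) (psub esub x v P)" by simp
  qed simp
next
  case (step_OutS e v b' p' a b p P)
  show ?case
  proof (rule preserves_refl)
    show "bn (ASOut a v b' p') \<inter> fn (OutS a e b p P) = {}" using step_OutS by simp
    fix \<Delta> \<sigma> assume ty: "typed \<Delta> \<sigma> (OutS a e b p P)" and fr: "bn (ASOut a v b' p') \<inter> supp \<Delta> \<sigma> = {}"
    have "{Srv b', Con p'} \<inter> (supp \<Delta> \<sigma> \<union> fn (OutS a e b p P)) = {}" using step_OutS fr
      unfolding bn.simps by blast
    from ty[unfolded typed_OutS_iff[OF this]] obtain V where V: "\<Delta> Cur = Some V" "Srv a \<in> V"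
      "typed (call_env \<Delta> V b' p') ((p', TI) # \<sigma>)
        (swapSC b b' p p' P)" by blast
    show "good \<Delta> \<sigma> (ASOut a v b' p') (swapSC b b' p p' P)"
      by (rule good_moveI[OF env_SOut[where \<Delta> = \<Delta>, OF V(1,2)] V(3)]) simp
  qed
next
  case (step_OutC e v b' p b P)
  show ?case
  proof (rule preserves_refl)
    show "bn (ACOut p v b') \<inter> fn (OutC p e b P) = {}" using step_OutC by simp
    fix \<Delta> \<sigma> assume ty: "typed \<Delta> \<sigma> (OutC p e b P)" and fr: "bn (ACOut p v b') \<inter> supp \<Delta> \<sigma> = {}"
    have "Srv b' \<notin> supp \<Delta> \<sigma> \<union> fn (OutC p e b P)" using step_OutC fr unfolding bn.simps by blast
    from ty[unfolded typed_OutC_iff[OF this]] obtain V \<sigma>' where \<sigma>: "\<sigma> = (p, TO) # \<sigma>'"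
      and V: "\<Delta> Cur = Some V" "Con p \<in> V"
      "typed (reply_env \<Delta> V b') \<sigma>' (swapS b b' P)" by blast
    show "good \<Delta> \<sigma> (ACOut p v b') (swapS b b' P)"
      unfolding \<sigma> by (rule good_moveI[OF env_COut[where \<Delta> = \<Delta>, OF V(1,2)] V(3)]) simp
  qed
next
  case (step_OutF e v h P)
  show ?case
  proof (rule preserves_refl)
    fix \<Delta> \<sigma> assume "typed \<Delta> \<sigma> (OutF h e P)"
    then have "typed \<Delta> \<sigma> P" by cases auto
    from good_moveI[OF env_FOut this] show "good \<Delta> \<sigma> (AFOut h v) P" by simp
  qed simp
next
  case (step_Succ w P)
  show ?case by (rule preserves_refl) (auto simp: good_def enabled_def)
next
  case (step_Rep \<alpha> P \<mu> P')
  show ?case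
  proof (rule preserves_mono[OF step_Rep.IH])
    fix \<Delta> \<sigma> assume ty: "typed \<Delta> \<sigma> (Rep \<alpha> P)"
    then obtain a x b p where \<alpha>: "\<alpha> = InS a x b p" by cases auto
    \<comment> \<open>A duplicable environment may be shared in full, so both copies receive all of
      \<Delta>, with empty stacks.\<close>
    from ty show "typed \<Delta> \<sigma> (Par (In \<alpha> P) (Rep \<alpha> P))"
      unfolding \<alpha> typed_RepS_iff
      by (intro typed_ParI[OF typed_wf[OF ty], of \<Delta> "[]" _ \<Delta>
        "[]"]) (auto simp: duplicable_def typed_RepS_iff)
  qed
next
  case (step_ParL P \<mu> P' Q)
  then show ?case by (intro preserves_ParL)
next
  case (step_ParR Q \<mu> Q' P)
  then show ?case by (intro preserves_ParR)
next
  case (step_ComSL P a v b p P' Q Q')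
  show ?case by (rule preserves_server_com[OF step_ComSL.IH])
next
  case (step_ComSR P a v b p P' Q Q')
  show ?case
    by (rule preserves_mono[OF preserves_server_com[OF step_ComSR.IH(2,1) typed_Par_commute]
      typed_Par_commute])
next
  case (step_ComCL P p v b P' Q Q')
  show ?case by (rule preserves_con_com[OF step_ComCL.IH])
next
  case (step_ComCR P p v b P' Q Q')
  show ?case
    by (rule preserves_mono[OF preserves_con_com[OF step_ComCR.IH(2,1) typed_Par_commute]
      typed_Par_commute])
next
  case (step_ComFL P h v P' Q Q')
  show ?case by (rule preserves_fo_com[OF step_ComFL.IH]) simp
next
  case (step_ComFR P h v P' Q Q')
  show ?case by (rule preserves_fo_com[OF step_ComFR.IH]) simp
next
  case (step_NuS a a' P \<mu> P')
  then show ?case by (intro preserves_NuS)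
next
  case (step_NuC p p' P \<mu> P')
  then show ?case by (intro preserves_NuC)
next
  case (step_NuF h h' P \<mu> P')
  show ?case
  proof (rule preserves_mono[OF step_NuF.IH])
    fix \<Delta> \<sigma> assume "typed \<Delta> \<sigma> (NuF h P)"
    then have "typed \<Delta> \<sigma> P" by cases
    then show "typed \<Delta> \<sigma> (swapF h h' P)" by (rule typed_ren_fresh) auto
  next
    fix \<Delta> \<sigma> assume "typed \<Delta> \<sigma> P'"
    then show "typed \<Delta> \<sigma> (NuF h' P')" by (intro typed_NuF typed_wf)
  qed
next
  case (step_SumL P \<mu> P' Q)
  show ?case by (rule preserves_mono[OF step_SumL.IH]) (erule typed.cases; simp)
next
  case (step_SumR Q \<mu> Q' P)
  show ?case by (rule preserves_mono[OF step_SumR.IH]) (erule typed.cases; simp)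
next
  case (step_Then e v f P \<mu> P' Q)
  show ?case by (rule preserves_mono[OF step_Then.IH]) (erule typed.cases; simp)
next
  case (step_Else e v f w Q \<mu> Q' P)
  show ?case by (rule preserves_mono[OF step_Else.IH]) (erule typed.cases; simp)
qed

theorem mainTheorem11:
  fixes efv :: "'e \<Rightarrow> var set"
    and esub :: "var \<Rightarrow> 'v \<Rightarrow> 'e \<Rightarrow> 'e"
    and ev :: "'e \<Rightarrow> 'v \<Rightarrow> bool"
    and \<Delta> :: vis and \<sigma> :: stack
    and P P' :: "'e proc" and \<mu> :: "'v act"
  assumes "expr_lang efv esub ev"
    and "visfun \<Delta>" and "is_stack \<sigma>"
    and "fv efv P = {}"
    and "typed \<Delta> \<sigma> P"
    and "step esub ev P \<mu> P'"
    and "bn \<mu> \<inter> supp \<Delta> \<sigma> = {}"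
  shows
    "(\<mu> = Tau \<longrightarrow>
        (\<exists>p \<sigma>''. \<sigma> = (p, TO) # (p, TI) # \<sigma>'' \<and> Con p \<notin> live_fn P' \<and>
           typed (erase \<Delta> (Nm (Con p))) \<sigma>'' P') \<or>
        typed \<Delta> \<sigma> P') \<and>
     (\<forall>a v b p. \<mu> = ASOut a v b p \<longrightarrow>
        (\<exists>V. \<Delta> Cur = Some V \<and> Srv a \<in> V \<and>
           typed ((erase \<Delta> Cur)(Nm (Srv b) \<mapsto> V \<union> {Srv b}, Nm (Con p) \<mapsto> V \<union> {Srv b}))
             ((p, TI) # \<sigma>) P')) \<and>
     (\<forall>p v b. \<mu> = ACOut p v b \<longrightarrow>
        (\<exists>\<sigma>'' V. \<sigma> = (p, TO) # \<sigma>'' \<and> \<Delta> Cur = Some V \<and> Con p \<in> V \<and>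
           typed ((erase \<Delta> Cur)(Nm (Srv b) \<mapsto> V \<union> {Srv b})) \<sigma>'' P')) \<and>
     (\<forall>a v b p. \<mu> = ASIn a v b p \<and> Cur \<notin> dom \<Delta> \<longrightarrow>
        (\<exists>V. \<Delta> (Nm (Srv a)) = Some V \<and>
           typed (\<Delta>(Cur \<mapsto> V \<union> {Srv b, Con p})) ((p, TO) # \<sigma>) P')) \<and>
     (\<forall>p v b. \<mu> = ACIn p v b \<and> Cur \<notin> dom \<Delta> \<and> (\<exists>\<sigma>'. \<sigma> = (p, TI) # \<sigma>') \<longrightarrow>
        (\<exists>q \<sigma>'' V. \<sigma> = (p, TI) # (q, TO) # \<sigma>'' \<and> \<Delta> (Nm (Con p)) = Some V \<and>
           typed ((erase \<Delta> (Nm (Con p)))(Cur \<mapsto> V \<union> {Srv b})) ((q, TO) # \<sigma>'') P')) \<and>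
     (\<forall>h v. \<mu> = AFIn h v \<or> \<mu> = AFOut h v \<and> Cur \<notin> dom \<Delta> \<longrightarrow> typed \<Delta> \<sigma> P')"
proof -
  from step_preserves[OF assms(6)] obtain P0 where "prunes P \<mu> P' P0"
    unfolding preserves_def by blast
  note P0 = prunesD[OF this]
  have "good \<Delta> \<sigma> \<mu> P'" by (rule P0(3)[OF P0(1)[OF assms(5)] assms(7)])
  then have move: "\<exists>\<Delta>' \<sigma>'. env_step \<Delta> \<sigma> \<mu> \<Delta>' \<sigma>' \<and> typed \<Delta>' \<sigma>' P'" if "enabled \<Delta> \<sigma> \<mu>"
    using that by (simp add: good_def)
  show ?thesis
  proof (intro conjI allI impI)
    assume \<mu>: "\<mu> = Tau"
    then obtain \<Delta>' \<sigma>' where es: "env_step \<Delta> \<sigma> (Tau :: 'v act) \<Delta>' \<sigma>'" and ty: "typed \<Delta>' \<sigma>' P'"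
      using move by (auto simp: enabled_def)
    from es show "(\<exists>p \<sigma>''. \<sigma> = (p, TO) # (p, TI) # \<sigma>'' \<and> Con p \<notin> live_fn P' \<and>
           typed (erase \<Delta> (Nm (Con p))) \<sigma>'' P') \<or> typed \<Delta> \<sigma> P'"
    proof cases
      case env_Tau
      then show ?thesis using ty by simp
    next
      case (env_Pair p)
      have "(p, TO) \<notin> set \<sigma>'" "(p, TI) \<notin> set \<sigma>'"
        using assms(3) unfolding env_Pair(1) by (auto simp: is_stack_Cons)
      then have "p \<notin> fst ` set \<sigma>'" by (auto, metis tag.exhaust)
      then have "Con p \<notin> live_fn P'" using live_con_in_stack[OF ty] by blast
      then show ?thesis using env_Pair ty by blast
    qed
  next
    fix a v b p assume "\<mu> = ASOut a v b p"
    then obtain \<Delta>' \<sigma>' where "env_step \<Delta> \<sigma> (ASOut a v b p) \<Delta>' \<sigma>'" and ty: "typed \<Delta>' \<sigma>' P'"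
      using move by (auto simp: enabled_def)
    then show "\<exists>V. \<Delta> Cur = Some V \<and> Srv a \<in> V \<and>
        typed (call_env \<Delta> V b p) ((p, TI) # \<sigma>) P'"
      by cases (use ty in blast)
  next
    fix p v b assume "\<mu> = ACOut p v b"
    then obtain \<Delta>' \<sigma>' where "env_step \<Delta> \<sigma> (ACOut p v b) \<Delta>' \<sigma>'" and ty: "typed \<Delta>' \<sigma>' P'"
      using move by (auto simp: enabled_def)
    then show "\<exists>\<sigma>'' V. \<sigma> = (p, TO) # \<sigma>'' \<and> \<Delta> Cur = Some V \<and> Con p \<in> V \<and>
        typed (reply_env \<Delta> V b) \<sigma>'' P'"
      by cases (use ty in blast)
  next
    fix a v b p assume "\<mu> = ASIn a v b p \<and> Cur \<notin> dom \<Delta>"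
    then obtain \<Delta>' \<sigma>' where "env_step \<Delta> \<sigma> (ASIn a v b p) \<Delta>' \<sigma>'" and ty: "typed \<Delta>' \<sigma>' P'"
      using move by (auto simp: enabled_def)
    then show "\<exists>V. \<Delta> (Nm (Srv a)) = Some V \<and> typed (serve_env \<Delta> V b p) ((p, TO) # \<sigma>) P'"
      by cases (use ty in blast)
  next
    fix p v b assume "\<mu> = ACIn p v b \<and> Cur \<notin> dom \<Delta> \<and> (\<exists>\<sigma>'. \<sigma> = (p, TI) # \<sigma>')"
    then obtain \<Delta>' \<sigma>' where "env_step \<Delta> \<sigma> (ACIn p v b) \<Delta>' \<sigma>'" and ty: "typed \<Delta>' \<sigma>' P'"
      using move by (auto simp: enabled_def)
    then show "\<exists>q \<sigma>'' V. \<sigma> = (p, TI) # (q, TO) # \<sigma>'' \<and> \<Delta> (Nm (Con p)) = Some V \<and>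
        typed ((erase \<Delta> (Nm (Con p)))(Cur \<mapsto> V \<union> {Srv b})) ((q, TO) # \<sigma>'') P'"
      by cases (use ty in blast)
  next
    fix h v assume \<mu>: "\<mu> = AFIn h v \<or> \<mu> = AFOut h v \<and> Cur \<notin> dom \<Delta>"
    then have "enabled \<Delta> \<sigma> \<mu>" by (auto simp: enabled_def)
    from move[OF this] obtain \<Delta>' \<sigma>' where es: "env_step \<Delta> \<sigma> \<mu> \<Delta>' \<sigma>'" and ty: "typed \<Delta>' \<sigma>' P'"
      by blast
    from es \<mu> have "\<Delta>' = \<Delta> \<and> \<sigma>' = \<sigma>" by cases auto
    with ty show "typed \<Delta> \<sigma> P'" by simp
  qed
qed

end
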